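(* Let $V$ be the complex vector bundle with volume form and $L\subset V$ the line subbundle induced by a higher complex structure on a closed surface $S$, and let $h$ be an $L$-compatible Hermitian structure on $V$. Consider a family of connections $M(\lambda)=\sum_{i=-N}^NA_i\lambda^i$, $\lambda\in\mathbb{C}^*$, where $A_0$ is a connection on $V$ and $A_i\in\Omega^1(S,\mathfrak{sl}(V))$ for all other $i$. Suppose that $M(\lambda)=-M(-1/\bar\lambda)^{*_h}$. Then $M(\lambda)$ is flat for all $\lambda\in\mathbb{C}^*$ if and only if it is $L$-parabolic for all $\lambda\in\mathbb{C}^*$.
   Context: A higher complex structure of order $n$ on $S$ is a section $I$ of the bundle with fibers the punctual Hilbert scheme zero-fiber $\mathrm{Hilb}^n_0(T_z^{*\mathbb{C}}S)$ (ideals of codimension $n$ in $\mathbb{C}[p,\bar p]$ supported at the origin) with $I(z)+\bar I(z)=\langle p,\bar p\rangle$ at each point; it induces a complex structure on $S$ with canonical bundle $K$. With $K^{1/2}$ fixed, $V$ is the rank-$n$ bundle with fiber $\mathbb{C}[p,\bar p]/I(z)$ tensored with $K^{(n-1)/2}$, and $L\subset V$ is the line spanned by constants tensored with $K^{(n-1)/2}$. $V$ is equipped with a volume form and connections are $\mathfrak{sl}_n(\mathbb{C})$-connections. $M^{*_h}$ is the $h$-adjoint and $\rho(M)=-M^{*_h}$ is the corresponding Lie algebra involution of $\mathfrak{sl}(V)$; $\mathfrak{sl}(V)^{-\rho}$ is the set of $M\in\mathfrak{sl}(V)$ with $M^{*_h}=M$. $\mathfrak{p}_L\subset\mathfrak{sl}(V)$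 is the parabolic subalgebra of endomorphisms preserving $L$ and $\mathfrak{p}_L^*$ its trace dual, i.e. the set of $N\in\mathfrak{sl}(V)$ with $\operatorname{tr}(NM)=0$ for all $M\in\mathfrak{p}_L$. (In a frame with first vector in $L$: matrices whose only nonzero entries are in positions $(1,2),\dots,(1,n)$.) $h$ is $L$-compatible if $\mathfrak{p}_L^*\cap\mathfrak{sl}(V)^{-\rho}=\{0\}$. A connection with curvature $F$ is $L$-parabolic if $\int_S\operatorname{tr}(FM)=0$ for all $M\in\mathcal{C}^\infty(S,\mathfrak{sl}(V))$ preserving $L$, equivalently if $F$ takes values in $\mathfrak{p}_L^*$. The condition $M(\lambda)=-M(-1/\bar\lambda)^{*_h}$ means that $A_0$ is an $h$-unitary connection and $A_{-k}=(-1)^{k+1}A_k^{*_h}$ for all $k>0$. *)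

theory Defs
  imports "HOL-Analysis.Analysis" "HOL-Computational_Algebra.Polynomial"
begin

section \<open>Smooth functions on surfaces\<close>

text \<open>
  Only used on open sets, where it is the usual notion of a map of class \<open>C^k\<close>.
\<close>

primrec Ck_on ::
    "nat \<Rightarrow> ('a::real_normed_vector \<Rightarrow> 'b::real_normed_vector) \<Rightarrow> 'a set \<Rightarrow> bool" where
  "Ck_on 0 f U \<longleftrightarrow> continuous_on U f"
| "Ck_on (Suc k) f U \<longleftrightarrow>
     f differentiable_on U \<and> (\<forall>v. Ck_on k (\<lambda>x. frechet_derivative f (at x) v) U)"

definition smooth_on ::
    "'a::real_normed_vector set \<Rightarrow> ('a \<Rightarrow> 'b::real_normed_vector) \<Rightarrow> bool" where
  "smooth_on U f \<longleftrightarrow> (\<forall>k. Ck_on k f U)"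

text \<open>
  A chart is a domain \<open>U\<close> with a coordinate map, regarded as meaningful on \<open>U\<close> only. The plane
  of coordinates is \<open>complex\<close> as a real vector space; no holomorphy is implied.
\<close>

type_synonym 'a chart = "'a set \<times> ('a \<Rightarrow> complex)"

definition chart_image :: "'a chart \<Rightarrow> 'a set \<Rightarrow> complex set" where
  "chart_image c W = snd c ` (fst c \<inter> W)"

definition chart_inv :: "'a chart \<Rightarrow> complex \<Rightarrow> 'a" where
  "chart_inv c = inv_into (fst c) (snd c)"

text \<open>
  A closed surface: a compact Hausdorff space (the whole type) with a smooth atlas of charts onto
  open subsets of the plane. Second countability follows from compactness. The atlas need not be
  maximal.
\<close>

definition closed_surface :: "'a::t2_space chart set \<Rightarrow> bool" where
  "closed_surface \<A> \<longleftrightarrow>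
     compact (UNIV :: 'a set) \<and>
     (\<Union>c\<in>\<A>. fst c) = UNIV \<and>
     (\<forall>c\<in>\<A>. open (fst c) \<and> open (chart_image c UNIV) \<and>
        homeomorphism (fst c) (chart_image c UNIV) (snd c) (chart_inv c)) \<and>
     (\<forall>c\<in>\<A>. \<forall>d\<in>\<A>. smooth_on (chart_image c (fst d)) (snd d \<circ> chart_inv c))"

definition smooth_fn ::
    "'a chart set \<Rightarrow> 'a set \<Rightarrow> ('a \<Rightarrow> 'b::real_normed_vector) \<Rightarrow> bool" where
  "smooth_fn \<A> W f \<longleftrightarrow> (\<forall>c\<in>\<A>. smooth_on (chart_image c W) (f \<circ> chart_inv c))"

text \<open>The derivative of \<open>f\<close> at \<open>x\<close> along the tangent vector with components \<open>v\<close> in the chart \<open>c\<close>.\<close>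

definition cderiv ::
    "'a chart \<Rightarrow> ('a \<Rightarrow> 'b::real_normed_vector) \<Rightarrow> 'a \<Rightarrow> complex \<Rightarrow> 'b" where
  "cderiv c f x v = frechet_derivative (f \<circ> chart_inv c) (at (snd c x)) v"

text \<open>
  The differential of the coordinate change from \<open>c\<close> to \<open>d\<close>, and its Wirtinger components
  \<open>\<partial>w/\<partial>z\<close> and \<open>\<partial>w/\<partial>zbar\<close>, where \<open>z\<close> and \<open>w\<close> are the coordinates of \<open>c\<close> and \<open>d\<close>.
\<close>

definition transD :: "'a chart \<Rightarrow> 'a chart \<Rightarrow> 'a \<Rightarrow> complex \<Rightarrow> complex" where
  "transD c d x v = cderiv c (snd d) x v"

definition trans_z :: "'a chart \<Rightarrow> 'a chart \<Rightarrow> 'a \<Rightarrow> complex" where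
  "trans_z c d x = (transD c d x 1 - \<i> * transD c d x \<i>) / 2"

definition trans_zbar :: "'a chart \<Rightarrow> 'a chart \<Rightarrow> 'a \<Rightarrow> complex" where
  "trans_zbar c d x = (transD c d x 1 + \<i> * transD c d x \<i>) / 2"


section \<open>The ring of polynomials in \<open>p\<close> and \<open>pbar\<close>\<close>

text \<open>
  \<open>\<complex>[p, pbar]\<close> as \<open>\<complex>[p][pbar]\<close>: the coefficient of \<open>p^i pbar^j\<close> in \<open>f\<close> is
  \<open>coeff (coeff f j) i\<close>.
\<close>

type_synonym poly2 = "complex poly poly"

definition const2 :: "complex \<Rightarrow> poly2" where "const2 a = [:[:a:]:]"

definition var_p :: poly2 where "var_p = [:[:0, 1:]:]"

definition var_pbar :: poly2 where "var_pbar = [:0, 1:]"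

definition coeff2 :: "poly2 \<Rightarrow> nat \<Rightarrow> nat \<Rightarrow> complex" where
  "coeff2 f i j = coeff (coeff f j) i"

definition eval2 :: "poly2 \<Rightarrow> complex \<Rightarrow> complex \<Rightarrow> complex" where
  "eval2 f u v = poly (poly f [:v:]) u"

text \<open>The substitution \<open>p := P\<close>, \<open>pbar := Q\<close>.\<close>

definition subst2 :: "poly2 \<Rightarrow> poly2 \<Rightarrow> poly2 \<Rightarrow> poly2" where
  "subst2 P Q f = poly (map_poly (\<lambda>g. poly (map_poly const2 g) P) f) Q"

text \<open>Complex conjugation: it conjugates coefficients and exchanges \<open>p\<close> and \<open>pbar\<close>.\<close>

definition conj2 :: "poly2 \<Rightarrow> poly2" where
  "conj2 f = subst2 var_pbar var_p (map_poly (map_poly cnj) f)"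

text \<open>Ideals are the submodules of the ring regarded as a module over itself.\<close>

definition is_ideal :: "poly2 set \<Rightarrow> bool" where
  "is_ideal J \<longleftrightarrow> module.subspace (*) J"

definition ideal_gen :: "poly2 set \<Rightarrow> poly2 set" where
  "ideal_gen B = module.span (*) B"

text \<open>
  The classes of the \<open>b k\<close>, for \<open>k\<close> in the finite set \<open>K\<close>, form a basis of the complex vector
  space \<open>\<complex>[p, pbar]/J\<close>; and the coordinates of the class of \<open>f\<close> in this basis.
\<close>

definition is_coords ::
    "poly2 set \<Rightarrow> 'k set \<Rightarrow> ('k \<Rightarrow> poly2) \<Rightarrow> poly2 \<Rightarrow> ('k \<Rightarrow> complex) \<Rightarrow> bool" where
  "is_coords J K b f a \<longleftrightarrow>
     (\<forall>k. k \<notin> K \<longrightarrow> a k = 0) \<and> f - (\<Sum>k\<in>K. const2 (a k) * b k) \<in> J"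

definition basis_mod :: "poly2 set \<Rightarrow> 'k set \<Rightarrow> ('k \<Rightarrow> poly2) \<Rightarrow> bool" where
  "basis_mod J K b \<longleftrightarrow> finite K \<and> (\<forall>f. \<exists>!a. is_coords J K b f a)"

definition coords :: "poly2 set \<Rightarrow> 'k set \<Rightarrow> ('k \<Rightarrow> poly2) \<Rightarrow> poly2 \<Rightarrow> 'k \<Rightarrow> complex" where
  "coords J K b f = (THE a. is_coords J K b f a)"

text \<open>
  The points of the zero-fibre of the punctual Hilbert scheme: ideals of codimension \<open>n\<close> whose
  zero locus is the origin.
\<close>

definition hilb0 :: "nat \<Rightarrow> poly2 set set" where
  "hilb0 n = {J. is_ideal J \<and> (\<exists>b. basis_mod J {..<n} b) \<and>
                 {(u, v). \<forall>f\<in>J. eval2 f u v = 0} = {(0, 0)}}"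


section \<open>Higher complex structures\<close>

text \<open>
  The data from which \<open>V\<close> is built.

  The ideal \<open>I(x)\<close> is recorded in each chart. In a chart with coordinate \<open>z\<close>, the linear
  coordinates \<open>p\<close> and \<open>pbar\<close> of the complexified cotangent spaces are \<open>\<partial>/\<partial>z\<close> and \<open>\<partial>/\<partial>zbar\<close>.

  The half-canonical bundle is recorded by a cocycle: nowhere vanishing sections \<open>\<theta>\<^sub>j\<close> of
  \<open>K^(1/2)\<close> over the sets \<open>hc_dom j\<close>, with \<open>\<theta>\<^sub>j = hc_trans j k \<cdot> \<theta>\<^sub>k\<close>, whose squares are the
  sections \<open>hc_form j\<close> of \<open>K\<close>. The value \<open>(u, v)\<close> of \<open>hc_form j c x\<close> stands for the covector
  \<open>u dz + v dzbar\<close> in the chart \<open>c\<close>.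
\<close>

record ('a, 'j) hcs =
  atlas :: "'a chart set"
  hideal :: "'a chart \<Rightarrow> 'a \<Rightarrow> poly2 set"
  hc_index :: "'j set"
  hc_dom :: "'j \<Rightarrow> 'a set"
  hc_form :: "'j \<Rightarrow> 'a chart \<Rightarrow> 'a \<Rightarrow> complex \<times> complex"
  hc_trans :: "'j \<Rightarrow> 'j \<Rightarrow> 'a \<Rightarrow> complex"

text \<open>
  The identification of polynomials in the coordinates of \<open>c\<close> with polynomials in the
  coordinates of \<open>d\<close>, from \<open>\<partial>/\<partial>z = (\<partial>w/\<partial>z) \<partial>/\<partial>w + (\<partial>wbar/\<partial>z) \<partial>/\<partial>wbar\<close> and its conjugate.
\<close>

definition chg :: "'a chart \<Rightarrow> 'a chart \<Rightarrow> 'a \<Rightarrow> poly2 \<Rightarrow> poly2" where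
  "chg c d x f = subst2
     (const2 (trans_z c d x) * var_p + const2 (cnj (trans_zbar c d x)) * var_pbar)
     (const2 (trans_zbar c d x) * var_p + const2 (cnj (trans_z c d x)) * var_pbar) f"

text \<open>
  A section of the bundle of zero-fibres of punctual Hilbert schemes. Smoothness means that near
  every point some fixed polynomials are a basis of all the quotients, and that the coordinates
  of every fixed polynomial in this basis are smooth functions; these coordinates are the standard
  coordinate functions of the Hilbert scheme.
\<close>

definition hilb0_section :: "nat \<Rightarrow> ('a::t2_space, 'j) hcs \<Rightarrow> bool" where
  "hilb0_section n X \<longleftrightarrow>
     (\<forall>c\<in>atlas X. \<forall>x\<in>fst c. hideal X c x \<in> hilb0 n) \<and>
     (\<forall>c\<in>atlas X. \<forall>d\<in>atlas X. \<forall>x\<in>fst c \<inter> fst d. \<forall>f.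
        f \<in> hideal X c x \<longleftrightarrow> chg c d x f \<in> hideal X d x) \<and>
     (\<forall>c\<in>atlas X. \<forall>x\<in>fst c. \<exists>W b. open W \<and> x \<in> W \<and> W \<subseteq> fst c \<and>
        (\<forall>y\<in>W. basis_mod (hideal X c y) {..<n} b) \<and>
        (\<forall>f. \<forall>i<n. smooth_fn (atlas X) W (\<lambda>y. coords (hideal X c y) {..<n} b f i)))"

definition higher_complex_structure :: "nat \<Rightarrow> ('a::t2_space, 'j) hcs \<Rightarrow> bool" where
  "higher_complex_structure n X \<longleftrightarrow>
     hilb0_section n X \<and>
     (\<forall>c\<in>atlas X. \<forall>x\<in>fst c.
        {f + conj2 g | f g. f \<in> hideal X c x \<and> g \<in> hideal X c x} = ideal_gen {var_p, var_pbar})"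

text \<open>
  The induced complex structure: the linear parts \<open>a \<partial>/\<partial>z + b \<partial>/\<partial>zbar\<close> of the elements of \<open>I(x)\<close>
  are the tangent vectors of type \<open>(0,1)\<close>, and the canonical line consists of the covectors
  annihilating them.
\<close>

definition canonical_line :: "('a, 'j) hcs \<Rightarrow> 'a chart \<Rightarrow> 'a \<Rightarrow> (complex \<times> complex) set" where
  "canonical_line X c x =
     {(u, v). \<forall>f\<in>hideal X c x. u * coeff2 f 1 0 + v * coeff2 f 0 1 = 0}"

text \<open>
  The sign of the chart \<open>c\<close> at \<open>x\<close> for the orientation of the induced complex structure: if
  \<open>dw = u dz + v dzbar\<close> spans the canonical line, then \<open>dw \<and> dwbar = (|u|^2 - |v|^2) dz \<and> dzbar\<close>.
\<close>

definition chart_sign :: "('a, 'j) hcs \<Rightarrow> 'a chart \<Rightarrow> 'a \<Rightarrow> real" where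
  "chart_sign X c x = (if \<exists>(u, v)\<in>canonical_line X c x. cmod v < cmod u then 1 else -1)"

definition half_canonical :: "('a::t2_space, 'j) hcs \<Rightarrow> bool" where
  "half_canonical X \<longleftrightarrow>
     (\<Union>j\<in>hc_index X. hc_dom X j) = UNIV \<and>
     (\<forall>j\<in>hc_index X. open (hc_dom X j)) \<and>
     (\<forall>j\<in>hc_index X. \<forall>c\<in>atlas X.
        smooth_fn (atlas X) (fst c \<inter> hc_dom X j) (hc_form X j c) \<and>
        (\<forall>x\<in>fst c \<inter> hc_dom X j. hc_form X j c x \<in> canonical_line X c x - {(0, 0)})) \<and>
     (\<forall>j\<in>hc_index X. \<forall>c\<in>atlas X. \<forall>d\<in>atlas X. \<forall>x\<in>fst c \<inter> fst d \<inter> hc_dom X j.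
        let (u, v) = hc_form X j d x in
        hc_form X j c x = (u * trans_z c d x + v * cnj (trans_zbar c d x),
                           u * trans_zbar c d x + v * cnj (trans_z c d x))) \<and>
     (\<forall>j\<in>hc_index X. \<forall>k\<in>hc_index X.
        smooth_fn (atlas X) (hc_dom X j \<inter> hc_dom X k) (hc_trans X j k) \<and>
        (\<forall>x\<in>hc_dom X j \<inter> hc_dom X k. hc_trans X j k x \<noteq> 0) \<and>
        (\<forall>c\<in>atlas X. \<forall>x\<in>fst c \<inter> hc_dom X j \<inter> hc_dom X k.
           let (u, v) = hc_form X k c x in
           hc_form X j c x = ((hc_trans X j k x)\<^sup>2 * u, (hc_trans X j k x)\<^sup>2 * v))) \<and>
     (\<forall>j\<in>hc_index X. \<forall>k\<in>hc_index X. \<forall>l\<in>hc_index X.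
        \<forall>x\<in>hc_dom X j \<inter> hc_dom X k \<inter> hc_dom X l.
          hc_trans X j k x * hc_trans X k l x = hc_trans X j l x)"


section \<open>The bundle \<open>V\<close> and the line subbundle \<open>L\<close>\<close>

text \<open>
  A local trivialisation of \<open>V\<close> over the open set \<open>tdom s\<close>: a coordinate chart, a local
  section \<open>\<theta>\<^sub>j\<close> of \<open>K^(1/2)\<close>, and polynomials \<open>tframe s k x\<close> (in the coordinates of the chart) such
  that the classes of \<open>tframe s k x\<close> modulo \<open>I(x)\<close>, tensored with \<open>\<theta>\<^sub>j^(n-1)\<close>, form a smooth frame
  of \<open>V\<close>. The rank \<open>n\<close> is \<open>CARD('n)\<close>.

  Sections of bundles associated with \<open>V\<close> are given by their matrices in all such
  trivialisations, together with the transformation law between them. Values outside of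
  \<open>tdom s\<close> are irrelevant.
\<close>

record ('a, 'j, 'n) triv =
  tdom :: "'a set"
  tchart :: "'a chart"
  tindex :: 'j
  tframe :: "'n \<Rightarrow> 'a \<Rightarrow> poly2"

definition trivs :: "('a::t2_space, 'j) hcs \<Rightarrow> ('a, 'j, 'n::finite) triv set" where
  "trivs X = {s. open (tdom s) \<and> tchart s \<in> atlas X \<and> tindex s \<in> hc_index X \<and>
     tdom s \<subseteq> fst (tchart s) \<inter> hc_dom X (tindex s) \<and>
     (\<forall>k i j. smooth_fn (atlas X) (tdom s) (\<lambda>x. coeff2 (tframe s k x) i j)) \<and>
     (\<forall>x\<in>tdom s. basis_mod (hideal X (tchart s) x) UNIV (\<lambda>k. tframe s k x))}"

text \<open>
  The transition matrix: if \<open>v\<close> is the coordinate vector of an element of the fibre \<open>V\<^sub>x\<close> in the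
  trivialisation \<open>s\<close>, then \<open>transT X s s' x *v v\<close> is its coordinate vector in \<open>s'\<close>.
\<close>

definition transT ::
    "('a, 'j) hcs \<Rightarrow> ('a, 'j, 'n::finite) triv \<Rightarrow> ('a, 'j, 'n) triv \<Rightarrow> 'a \<Rightarrow> complex^'n^'n" where
  "transT X s s' x = (\<chi> i k.
     coords (hideal X (tchart s') x) UNIV (\<lambda>l. tframe s' l x)
       (const2 (hc_trans X (tindex s) (tindex s') x ^ (CARD('n) - 1)) *
        chg (tchart s) (tchart s') x (tframe s k x)) i)"

definition line_L ::
    "('a, 'j) hcs \<Rightarrow> ('a, 'j, 'n::finite) triv \<Rightarrow> 'a \<Rightarrow> (complex^'n) set" where
  "line_L X s x = {v. \<exists>a. (\<Sum>k\<in>UNIV. const2 (v $ k) * tframe s k x) - const2 a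
                            \<in> hideal X (tchart s) x}"

definition volume_form ::
    "('a::t2_space, 'j) hcs \<Rightarrow> (('a, 'j, 'n::finite) triv \<Rightarrow> 'a \<Rightarrow> complex) \<Rightarrow> bool" where
  "volume_form X vol \<longleftrightarrow>
     (\<forall>s\<in>trivs X. smooth_fn (atlas X) (tdom s) (vol s) \<and> (\<forall>x\<in>tdom s. vol s x \<noteq> 0)) \<and>
     (\<forall>s\<in>trivs X. \<forall>s'\<in>trivs X. \<forall>x\<in>tdom s \<inter> tdom s'.
        vol s x = vol s' x * det (transT X s s' x))"

definition sl_section ::
    "('a::t2_space, 'j) hcs \<Rightarrow> (('a, 'j, 'n::finite) triv \<Rightarrow> 'a \<Rightarrow> complex^'n^'n) \<Rightarrow> bool" where
  "sl_section X M \<longleftrightarrow>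
     (\<forall>s\<in>trivs X. smooth_fn (atlas X) (tdom s) (M s) \<and> (\<forall>x\<in>tdom s. trace (M s x) = 0)) \<and>
     (\<forall>s\<in>trivs X. \<forall>s'\<in>trivs X. \<forall>x\<in>tdom s \<inter> tdom s'.
        M s' x ** transT X s s' x = transT X s s' x ** M s x)"


section \<open>Hermitian structures and \<open>L\<close>-compatibility\<close>

definition ctranspose :: "complex^'n^'m \<Rightarrow> complex^'m^'n" where
  "ctranspose M = (\<chi> i j. cnj (M $ j $ i))"

text \<open>
  A Hermitian structure is a smooth family of nondegenerate Hermitian forms, of any signature, with
  Gram matrices \<open>h s x\<close>; the form is \<open>(v, w) \<mapsto> \<Sum> cnj (v $ i) * h s x $ i $ j * w $ j\<close>.
\<close>

definition hermitian_structure ::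
    "('a::t2_space, 'j) hcs \<Rightarrow> (('a, 'j, 'n::finite) triv \<Rightarrow> 'a \<Rightarrow> complex^'n^'n) \<Rightarrow> bool" where
  "hermitian_structure X h \<longleftrightarrow>
     (\<forall>s\<in>trivs X. smooth_fn (atlas X) (tdom s) (h s) \<and>
        (\<forall>x\<in>tdom s. ctranspose (h s x) = h s x \<and> invertible (h s x))) \<and>
     (\<forall>s\<in>trivs X. \<forall>s'\<in>trivs X. \<forall>x\<in>tdom s \<inter> tdom s'.
        h s x = ctranspose (transT X s s' x) ** h s' x ** transT X s s' x)"

definition hadjoint :: "complex^'n^'n \<Rightarrow> complex^'n^'n \<Rightarrow> complex^'n^'n::finite" where
  "hadjoint H M = matrix_inv H ** ctranspose M ** H"

definition preserves_L ::
    "('a, 'j) hcs \<Rightarrow> ('a, 'j, 'n::finite) triv \<Rightarrow> 'a \<Rightarrow> complex^'n^'n \<Rightarrow> bool" where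
  "preserves_L X s x M \<longleftrightarrow> (\<forall>v\<in>line_L X s x. M *v v \<in> line_L X s x)"

definition parabolic_L ::
    "('a, 'j) hcs \<Rightarrow> ('a, 'j, 'n::finite) triv \<Rightarrow> 'a \<Rightarrow> (complex^'n^'n) set" where
  "parabolic_L X s x = {M. trace M = 0 \<and> preserves_L X s x M}"

definition parabolic_L_dual ::
    "('a, 'j) hcs \<Rightarrow> ('a, 'j, 'n::finite) triv \<Rightarrow> 'a \<Rightarrow> (complex^'n^'n) set" where
  "parabolic_L_dual X s x =
     {N. trace N = 0 \<and> (\<forall>M\<in>parabolic_L X s x. trace (N ** M) = 0)}"

definition L_compatible ::
    "('a::t2_space, 'j) hcs \<Rightarrow> (('a, 'j, 'n::finite) triv \<Rightarrow> 'a \<Rightarrow> complex^'n^'n) \<Rightarrow> bool" where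
  "L_compatible X h \<longleftrightarrow> (\<forall>s\<in>trivs X. \<forall>x\<in>tdom s.
     parabolic_L_dual X s x \<inter> {M. trace M = 0 \<and> hadjoint (h s x) M = M} = {0})"


section \<open>Connections and curvature\<close>

text \<open>
  In a trivialisation \<open>s\<close>, a matrix-valued one-form is evaluated on the tangent vector with
  components \<open>v\<close> in the chart \<open>tchart s\<close>. The covariant derivative of a connection with local form
  \<open>A s\<close> is \<open>d + A s\<close>.
\<close>

type_synonym ('a, 'j, 'n) matrix_form =
  "('a, 'j, 'n) triv \<Rightarrow> 'a \<Rightarrow> complex \<Rightarrow> complex^'n^'n"

definition smooth_form ::
    "('a::t2_space, 'j) hcs \<Rightarrow> ('a, 'j, 'n::finite) matrix_form \<Rightarrow> bool" where
  "smooth_form X A \<longleftrightarrow> (\<forall>s\<in>trivs X.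
     (\<forall>v. smooth_fn (atlas X) (tdom s) (\<lambda>x. A s x v)) \<and> (\<forall>x\<in>tdom s. linear (A s x)))"

definition sl_one_form ::
    "('a::t2_space, 'j) hcs \<Rightarrow> ('a, 'j, 'n::finite) matrix_form \<Rightarrow> bool" where
  "sl_one_form X A \<longleftrightarrow>
     smooth_form X A \<and>
     (\<forall>s\<in>trivs X. \<forall>x\<in>tdom s. \<forall>v. trace (A s x v) = 0) \<and>
     (\<forall>s\<in>trivs X. \<forall>s'\<in>trivs X. \<forall>x\<in>tdom s \<inter> tdom s'. \<forall>v.
        A s' x (transD (tchart s) (tchart s') x v) ** transT X s s' x =
        transT X s s' x ** A s x v)"

text \<open>The trace condition says that the volume form is parallel.\<close>

definition sl_connection ::
    "('a::t2_space, 'j) hcs \<Rightarrow> (('a, 'j, 'n::finite) triv \<Rightarrow> 'a \<Rightarrow> complex) \<Rightarrow>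
     ('a, 'j, 'n) matrix_form \<Rightarrow> bool" where
  "sl_connection X vol A \<longleftrightarrow>
     smooth_form X A \<and>
     (\<forall>s\<in>trivs X. \<forall>x\<in>tdom s. \<forall>v. cderiv (tchart s) (vol s) x v = trace (A s x v) * vol s x) \<and>
     (\<forall>s\<in>trivs X. \<forall>s'\<in>trivs X. \<forall>x\<in>tdom s \<inter> tdom s'. \<forall>v.
        A s' x (transD (tchart s) (tchart s') x v) ** transT X s s' x
          + cderiv (tchart s) (transT X s s') x v =
        transT X s s' x ** A s x v)"

text \<open>
  The involution \<open>\<nabla> \<mapsto> -\<nabla>^*\<close> on connections: \<open>B = neg_adjoint h A\<close> is characterised by
  \<open>d h(v, w) = h(\<nabla>\<^sub>B v, w) + h(v, \<nabla>\<^sub>A w)\<close>, that is \<open>dH = B^\<dagger> H + H A\<close> for the Gram matrix \<open>H\<close>.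
  Its fixed points are the \<open>h\<close>-unitary connections, and adding a one-form \<open>C\<close> to \<open>A\<close> adds
  \<open>- hadjoint h C\<close> to \<open>B\<close>.
\<close>

definition neg_adjoint ::
    "(('a, 'j, 'n::finite) triv \<Rightarrow> 'a \<Rightarrow> complex^'n^'n) \<Rightarrow>
     ('a, 'j, 'n) matrix_form \<Rightarrow> ('a, 'j, 'n) matrix_form" where
  "neg_adjoint h A s x v =
     matrix_inv (h s x) ** cderiv (tchart s) (h s) x v - hadjoint (h s x) (A s x v)"

definition curvature ::
    "('a, 'j, 'n::finite) matrix_form \<Rightarrow> ('a, 'j, 'n) triv \<Rightarrow> 'a \<Rightarrow>
     complex \<Rightarrow> complex \<Rightarrow> complex^'n^'n" where
  "curvature A s x v w =
     cderiv (tchart s) (\<lambda>y. A s y w) x v - cderiv (tchart s) (\<lambda>y. A s y v) x w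
     + (A s x v ** A s x w - A s x w ** A s x v)"

definition flat ::
    "('a::t2_space, 'j) hcs \<Rightarrow> ('a, 'j, 'n::finite) matrix_form \<Rightarrow> bool" where
  "flat X A \<longleftrightarrow> (\<forall>s\<in>trivs X. \<forall>x\<in>tdom s. \<forall>v w. curvature A s x v w = 0)"


section \<open>Integration and \<open>L\<close>-parabolic connections\<close>

text \<open>A finite smooth partition of unity subordinate to the domains of trivialisations.\<close>

definition partition_of_unity ::
    "('a::t2_space, 'j) hcs \<Rightarrow>
     nat \<times> (nat \<Rightarrow> ('a, 'j, 'n::finite) triv) \<times> (nat \<Rightarrow> 'a \<Rightarrow> real) \<Rightarrow> bool" where
  "partition_of_unity X P \<longleftrightarrow> (case P of (m, s, r) \<Rightarrow>
     (\<forall>i<m. s i \<in> trivs X \<and> smooth_fn (atlas X) UNIV (r i) \<and> (\<forall>x. 0 \<le> r i x) \<and>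
            closure {x. r i x \<noteq> 0} \<subseteq> tdom (s i)) \<and>
     (\<forall>x. (\<Sum>i<m. r i x) = 1))"

text \<open>
  The integral of a complex two-form over the surface, oriented by its complex structure, computed
  with some fixed partition of unity (the result does not depend on it). In a trivialisation
  \<open>s\<close> with coordinate \<open>x + i y\<close> the two-form is \<open>\<omega> s dx \<and> dy\<close>, that is, \<open>\<omega> s\<close> is its value on the
  coordinate vectors \<open>1\<close> and \<open>\<i>\<close>.
\<close>

definition surface_integral ::
    "('a::t2_space, 'j) hcs \<Rightarrow> (('a, 'j, 'n::finite) triv \<Rightarrow> 'a \<Rightarrow> complex) \<Rightarrow> complex" where
  "surface_integral X \<omega> =
     (let (m, s, r) = (SOME P. partition_of_unity X P) in
      \<Sum>i<m. set_lebesgue_integral lborel (chart_image (tchart (s i)) (tdom (s i)))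
        (\<lambda>z. let x = chart_inv (tchart (s i)) z in
             complex_of_real (r i x * chart_sign X (tchart (s i)) x) * \<omega> (s i) x))"

definition L_parabolic ::
    "('a::t2_space, 'j) hcs \<Rightarrow> ('a, 'j, 'n::finite) matrix_form \<Rightarrow> bool" where
  "L_parabolic X A \<longleftrightarrow>
     (\<forall>M. sl_section X M \<and> (\<forall>s\<in>trivs X. \<forall>x\<in>tdom s. preserves_L X s x (M s x)) \<longrightarrow>
        surface_integral X (\<lambda>s x. trace (curvature A s x 1 \<i> ** M s x)) = 0)"


section \<open>Laurent polynomial families\<close>

definition laurent_family ::
    "nat \<Rightarrow> (int \<Rightarrow> ('a, 'j, 'n::finite) matrix_form) \<Rightarrow> complex \<Rightarrow> ('a, 'j, 'n) matrix_form" where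
  "laurent_family N A l s x v =
     (\<Sum>i\<in>{- int N..int N}. (\<chi> a b. l powi i * A i s x v $ a $ b))"

end

theory Submission
  imports Defs "HOL-Computational_Algebra.Fundamental_Theorem_Algebra"
begin

text \<open>
  The algebraic heart is short. Write \<open>F(\<lambda>)\<close> for the value of the curvature of \<open>M(\<lambda>)\<close> on the
  coordinate vectors at a point. The symmetry of the family gives
  \<open>F(\<lambda>) = - F(-1/conj \<lambda>)^*\<close>, where \<open>*\<close> is the \<open>h\<close>-adjoint. If \<open>M(\<lambda>)\<close> is \<open>L\<close>-parabolic for all
  \<open>\<lambda>\<close>, then all \<open>F(\<lambda>)\<close> lie in the dual \<open>p_L^*\<close> of the parabolic, hence so does the adjoint
  \<open>F(\<lambda>)^* = - F(-1/conj \<lambda>)\<close>. As \<open>p_L^*\<close> is a complex subspace, it contains the self-adjoint matrices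
  \<open>F + F^*\<close> and \<open>i (F - F^*)\<close>; by \<open>L\<close>-compatibility both vanish, so \<open>F = 0\<close>
  (\<open>eq_0_if_adjoint_in_parabolic_L_dual\<close>).

  The remaining work is to make the two ingredients rigorous in terms of local matrices.

  \<^item> Curvature is compatible with changes of trivialisation and with adjoints. Both facts are
    consequences of one computation (\<open>local_curvature_gauge\<close>): if \<open>T\<close> intertwines \<open>d + A\<close> with
    \<open>d + B\<close>, then it intertwines their curvatures. Taking for \<open>T\<close> a transition matrix gives the
    transformation law, and taking for \<open>T\<close> the Gram matrix of \<open>h\<close> gives the symmetry of \<open>F\<close>. This
    requires that the transition matrices of \<open>V\<close> are smooth for arbitrary smooth frames of
    polynomials. The reason is that \<open>p^n\<close> and \<open>pbar^n\<close> lie in every ideal of codimension \<open>n\<close>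
    supported at the origin (\<open>power_in_ideal\<close>), so that only finitely many coefficients of a
    representative matter (\<open>smooth_transT\<close>).

  \<^item> The integral condition implies the pointwise condition (\<open>L_parabolic_imp_pointwise\<close>). If it
    failed at a point, one could extend the offending element of the parabolic to a section
    preserving \<open>L\<close> with support near that point, and choose its phase such that the integrand has
    nonnegative real part in every chart and positive real part in one. Here the sign of a chart
    must match the sign of the Jacobian of a coordinate change (\<open>chart_sign_change\<close>), which rests on
    \<open>I + conj I = (p, pbar)\<close>.

  Conversely, the integral of a vanishing curvature is zero as soon as the partition of unity that
  defines the integral exists (\<open>partition_of_unity_exists\<close>).
\<close>

section \<open>Calculus of smooth functions\<close>

abbreviation Der :: "('a::real_normed_vector \<Rightarrow> 'b::real_normed_vector) \<Rightarrow> 'a \<Rightarrow> 'a \<Rightarrow> 'b" where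
  "Der f x \<equiv> frechet_derivative f (at x)"

lemma Ck_on_differentiable:
  assumes "Ck_on (Suc k) f U" "open U" "x \<in> U"
  shows "f differentiable (at x)"
proof -
  have "f differentiable (at x within U)"
    using assms by (simp add: differentiable_on_def)
  then show ?thesis by (simp add: at_within_open[OF assms(3,2)])
qed

lemma Ck_on_has_derivative:
  assumes "Ck_on (Suc k) f U" "open U" "x \<in> U"
  shows "(f has_derivative Der f x) (at x)"
  using Ck_on_differentiable[OF assms] frechet_derivative_works by blast

lemma Ck_on_SucD: "Ck_on (Suc k) f U \<Longrightarrow> Ck_on k f U"
proof (induction k arbitrary: f)
  case 0
  then show ?case by (simp add: differentiable_imp_continuous_on)
next
  case (Suc k)
  then show ?case by (metis Ck_on.simps(2))
qed

lemma Ck_on_subset: "Ck_on k f U \<Longrightarrow> V \<subseteq> U \<Longrightarrow> Ck_on k f V"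
  by (induction k arbitrary: f) (auto intro: continuous_on_subset differentiable_on_subset)

lemma Ck_on_cong:
  assumes "Ck_on k f U" "open U" "\<And>x. x \<in> U \<Longrightarrow> f x = g x"
  shows "Ck_on k g U"
  using assms
proof (induction k arbitrary: f g)
  case 0
  then show ?case by (auto cong: continuous_on_cong)
next
  case (Suc k)
  have d: "Der f x = Der g x" if "x \<in> U" for x
    by (rule frechet_derivative_transform_within_open[OF Ck_on_differentiable[OF Suc.prems(1,2) that]
          Suc.prems(2) that Suc.prems(3)])
  have "g differentiable_on U"
    unfolding differentiable_on_def
  proof
    fix x assume x: "x \<in> U"
    show "g differentiable (at x within U)"
      by (rule differentiableI[OF has_derivative_at_withinI[OF
            has_derivative_transform_within_open[OF Ck_on_has_derivative[OF Suc.prems(1,2) x]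
              Suc.prems(2) x Suc.prems(3)]]])
  qed
  moreover have "Ck_on k (\<lambda>x. Der g x v) U" for v
    by (rule Suc.IH[of "\<lambda>x. Der f x v"]) (use Suc.prems d in auto)
  ultimately show ?case by simp
qed

lemma Ck_on_local:
  assumes "\<And>x. x \<in> U \<Longrightarrow> \<exists>V. open V \<and> x \<in> V \<and> Ck_on k f V"
  shows "Ck_on k f U"
  using assms
proof (induction k arbitrary: f)
  case 0
  then show ?case
    by (metis Ck_on.simps(1) continuous_at_imp_continuous_on continuous_on_eq_continuous_at)
next
  case (Suc k)
  have "f differentiable_on U"
    using Suc.prems by (meson Ck_on_differentiable differentiable_at_withinI differentiable_on_def)
  moreover have "Ck_on k (\<lambda>x. Der f x v) U" for v
    using Suc by (metis Ck_on.simps(2))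
  ultimately show ?case by simp
qed

text \<open>
  Reduces \<open>C^(k+1)\<close> to \<open>C^k\<close> for an explicit formula of the derivative.
\<close>

lemma Ck_on_SucI:
  assumes "open U"
    and "\<And>x. x \<in> U \<Longrightarrow> (f has_derivative f' x) (at x)"
    and "\<And>v. Ck_on k (\<lambda>x. f' x v) U"
  shows "Ck_on (Suc k) f U"
proof -
  have "Der f x = f' x" if "x \<in> U" for x
    using frechet_derivative_at assms(2) that by fastforce
  then have "Ck_on k (\<lambda>x. Der f x v) U" for v
    using Ck_on_cong[OF assms(3) assms(1)] by simp
  moreover have "f differentiable_on U"
    using assms by (auto simp: differentiable_on_def differentiable_def intro: has_derivative_at_withinI)
  ultimately show ?thesis by simp
qed

lemma Ck_on_const: "Ck_on k (\<lambda>x. c) U"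
  by (induction k arbitrary: c) auto

lemma Ck_on_add:
  assumes "open U" "Ck_on k f U" "Ck_on k g U"
  shows "Ck_on k (\<lambda>x. f x + g x) U"
  using assms(2,3)
proof (induction k arbitrary: f g)
  case 0
  then show ?case by (auto intro: continuous_intros)
next
  case (Suc k)
  show ?case
    using Suc Ck_on_has_derivative[OF Suc.prems(1) \<open>open U\<close>] Ck_on_has_derivative[OF Suc.prems(2) \<open>open U\<close>]
    by (intro Ck_on_SucI[OF \<open>open U\<close>, where f'="\<lambda>x v. Der f x v + Der g x v"])
      (auto intro!: has_derivative_add)
qed

lemma Ck_on_bilinear:
  assumes "bounded_bilinear mul" "open U" "Ck_on k f U" "Ck_on k g U"
  shows "Ck_on k (\<lambda>x. mul (f x) (g x)) U"
  using assms(3,4)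
proof (induction k arbitrary: f g)
  case 0
  then show ?case by (auto intro: bounded_bilinear.continuous_on[OF assms(1)])
next
  case (Suc k)
  let ?D = "\<lambda>x v. mul (f x) (Der g x v) + mul (Der f x v) (g x)"
  show ?case
  proof (rule Ck_on_SucI[OF \<open>open U\<close>, where f'="?D"])
    show "((\<lambda>x. mul (f x) (g x)) has_derivative ?D x) (at x)" if "x \<in> U" for x
      using that by (intro bounded_bilinear.FDERIV[OF assms(1)] Ck_on_has_derivative[OF Suc.prems(1) \<open>open U\<close>]
          Ck_on_has_derivative[OF Suc.prems(2) \<open>open U\<close>])
    show "Ck_on k (\<lambda>x. ?D x v) U" for v
      using Suc.prems
      by (intro Ck_on_add[OF \<open>open U\<close>] Suc.IH Ck_on_SucD[OF Suc.prems(1)] Ck_on_SucD[OF Suc.prems(2)]) auto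
  qed
qed

lemma Ck_on_bounded_linear:
  assumes "bounded_linear L" "open U" "Ck_on k f U"
  shows "Ck_on k (\<lambda>x. L (f x)) U"
  using assms(3)
proof (induction k arbitrary: f)
  case 0
  then show ?case by (auto intro: bounded_linear.continuous_on[OF assms(1)])
next
  case (Suc k)
  show ?case
    using Suc Ck_on_has_derivative[OF Suc.prems(1) \<open>open U\<close>]
    by (intro Ck_on_SucI[OF \<open>open U\<close>, where f'="\<lambda>x v. L (Der f x v)"])
      (auto intro!: bounded_linear.has_derivative[OF assms(1)])
qed

lemma Ck_on_sum:
  assumes "open U" "finite I" "\<And>i. i \<in> I \<Longrightarrow> Ck_on k (f i) U"
  shows "Ck_on k (\<lambda>x. \<Sum>i\<in>I. f i x) U"
  using assms(2,3) by (induction I rule: finite_induct) (auto intro: Ck_on_const Ck_on_add[OF assms(1)])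

lemma Ck_on_inverse:
  fixes f :: "'a::real_normed_vector \<Rightarrow> 'b::real_normed_field"
  assumes "open U" "Ck_on k f U" "\<And>x. x \<in> U \<Longrightarrow> f x \<noteq> 0"
  shows "Ck_on k (\<lambda>x. inverse (f x)) U"
  using assms(2)
proof (induction k)
  case 0
  then show ?case using assms(3) by (auto intro: continuous_intros)
next
  case (Suc k)
  have "Ck_on k (\<lambda>x. - 1 * (inverse (f x) * Der f x v * inverse (f x))) U" for v
    using Suc Ck_on_SucD[OF Suc.prems]
    by (intro Ck_on_bilinear[OF bounded_bilinear_mult] \<open>open U\<close> Ck_on_const) auto
  then show ?case
    by (intro Ck_on_SucI[OF \<open>open U\<close>, where f'="\<lambda>x v. - 1 * (inverse (f x) * Der f x v * inverse (f x))"])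
      (auto intro!: derivative_eq_intros Ck_on_has_derivative[OF Suc.prems \<open>open U\<close>] assms(3))
qed

lemma frechet_derivative_Basis_expansion:
  fixes g :: "'b::euclidean_space \<Rightarrow> 'c::real_normed_vector"
  assumes "g differentiable (at y)"
  shows "Der g y v = (\<Sum>b\<in>Basis. (v \<bullet> b) *\<^sub>R Der g y b)"
proof -
  have l: "linear (Der g y)"
    using assms linear_frechet_derivative by blast
  have "Der g y v = Der g y (\<Sum>b\<in>Basis. (v \<bullet> b) *\<^sub>R b)"
    by (simp add: euclidean_representation)
  then show ?thesis by (simp add: linear_sum[OF l] linear_scale[OF l])
qed

text \<open>
  The derivative of a composition is a bilinear expression in two functions of one order less,
  but only after the direction in which the outer function is differentiated, which varies with
  the point, has been expanded in a fixed basis.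
\<close>

lemma Ck_on_compose:
  fixes g :: "'b::euclidean_space \<Rightarrow> 'c::real_normed_vector"
  assumes "open U" "open V" "Ck_on k f U" "Ck_on k g V" "f ` U \<subseteq> V"
  shows "Ck_on k (\<lambda>x. g (f x)) U"
  using assms(3,4)
proof (induction k arbitrary: g)
  case 0
  then show ?case using assms(5) by (auto intro: continuous_on_compose2)
next
  case (Suc k)
  let ?D = "\<lambda>x v. \<Sum>b\<in>Basis. (Der f x v \<bullet> b) *\<^sub>R Der g (f x) b"
  show ?case
  proof (rule Ck_on_SucI[OF \<open>open U\<close>, where f'="?D"])
    fix x assume x: "x \<in> U"
    have "?D x = (\<lambda>v. Der g (f x) (Der f x v))"
      using Ck_on_differentiable[OF Suc.prems(2) \<open>open V\<close>, of "f x"] x assms(5)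
      by (subst (2) frechet_derivative_Basis_expansion) auto
    moreover have "((g \<circ> f) has_derivative Der g (f x) \<circ> Der f x) (at x)"
      using x assms(5) by (intro diff_chain_at Ck_on_has_derivative[OF Suc.prems(1) \<open>open U\<close>]
          Ck_on_has_derivative[OF Suc.prems(2) \<open>open V\<close>]) auto
    ultimately show "((\<lambda>x. g (f x)) has_derivative ?D x) (at x)" by (simp add: o_def)
  next
    fix v
    show "Ck_on k (\<lambda>x. ?D x v) U"
      using Suc.prems
      by (intro Ck_on_sum \<open>open U\<close> finite_Basis Ck_on_bilinear[OF bounded_bilinear_scaleR]
            Ck_on_bounded_linear[OF bounded_linear_inner_left] Suc.IH Ck_on_SucD[OF Suc.prems(1)])
        auto
  qed
qed

lemma smooth_on_subset: "smooth_on U f \<Longrightarrow> V \<subseteq> U \<Longrightarrow> smooth_on V f"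
  by (auto simp: smooth_on_def intro: Ck_on_subset)

lemma smooth_on_cong:
  "smooth_on U f \<Longrightarrow> open U \<Longrightarrow> (\<And>x. x \<in> U \<Longrightarrow> f x = g x) \<Longrightarrow> smooth_on U g"
  by (auto simp: smooth_on_def intro: Ck_on_cong)

lemma smooth_on_local:
  "(\<And>x. x \<in> U \<Longrightarrow> \<exists>V. open V \<and> x \<in> V \<and> smooth_on V f) \<Longrightarrow> smooth_on U f"
  unfolding smooth_on_def by (intro allI Ck_on_local) blast

lemma smooth_on_const: "smooth_on U (\<lambda>x. c)"
  by (simp add: smooth_on_def Ck_on_const)

lemma smooth_on_bilinear:
  "bounded_bilinear mul \<Longrightarrow> open U \<Longrightarrow> smooth_on U f \<Longrightarrow> smooth_on U g \<Longrightarrow> smooth_on U (\<lambda>x. mul (f x) (g x))"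
  by (simp add: smooth_on_def Ck_on_bilinear)

lemma smooth_on_bounded_linear:
  "bounded_linear L \<Longrightarrow> open U \<Longrightarrow> smooth_on U f \<Longrightarrow> smooth_on U (\<lambda>x. L (f x))"
  by (simp add: smooth_on_def Ck_on_bounded_linear)

lemma smooth_on_add:
  "open U \<Longrightarrow> smooth_on U f \<Longrightarrow> smooth_on U g \<Longrightarrow> smooth_on U (\<lambda>x. f x + g x)"
  by (simp add: smooth_on_def Ck_on_add)

lemma smooth_on_inverse:
  fixes f :: "'a::real_normed_vector \<Rightarrow> 'b::real_normed_field"
  shows "open U \<Longrightarrow> smooth_on U f \<Longrightarrow> (\<And>x. x \<in> U \<Longrightarrow> f x \<noteq> 0) \<Longrightarrow> smooth_on U (\<lambda>x. inverse (f x))"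
  by (simp add: smooth_on_def Ck_on_inverse)

lemma smooth_on_compose:
  fixes g :: "'b::euclidean_space \<Rightarrow> 'c::real_normed_vector"
  shows "open U \<Longrightarrow> open V \<Longrightarrow> smooth_on U f \<Longrightarrow> smooth_on V g \<Longrightarrow> f ` U \<subseteq> V \<Longrightarrow> smooth_on U (\<lambda>x. g (f x))"
  by (simp add: smooth_on_def Ck_on_compose)

lemma smooth_on_continuous_on: "smooth_on U f \<Longrightarrow> continuous_on U f"
  by (metis smooth_on_def Ck_on.simps(1))

lemma smooth_on_has_derivative:
  "smooth_on U f \<Longrightarrow> open U \<Longrightarrow> x \<in> U \<Longrightarrow> (f has_derivative Der f x) (at x)"
  using Ck_on_has_derivative smooth_on_def by blast

lemma smooth_on_differentiable:
  "smooth_on U f \<Longrightarrow> open U \<Longrightarrow> x \<in> U \<Longrightarrow> f differentiable (at x)"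
  using Ck_on_differentiable smooth_on_def by blast

lemma smooth_on_frechet_derivative:
  "smooth_on U f \<Longrightarrow> smooth_on U (\<lambda>x. Der f x v)"
  unfolding smooth_on_def by (metis Ck_on.simps(2))


section \<open>A smooth bump function\<close>

text \<open>
  The derivative of \<open>exp (-1/x) / x^m\<close> is a combination of two functions of the same form, so the
  whole family can be shown to be smooth simultaneously. At \<open>0\<close> all of them vanish to infinite
  order.
\<close>

definition flat_exp :: "nat \<Rightarrow> real \<Rightarrow> real" where
  "flat_exp m x = (if 0 < x then exp (- inverse x) * inverse x ^ m else 0)"

lemma flat_exp_has_derivative:
  "(flat_exp m has_real_derivative (flat_exp (m + 2) x - real m * flat_exp (m + 1) x)) (at x)"
proof (cases x "0::real" rule: linorder_cases)
  case less
  have "((\<lambda>x. 0::real) has_real_derivative 0) (at x)" by simp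
  moreover have "\<forall>\<^sub>F y in nhds x. flat_exp m y = 0"
    using less by (auto simp: flat_exp_def eventually_nhds intro!: exI[of _ "{..<0}"])
  ultimately have "(flat_exp m has_real_derivative 0) (at x)"
    by (subst DERIV_cong_ev[OF refl _ refl]) auto
  then show ?thesis using less by (simp add: flat_exp_def)
next
  case greater
  have "((\<lambda>y. exp (- inverse y) * inverse y ^ m) has_real_derivative
      flat_exp (m + 2) x - real m * flat_exp (m + 1) x) (at x)"
  proof (cases m)
    case 0
    with greater show ?thesis
      by (auto intro!: derivative_eq_intros simp: flat_exp_def power2_eq_square)
  next
    case (Suc k)
    have i: "(inverse has_real_derivative - (inverse x * inverse x)) (at x)"
      using DERIV_inverse[of x] greater by (simp add: power2_eq_square)
    have "((\<lambda>y. exp (- inverse y) * inverse y ^ Suc k) has_real_derivative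
        exp (- inverse x) * ((1 + of_nat k) * (- (inverse x * inverse x) * inverse x ^ k))
        + exp (- inverse x) * (inverse x * inverse x) * inverse x ^ Suc k) (at x)"
      using DERIV_mult'[OF DERIV_fun_exp[OF DERIV_minus[OF i]] DERIV_power_Suc[OF i, of k]] by simp
    with Suc greater show ?thesis
      by (simp add: flat_exp_def algebra_simps)
  qed
  moreover have "\<forall>\<^sub>F y in nhds x. exp (- inverse y) * inverse y ^ m = flat_exp m y"
    using greater by (auto simp: flat_exp_def eventually_nhds intro!: exI[of _ "{0<..}"])
  ultimately show ?thesis
    by (subst DERIV_cong_ev[OF refl _ refl, where g="\<lambda>y. exp (- inverse y) * inverse y ^ m"])
      (auto elim: eventually_mono)
next
  case equal
  have lim: "((\<lambda>u::real. u ^ (m + 1) / exp u) \<longlongrightarrow> 0) at_top"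
    by (rule tendsto_power_div_exp_0)
  have "((\<lambda>y. flat_exp m y / y) \<longlongrightarrow> 0) (at_right 0)"
  proof (rule Lim_transform_eventually)
    show "((\<lambda>y::real. inverse y ^ (m + 1) / exp (inverse y)) \<longlongrightarrow> 0) (at_right 0)"
      by (rule filterlim_compose[OF lim filterlim_inverse_at_top_right])
    show "\<forall>\<^sub>F y in at_right 0. inverse y ^ (m + 1) / exp (inverse y) = flat_exp m y / y"
      by (auto simp: eventually_at_right_less flat_exp_def exp_minus field_simps
          intro!: eventually_mono[OF eventually_at_right_less[of "0::real"]])
  qed
  moreover have "((\<lambda>y. flat_exp m y / y) \<longlongrightarrow> 0) (at_left 0)"
    by (rule Lim_transform_eventually[OF tendsto_const])
      (auto simp: flat_exp_def eventually_at_left_field intro!: exI[of _ "-1"])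
  ultimately have "((\<lambda>y. flat_exp m y / y) \<longlongrightarrow> 0) (at 0)"
    by (simp add: filterlim_split_at)
  then have "(flat_exp m has_real_derivative 0) (at 0)"
    by (simp add: has_field_derivative_iff flat_exp_def)
  then show ?thesis using equal by (simp add: flat_exp_def)
qed

lemma smooth_on_flat_exp: "smooth_on UNIV (flat_exp m)"
proof -
  have "Ck_on k (flat_exp m) UNIV" for k
  proof (induction k arbitrary: m)
    case 0
    then show ?case
      by (metis Ck_on.simps(1) DERIV_continuous continuous_at_imp_continuous_on flat_exp_has_derivative)
  next
    case (Suc k)
    have "Ck_on k (\<lambda>x. (flat_exp (m + 2) x + (- real m) * flat_exp (m + 1) x) * v) UNIV" for v
      by (intro Ck_on_bilinear[OF bounded_bilinear_mult] Ck_on_add Suc.IH open_UNIV Ck_on_const)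
    then show ?case
      using flat_exp_has_derivative
      by (intro Ck_on_SucI[OF open_UNIV, where
            f'="\<lambda>x v. (flat_exp (m + 2) x + (- real m) * flat_exp (m + 1) x) * v"])
        (auto simp: has_field_derivative_def)
  qed
  then show ?thesis by (simp add: smooth_on_def)
qed

definition bump :: "complex \<Rightarrow> real \<Rightarrow> complex \<Rightarrow> real" where
  "bump a e z = flat_exp 0 (e\<^sup>2 - (z - a) \<bullet> (z - a))"

lemma smooth_on_ident: "smooth_on U (\<lambda>x. x)"
proof -
  have "Ck_on k (\<lambda>x. x) U" for k
    by (cases k) (auto simp: differentiable_on_def Ck_on_const)
  then show ?thesis by (simp add: smooth_on_def)
qed

lemma smooth_on_bump: "smooth_on UNIV (bump a e)"
proof -
  have "smooth_on UNIV (\<lambda>z. e\<^sup>2 + (- 1) * ((z + (- a)) \<bullet> (z + (- a))))"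
    by (intro smooth_on_add smooth_on_bilinear[OF bounded_bilinear_mult]
        smooth_on_bilinear[OF bounded_bilinear_inner] smooth_on_const smooth_on_ident open_UNIV)
  then have "smooth_on UNIV (\<lambda>z. flat_exp 0 (e\<^sup>2 + (- 1) * ((z + (- a)) \<bullet> (z + (- a)))))"
    by (rule smooth_on_compose[OF open_UNIV open_UNIV _ smooth_on_flat_exp]) simp
  then show ?thesis by (auto simp: bump_def [abs_def])
qed

lemma bump_nonneg: "0 \<le> bump a e z"
  by (simp add: bump_def flat_exp_def)

lemma bump_pos_iff: "0 < e \<Longrightarrow> 0 < bump a e z \<longleftrightarrow> z \<in> ball a e"
  by (auto simp: bump_def flat_exp_def dist_norm norm_minus_commute dot_square_norm power2_less_imp_less
      intro: power_strict_mono)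


section \<open>Curvature of matrix-valued one-forms on plane domains\<close>

lemma DERIV_along_line:
  fixes g :: "'a::real_normed_vector \<Rightarrow> real"
  assumes "g differentiable (at (p + s *\<^sub>R v))"
  shows "((\<lambda>s. g (p + s *\<^sub>R v)) has_real_derivative Der g (p + s *\<^sub>R v) v) (at s)"
proof -
  have g: "(g has_derivative Der g (p + s *\<^sub>R v)) (at (p + s *\<^sub>R v))"
    using assms frechet_derivative_works by blast
  have "((\<lambda>s. g (p + s *\<^sub>R v)) has_derivative (\<lambda>t. Der g (p + s *\<^sub>R v) (t *\<^sub>R v))) (at s)"
    by (rule has_derivative_compose[of "\<lambda>s. p + s *\<^sub>R v", OF _ g]) (auto intro!: derivative_eq_intros)
  moreover have "Der g (p + s *\<^sub>R v) (t *\<^sub>R v)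
      = Der g (p + s *\<^sub>R v) v * t" for t
    using has_derivative_bounded_linear[OF g] by (simp add: linear_simps mult.commute)
  ultimately show ?thesis by (simp add: has_field_derivative_def)
qed

text \<open>
  Two applications of the mean value theorem: the second difference of \<open>g\<close> over a small
  parallelogram is \<open>t\<^sup>2\<close> times a mixed second derivative at a nearby point. Since the second
  difference is symmetric in the two directions, so are the mixed derivatives.
\<close>

lemma second_difference_limit:
  fixes g :: "'a::real_normed_vector \<Rightarrow> real" and v w :: 'a
  assumes C2: "Ck_on 2 g U" and U: "open U" and z: "z \<in> U" and e: "0 < e"
  defines "Dvw \<equiv> \<lambda>y. Der (\<lambda>x. Der g x v) y w"
  shows "\<exists>d>0. \<forall>t. 0 < t \<and> t < d \<longrightarrow>
    \<bar>g (z + t *\<^sub>R v + t *\<^sub>R w) - g (z + t *\<^sub>R v) - g (z + t *\<^sub>R w) + g z - t\<^sup>2 * Dvw z\<bar> \<le> e * t\<^sup>2"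
proof -
  let ?Dv = "\<lambda>x. Der g x v"
  have C1: "Ck_on (Suc 1) g U" using C2 by (simp add: numeral_2_eq_2)
  then have Dv1: "Ck_on (Suc 0) ?Dv U" by simp
  then have "continuous_on U Dvw" unfolding Dvw_def by simp
  then obtain r where r: "r > 0" "\<And>y. dist y z < r \<Longrightarrow> y \<in> U \<Longrightarrow> dist (Dvw y) (Dvw z) < e"
    using z e unfolding continuous_on_iff by metis
  obtain r' where r': "r' > 0" "ball z r' \<subseteq> U" using U z openE by blast
  define R where "R = min r r'"
  have R: "R > 0" using r r' by (simp add: R_def)
  define d where "d = R / (norm v + norm w + 1)"
  have pos: "norm v + norm w + 1 > 0" by (smt (verit) norm_ge_zero)
  have d: "d > 0" unfolding d_def using R pos by simp
  have near: "z + s *\<^sub>R v + u *\<^sub>R w \<in> U \<and> dist (z + s *\<^sub>R v + u *\<^sub>R w) z < r"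
    if "0 \<le> s" "s \<le> t" "0 \<le> u" "u \<le> t" "t < d" for s u t
  proof -
    have "dist (z + s *\<^sub>R v + u *\<^sub>R w) z \<le> s * norm v + u * norm w"
      using that norm_triangle_ineq[of "s *\<^sub>R v" "u *\<^sub>R w"] by (simp add: dist_norm add.assoc)
    also have "\<dots> \<le> t * norm v + t * norm w"
      using that by (intro add_mono mult_right_mono) auto
    also have "\<dots> \<le> t * (norm v + norm w + 1)" using that by (simp add: algebra_simps)
    also have "\<dots> < d * (norm v + norm w + 1)" using that pos by simp
    also have "\<dots> = R" using pos by (simp add: d_def)
    finally have "dist (z + s *\<^sub>R v + u *\<^sub>R w) z < R" .
    then show ?thesis using r' by (auto simp: R_def dist_commute mem_ball subset_iff)
  qed
  have "\<bar>g (z + t *\<^sub>R v + t *\<^sub>R w) - g (z + t *\<^sub>R v) - g (z + t *\<^sub>R w) + g z - t\<^sup>2 * Dvw z\<bar> \<le> e * t\<^sup>2"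
    if t: "0 < t" "t < d" for t
  proof -
    let ?p = "\<lambda>s. g (z + t *\<^sub>R w + s *\<^sub>R v) - g (z + s *\<^sub>R v)"
    have "\<exists>s. 0 < s \<and> s < t \<and> ?p t - ?p 0 =
        (t - 0) * (?Dv (z + t *\<^sub>R w + s *\<^sub>R v) - ?Dv (z + s *\<^sub>R v))"
    proof (rule MVT2)
      fix s assume s: "0 \<le> s" "s \<le> t"
      have "z + t *\<^sub>R w + s *\<^sub>R v \<in> U"
        using near[of s t t] s t by (simp add: algebra_simps)
      moreover have "z + s *\<^sub>R v \<in> U"
        using near[of s t 0] s t by simp
      ultimately show "(?p has_real_derivative ?Dv (z + t *\<^sub>R w + s *\<^sub>R v) - ?Dv (z + s *\<^sub>R v)) (at s)"
        by (intro DERIV_diff DERIV_along_line Ck_on_differentiable[OF C1 U])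
    qed (use t in auto)
    then obtain s where s: "0 < s" "s < t"
      "?p t - ?p 0 = t * (?Dv (z + t *\<^sub>R w + s *\<^sub>R v) - ?Dv (z + s *\<^sub>R v))" by auto
    have "\<exists>u. 0 < u \<and> u < t \<and> ?Dv (z + s *\<^sub>R v + t *\<^sub>R w) - ?Dv (z + s *\<^sub>R v + 0 *\<^sub>R w)
         = (t - 0) * Dvw (z + s *\<^sub>R v + u *\<^sub>R w)"
    proof (rule MVT2)
      fix u assume u: "0 \<le> u" "u \<le> t"
      show "((\<lambda>u. ?Dv (z + s *\<^sub>R v + u *\<^sub>R w)) has_real_derivative Dvw (z + s *\<^sub>R v + u *\<^sub>R w)) (at u)"
        unfolding Dvw_def
        using near[of s t u] u s t by (intro DERIV_along_line Ck_on_differentiable[OF Dv1 U]) auto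
    qed (use t in auto)
    then obtain u where u: "0 < u" "u < t"
      "?Dv (z + s *\<^sub>R v + t *\<^sub>R w) - ?Dv (z + s *\<^sub>R v) = t * Dvw (z + s *\<^sub>R v + u *\<^sub>R w)" by auto
    have "g (z + t *\<^sub>R v + t *\<^sub>R w) - g (z + t *\<^sub>R v) - g (z + t *\<^sub>R w) + g z = ?p t - ?p 0"
      by (simp add: algebra_simps)
    also have "\<dots> = t * (t * Dvw (z + s *\<^sub>R v + u *\<^sub>R w))"
      using s(3) u(3) by (simp add: add.commute add.left_commute)
    finally have eq: "g (z + t *\<^sub>R v + t *\<^sub>R w) - g (z + t *\<^sub>R v) - g (z + t *\<^sub>R w) + g z - t\<^sup>2 * Dvw z
        = t\<^sup>2 * (Dvw (z + s *\<^sub>R v + u *\<^sub>R w) - Dvw z)"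
      by (simp add: algebra_simps power2_eq_square)
    have "\<bar>Dvw (z + s *\<^sub>R v + u *\<^sub>R w) - Dvw z\<bar> < e"
      using near[of s t u] s u t r(2) by (auto simp: dist_real_def)
    then have "t\<^sup>2 * \<bar>Dvw (z + s *\<^sub>R v + u *\<^sub>R w) - Dvw z\<bar> \<le> t\<^sup>2 * e"
      by (intro mult_left_mono) auto
    then show ?thesis unfolding eq by (simp add: abs_mult mult.commute)
  qed
  with d show ?thesis by blast
qed

lemma symmetric_second_derivative_real:
  fixes g :: "'a::real_normed_vector \<Rightarrow> real"
  assumes "Ck_on 2 g U" and "open U" and "z \<in> U"
  shows "Der (\<lambda>x. Der g x v) z w =
         Der (\<lambda>x. Der g x w) z v" (is "?a = ?b")
proof (rule ccontr)
  assume "?a \<noteq> ?b"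
  define e where "e = \<bar>?a - ?b\<bar> / 3"
  have e: "e > 0" using \<open>?a \<noteq> ?b\<close> by (simp add: e_def)
  obtain d1 d2 where d: "d1 > 0" "d2 > 0"
    "\<And>t. 0 < t \<Longrightarrow> t < d1 \<Longrightarrow>
      \<bar>g (z + t *\<^sub>R v + t *\<^sub>R w) - g (z + t *\<^sub>R v) - g (z + t *\<^sub>R w) + g z - t\<^sup>2 * ?a\<bar> \<le> e * t\<^sup>2"
    "\<And>t. 0 < t \<Longrightarrow> t < d2 \<Longrightarrow>
      \<bar>g (z + t *\<^sub>R w + t *\<^sub>R v) - g (z + t *\<^sub>R w) - g (z + t *\<^sub>R v) + g z - t\<^sup>2 * ?b\<bar> \<le> e * t\<^sup>2"
    using second_difference_limit[OF assms e, of v w] second_difference_limit[OF assms e, of w v] by metis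
  define t where "t = min d1 d2 / 2"
  have t: "0 < t" "t < d1" "t < d2" using d by (auto simp: t_def)
  have "\<bar>t\<^sup>2 * ?a - t\<^sup>2 * ?b\<bar> \<le> 2 * (e * t\<^sup>2)"
    using d(3)[OF t(1,2)] d(4)[OF t(1,3)] by (simp add: add.commute add.left_commute abs_le_iff)
  then have "t\<^sup>2 * \<bar>?a - ?b\<bar> \<le> t\<^sup>2 * (2 * e)"
    by (simp add: right_diff_distrib[symmetric] abs_mult mult.commute mult.left_commute)
  then have "\<bar>?a - ?b\<bar> \<le> 2 * e" using t by simp
  then show False using e by (simp add: e_def)
qed

lemma symmetric_second_derivative:
  fixes f :: "'a::real_normed_vector \<Rightarrow> 'b::real_inner"
  assumes f: "smooth_on U f" and U: "open U" and z: "z \<in> U"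
  shows "Der (\<lambda>x. Der f x v) z w =
         Der (\<lambda>x. Der f x w) z v"
proof -
  have inner_deriv: "Der (\<lambda>x. f x \<bullet> c) x u = Der f x u \<bullet> c"
    if "smooth_on U f" "x \<in> U" for f :: "'a \<Rightarrow> 'b" and x u c
    using frechet_derivative_at[OF bounded_linear.has_derivative[OF bounded_linear_inner_left
          smooth_on_has_derivative[OF that(1) U that(2)]]] by metis
  have twice: "Der (\<lambda>x. Der (\<lambda>x. f x \<bullet> c) x v) z w
      = Der (\<lambda>x. Der f x v) z w \<bullet> c" for v w c
  proof -
    have "Der (\<lambda>x. Der f x v \<bullet> c) z
        = Der (\<lambda>x. Der (\<lambda>x. f x \<bullet> c) x v) z"
    proof (rule frechet_derivative_transform_within_open[OF _ U z])
      show "(\<lambda>x. Der f x v \<bullet> c) differentiable (at z)"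
        by (rule smooth_on_differentiable[OF smooth_on_bounded_linear[OF bounded_linear_inner_left U
                smooth_on_frechet_derivative[OF f]] U z])
    qed (simp add: inner_deriv[OF f])
    then show ?thesis
      using inner_deriv[OF smooth_on_frechet_derivative[OF f] z] by metis
  qed
  have "Ck_on 2 (\<lambda>x. f x \<bullet> c) U" for c
    using smooth_on_bounded_linear[OF bounded_linear_inner_left U f] by (simp add: smooth_on_def)
  from symmetric_second_derivative_real[OF this U z]
  show ?thesis unfolding twice by (metis vector_eq_rdot)
qed

lemma bounded_bilinear_matrix_mult:
  "bounded_bilinear ((**) :: complex^'n^'n::finite \<Rightarrow> complex^'n^'n \<Rightarrow> complex^'n^'n)"
  unfolding bilinear_conv_bounded_bilinear[symmetric] bilinear_def
  by (auto intro!: linearI simp: matrix_add_ldistrib matrix_matrix_mult_def vec_eq_iff algebra_simps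
        sum.distrib scaleR_sum_right)

lemmas matrix_scaleR_left = bounded_bilinear.scaleR_left[OF bounded_bilinear_matrix_mult]
lemmas matrix_scaleR_right = bounded_bilinear.scaleR_right[OF bounded_bilinear_matrix_mult]

lemma matrix_algebra_simps:
  fixes A B C :: "complex^'n^'n::finite"
  shows "(A + B) ** C = A ** C + B ** C" "(A - B) ** C = A ** C - B ** C" "(- A) ** C = - (A ** C)"
    "C ** (A + B) = C ** A + C ** B" "C ** (A - B) = C ** A - C ** B" "C ** (- A) = - (C ** A)"
    "0 ** C = 0" "C ** 0 = 0" "(A ** B) ** C = A ** (B ** C)"
  using bounded_bilinear.add_left[OF bounded_bilinear_matrix_mult]
    bounded_bilinear.diff_left[OF bounded_bilinear_matrix_mult]
    bounded_bilinear.minus_left[OF bounded_bilinear_matrix_mult]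
    bounded_bilinear.add_right[OF bounded_bilinear_matrix_mult]
    bounded_bilinear.diff_right[OF bounded_bilinear_matrix_mult]
    bounded_bilinear.minus_right[OF bounded_bilinear_matrix_mult]
  by (auto simp: matrix_mul_assoc)

type_synonym 'n local_form = "complex \<Rightarrow> complex \<Rightarrow> complex^'n^'n"

definition local_curvature :: "'n::finite local_form \<Rightarrow> complex \<Rightarrow> complex \<Rightarrow> complex \<Rightarrow> complex^'n^'n" where
  "local_curvature B z v w =
     Der (\<lambda>u. B u w) z v - Der (\<lambda>u. B u v) z w
     + (B z v ** B z w - B z w ** B z v)"

definition smooth_local_form :: "complex set \<Rightarrow> 'n::finite local_form \<Rightarrow> bool" where
  "smooth_local_form U B \<longleftrightarrow> (\<forall>v. smooth_on U (\<lambda>z. B z v)) \<and> (\<forall>z\<in>U. linear (B z))"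

lemma frechet_derivative_matrix_mult:
  fixes f g :: "complex \<Rightarrow> complex^'n^'n::finite"
  assumes "f differentiable (at z)" "g differentiable (at z)"
  shows "Der (\<lambda>x. f x ** g x) z v =
    f z ** Der g z v + Der f z v ** g z"
  by (simp add: frechet_derivative_at[OF bounded_bilinear.FDERIV[OF bounded_bilinear_matrix_mult
        assms[THEN frechet_derivative_works[THEN iffD1]]], symmetric])

text \<open>
  The hypothesis says that \<open>T\<close> intertwines \<open>d + A\<close> with \<open>d + B\<close>, hence also their squares. In
  coordinates: differentiate the relation in a second direction and antisymmetrise; the second
  derivatives of \<open>T\<close> cancel and the first derivatives are eliminated by the relation itself.
\<close>

lemma local_curvature_gauge:
  fixes A B :: "'n::finite local_form"
  assumes A: "smooth_local_form U A" and B: "smooth_local_form U B"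
    and T: "smooth_on U T" and U: "open U" and z: "z \<in> U"
    and gauge: "\<And>z v. z \<in> U \<Longrightarrow> B z v ** T z + Der T z v = T z ** A z v"
  shows "local_curvature B z v w ** T z = T z ** local_curvature A z v w"
proof -
  have dA: "(\<lambda>z. A z v) differentiable (at z)" and dB: "(\<lambda>z. B z v) differentiable (at z)" for v
    using A B U z by (auto simp: smooth_local_form_def intro: smooth_on_differentiable)
  have dT: "T differentiable (at z)" by (rule smooth_on_differentiable[OF T U z])
  let ?DT = "\<lambda>v z. Der T z v"
  have dDT: "?DT v differentiable (at z)" for v
    by (rule smooth_on_differentiable[OF smooth_on_frechet_derivative[OF T] U z])
  \<comment> \<open>The hypothesis, differentiated in the direction \<open>w\<close>.\<close>
  have D: "(B z v ** ?DT w z + Der (\<lambda>z. B z v) z w ** T z)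
      + Der (?DT v) z w =
      T z ** Der (\<lambda>z. A z v) z w + ?DT w z ** A z v" for v w
  proof -
    have BT: "(\<lambda>z. B z v ** T z) differentiable (at z)"
      by (rule differentiableI[OF bounded_bilinear.FDERIV[OF bounded_bilinear_matrix_mult
              dB[THEN frechet_derivative_works[THEN iffD1]] dT[THEN frechet_derivative_works[THEN iffD1]]]])
    have "Der (\<lambda>z. B z v ** T z + ?DT v z) z w
        = (B z v ** ?DT w z + Der (\<lambda>z. B z v) z w ** T z)
          + Der (?DT v) z w"
      by (simp add: frechet_derivative_at[OF has_derivative_add[OF
          BT[THEN frechet_derivative_works[THEN iffD1]] dDT[THEN frechet_derivative_works[THEN iffD1]]], symmetric]
        frechet_derivative_matrix_mult[OF dB dT])
    moreover have "Der (\<lambda>z. B z v ** T z + ?DT v z) z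
        = Der (\<lambda>z. T z ** A z v) z"
      by (rule frechet_derivative_transform_within_open[OF _ U z])
        (auto intro: differentiable_add BT dDT simp: gauge)
    ultimately show ?thesis by (simp add: frechet_derivative_matrix_mult[OF dT dA])
  qed
  have sub: "?DT v z = T z ** A z v - B z v ** T z" for v
    using gauge[OF z, of v] by (simp add: algebra_simps)
  have sym: "Der (?DT w) z v = Der (?DT v) z w"
    by (rule symmetric_second_derivative[OF T U z])
  show ?thesis
    using D[of w v] D[of v w] unfolding sym sub local_curvature_def matrix_algebra_simps
    by (simp add: algebra_simps) (smt (verit) add.assoc add.commute add_left_cancel)
qed

lemma complex_real_expansion: "v = Re v *\<^sub>R 1 + Im v *\<^sub>R \<i>"
  by (simp add: complex_eq_iff)

lemma linear_complex_expansion: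
  assumes "linear (f :: complex \<Rightarrow> 'b::real_vector)"
  shows "f v = Re v *\<^sub>R f 1 + Im v *\<^sub>R f \<i>"
  using linear_add[OF assms] linear_scale[OF assms] complex_real_expansion by metis

text \<open>
  Both derivatives in the curvature are linear in the argument of the form as well, which makes the
  curvature an alternating bilinear form on a plane.
\<close>

lemma smooth_local_form_deriv_linear:
  assumes B: "smooth_local_form U B" and U: "open U" and z: "z \<in> U"
  shows "linear (\<lambda>v. Der (\<lambda>u. B u v) z w)"
proof -
  have d: "((\<lambda>u. B u v) has_derivative Der (\<lambda>u. B u v) z) (at z)" for v
    using B U z by (auto simp: smooth_local_form_def intro: smooth_on_has_derivative)
  have "Der (\<lambda>u. B u (a + b)) z =
      (\<lambda>w. Der (\<lambda>u. B u a) z w + Der (\<lambda>u. B u b) z w)" for a b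
    by (rule frechet_derivative_at[symmetric], rule has_derivative_transform_within_open[OF has_derivative_add[OF d d] U z])
      (use B in \<open>auto simp: smooth_local_form_def linear_add\<close>)
  moreover have "Der (\<lambda>u. B u (r *\<^sub>R a)) z =
      (\<lambda>w. r *\<^sub>R Der (\<lambda>u. B u a) z w)" for a r
    by (rule frechet_derivative_at[symmetric], rule has_derivative_transform_within_open[OF has_derivative_scaleR_right[OF d] U z])
      (use B in \<open>auto simp: smooth_local_form_def linear_scale\<close>)
  ultimately show ?thesis by (intro linearI) auto
qed

lemma local_curvature_alternating:
  assumes B: "smooth_local_form U B" and U: "open U" and z: "z \<in> U"
  shows "local_curvature B z v w = (Re v * Im w - Im v * Re w) *\<^sub>R local_curvature B z 1 \<i>"
proof -
  have Bz: "linear (B z)" using B z by (simp add: smooth_local_form_def)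
  have lin2: "linear (\<lambda>w. Der (\<lambda>u. B u v) z w)" for v
    using B U z by (auto simp: smooth_local_form_def intro!: linear_frechet_derivative smooth_on_differentiable)
  define d where "d x y = Der (\<lambda>u. B u x) z y" for x y
  have "d x y = Re x *\<^sub>R (Re y *\<^sub>R d 1 1 + Im y *\<^sub>R d 1 \<i>) + Im x *\<^sub>R (Re y *\<^sub>R d \<i> 1 + Im y *\<^sub>R d \<i> \<i>)" for x y
    unfolding d_def
    using linear_complex_expansion[OF lin2] linear_complex_expansion[OF smooth_local_form_deriv_linear[OF B U z]]
    by metis
  note d = this[of v w] this[of w v] this[of 1 \<i>] this[of \<i> 1]
  define b1 bi where "b1 = B z 1" and "bi = B z \<i>"
  have b: "B z x = Re x *\<^sub>R b1 + Im x *\<^sub>R bi" for x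
    unfolding b1_def bi_def by (rule linear_complex_expansion[OF Bz])
  show ?thesis
    unfolding local_curvature_def d_def[symmetric] b
    by (subst d(1), subst d(2))
      (simp add: matrix_algebra_simps matrix_scaleR_left
        matrix_scaleR_right algebra_simps scaleR_scaleR)
qed

text \<open>
  In the pulled back form the tangent vector is moved by \<open>D\<phi>\<close>, so its derivative contains a second
  derivative of \<open>\<phi>\<close>; this term is symmetric and cancels in the curvature.
\<close>

lemma local_curvature_pullback:
  assumes B: "smooth_local_form V B" and V: "open V"
    and \<phi>: "smooth_on U \<phi>" and U: "open U" and z: "z \<in> U" and img: "\<phi> ` U \<subseteq> V"
  defines "D \<equiv> \<lambda>z. Der \<phi> z"
  shows "local_curvature (\<lambda>z v. B (\<phi> z) (D z v)) z v w = local_curvature B (\<phi> z) (D z v) (D z w)"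
proof -
  let ?dB = "\<lambda>x v. Der (\<lambda>u. B u x) (\<phi> z) v"
  have \<phi>z: "\<phi> z \<in> V" using img z by auto
  have d\<phi>: "(\<phi> has_derivative D z) (at z)"
    unfolding D_def by (rule smooth_on_has_derivative[OF \<phi> U z])
  have dD: "((\<lambda>z. D z w) has_derivative Der (\<lambda>z. D z w) z) (at z)" for w
    unfolding D_def by (rule smooth_on_has_derivative[OF smooth_on_frechet_derivative[OF \<phi>] U z])
  have dB: "((\<lambda>u. B u x) has_derivative ?dB x) (at (\<phi> z))" for x
    using B V \<phi>z by (auto simp: smooth_local_form_def intro: smooth_on_has_derivative)
  have dB\<phi>: "((\<lambda>z. B (\<phi> z) x) has_derivative (\<lambda>v. ?dB x (D z v))) (at z)" for x
    by (rule has_derivative_compose[OF d\<phi> dB])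
  have lin: "linear (B (\<phi> z))" if "z \<in> U" for z
    using B img that by (auto simp: smooth_local_form_def)
  \<comment> \<open>The vector \<open>D z w\<close> varies with \<open>z\<close>, so it is expanded in the real basis \<open>1, \<i>\<close> before
    the product rule is applied.\<close>
  have deriv: "Der (\<lambda>z. B (\<phi> z) (D z w)) z v =
      B (\<phi> z) (Der (\<lambda>z. D z w) z v) + ?dB (D z w) (D z v)" for v w
  proof -
    let ?DD = "Der (\<lambda>z. D z w) z"
    have "((\<lambda>z. Re (D z w) *\<^sub>R B (\<phi> z) 1 + Im (D z w) *\<^sub>R B (\<phi> z) \<i>) has_derivative
        (\<lambda>v. (Re (D z w) *\<^sub>R ?dB 1 (D z v) + Re (?DD v) *\<^sub>R B (\<phi> z) 1) +
             (Im (D z w) *\<^sub>R ?dB \<i> (D z v) + Im (?DD v) *\<^sub>R B (\<phi> z) \<i>))) (at z)"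
      by (intro has_derivative_add has_derivative_scaleR dB\<phi>
          bounded_linear.has_derivative[OF bounded_linear_Re] bounded_linear.has_derivative[OF bounded_linear_Im] dD)
    then have "((\<lambda>z. B (\<phi> z) (D z w)) has_derivative
        (\<lambda>v. (Re (D z w) *\<^sub>R ?dB 1 (D z v) + Re (?DD v) *\<^sub>R B (\<phi> z) 1) +
             (Im (D z w) *\<^sub>R ?dB \<i> (D z v) + Im (?DD v) *\<^sub>R B (\<phi> z) \<i>))) (at z)"
      by (rule has_derivative_transform_within_open[OF _ U z])
        (use linear_complex_expansion[OF lin] in metis)
    then have "Der (\<lambda>z. B (\<phi> z) (D z w)) z =
        (\<lambda>v. (Re (D z w) *\<^sub>R ?dB 1 (D z v) + Re (?DD v) *\<^sub>R B (\<phi> z) 1) +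
             (Im (D z w) *\<^sub>R ?dB \<i> (D z v) + Im (?DD v) *\<^sub>R B (\<phi> z) \<i>))"
      by (rule frechet_derivative_at[symmetric])
    then show ?thesis
      using linear_complex_expansion[OF lin[OF z], of "?DD v"]
        linear_complex_expansion[OF smooth_local_form_deriv_linear[OF B V \<phi>z], of "D z w" "D z v"]
      by simp
  qed
  have "Der (\<lambda>z. D z w) z v = Der (\<lambda>z. D z v) z w"
    unfolding D_def by (rule symmetric_second_derivative[OF \<phi> U z])
  then show ?thesis unfolding local_curvature_def deriv by simp
qed

lemma smooth_local_form_pullback:
  assumes B: "smooth_local_form V B" and V: "open V"
    and \<phi>: "smooth_on U \<phi>" and U: "open U" and img: "\<phi> ` U \<subseteq> V"
  shows "smooth_local_form U (\<lambda>z v. B (\<phi> z) (Der \<phi> z v))"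
proof -
  have lin: "linear (B (\<phi> z))" if "z \<in> U" for z
    using B img that by (auto simp: smooth_local_form_def)
  have "smooth_on U (\<lambda>z. Re (Der \<phi> z v) *\<^sub>R B (\<phi> z) 1
      + Im (Der \<phi> z v) *\<^sub>R B (\<phi> z) \<i>)" for v
    using B by (intro smooth_on_add[OF U] smooth_on_bilinear[OF bounded_bilinear_scaleR U]
        smooth_on_bounded_linear[OF bounded_linear_Re U] smooth_on_bounded_linear[OF bounded_linear_Im U]
        smooth_on_frechet_derivative[OF \<phi>] smooth_on_compose[OF U V \<phi> _ img])
      (auto simp: smooth_local_form_def)
  then have "smooth_on U (\<lambda>z. B (\<phi> z) (Der \<phi> z v))" for v
    by (rule smooth_on_cong[OF _ U, where f="\<lambda>z. Re (Der \<phi> z v) *\<^sub>R B (\<phi> z) 1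
      + Im (Der \<phi> z v) *\<^sub>R B (\<phi> z) \<i>"])
      (use linear_complex_expansion[OF lin] in metis)
  moreover have "linear (\<lambda>v. B (\<phi> z) (Der \<phi> z v))" if "z \<in> U" for z
    using linear_compose[OF linear_frechet_derivative[OF smooth_on_differentiable[OF \<phi> U that]] lin[OF that]]
    by (simp add: o_def)
  ultimately show ?thesis by (simp add: smooth_local_form_def)
qed

lemma ctranspose_mult: "ctranspose (A ** B) = ctranspose B ** ctranspose A"
  by (simp add: ctranspose_def matrix_matrix_mult_def vec_eq_iff mult.commute)

lemma ctranspose_add: "ctranspose (A + B) = ctranspose A + ctranspose B"
  by (simp add: ctranspose_def vec_eq_iff)

lemma ctranspose_diff: "ctranspose (A - B) = ctranspose A - ctranspose B"
  by (simp add: ctranspose_def vec_eq_iff)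

lemma bounded_linear_ctranspose:
  "bounded_linear (ctranspose :: complex^'n^'n::finite \<Rightarrow> complex^'n^'n)"
  unfolding linear_conv_bounded_linear[symmetric]
  by (rule linearI) (auto simp: ctranspose_def vec_eq_iff)

text \<open>
  \<open>d - B^\<dagger>\<close> is the connection induced by \<open>d + B\<close> on the conjugate dual bundle. The adjoint reverses
  products, which is compensated by the sign.
\<close>

lemma smooth_local_form_neg_ctranspose:
  assumes "smooth_local_form U B" "open U"
  shows "smooth_local_form U (\<lambda>z v. - ctranspose (B z v))"
proof -
  have bl: "bounded_linear (\<lambda>M :: complex^'n^'n. - ctranspose M)"
    by (rule bounded_linear_minus[OF bounded_linear_ctranspose])
  show ?thesis
    unfolding smooth_local_form_def
  proof (intro conjI allI ballI)
    show "smooth_on U (\<lambda>z. - ctranspose (B z v))" for v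
      using assms by (intro smooth_on_bounded_linear[OF bl]) (auto simp: smooth_local_form_def)
    show "linear (\<lambda>v. - ctranspose (B z v))" if "z \<in> U" for z
      using linear_compose[of "B z", OF _ bounded_linear.linear[OF bl]] assms(1) that
      by (simp add: smooth_local_form_def o_def)
  qed
qed

lemma local_curvature_neg_ctranspose:
  assumes B: "smooth_local_form U B" and U: "open U" and z: "z \<in> U"
  shows "local_curvature (\<lambda>z v. - ctranspose (B z v)) z v w = - ctranspose (local_curvature B z v w)"
proof -
  have "Der (\<lambda>u. - ctranspose (B u x)) z
      = (\<lambda>v. - ctranspose (Der (\<lambda>u. B u x) z v))" for x
    using B U z by (intro frechet_derivative_at[symmetric] has_derivative_minus
        bounded_linear.has_derivative[OF bounded_linear_ctranspose])
      (auto simp: smooth_local_form_def intro: smooth_on_has_derivative)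
  then show ?thesis
    by (simp add: local_curvature_def ctranspose_add ctranspose_diff ctranspose_mult matrix_algebra_simps)
qed

lemma bounded_linear_trace: "bounded_linear (trace :: complex^'n^'n::finite \<Rightarrow> complex)"
  unfolding linear_conv_bounded_linear[symmetric]
  by (rule linearI) (auto simp: trace_def sum.distrib scaleR_sum_right)

text \<open>
  The trace of the curvature is the exterior derivative of the trace of the connection form. If that
  trace is a logarithmic differential, it vanishes by symmetry of second derivatives.
\<close>

lemma trace_local_curvature_eq_0:
  fixes f :: "complex \<Rightarrow> complex"
  assumes B: "smooth_local_form U B" and U: "open U" and z: "z \<in> U"
    and f: "smooth_on U f" and f0: "f z \<noteq> 0"
    and eq: "\<And>z v. z \<in> U \<Longrightarrow> Der f z v = trace (B z v) * f z"
  shows "trace (local_curvature B z v w) = 0"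
proof -
  have dB: "((\<lambda>u. B u x) has_derivative Der (\<lambda>u. B u x) z) (at z)" for x
    using B U z by (auto simp: smooth_local_form_def intro: smooth_on_has_derivative)
  have "Der (\<lambda>z. Der f z x) z =
      (\<lambda>y. trace (B z x) * Der f z y + trace (Der (\<lambda>u. B u x) z y) * f z)" for x
    by (rule frechet_derivative_at[symmetric], rule has_derivative_transform_within_open[OF _ U z,
          where f="\<lambda>z. trace (B z x) * f z"])
      (intro has_derivative_mult bounded_linear.has_derivative[OF bounded_linear_trace dB]
        smooth_on_has_derivative[OF f U z], simp add: eq)
  then have "trace (B z w) * Der f z v + trace (Der (\<lambda>u. B u w) z v) * f z
      = trace (B z v) * Der f z w + trace (Der (\<lambda>u. B u v) z w) * f z"
    using symmetric_second_derivative[OF f U z, of w v] by simp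
  then have "trace (Der (\<lambda>u. B u w) z v) = trace (Der (\<lambda>u. B u v) z w)"
    using f0 by (simp add: eq[OF z])
  then show ?thesis
    by (simp add: local_curvature_def trace_add trace_sub trace_mul_sym[of "B z w"])
qed


section \<open>Substitution in polynomials in two variables\<close>

definition ring_morphism :: "('a::comm_ring_1 \<Rightarrow> 'b::comm_ring_1) \<Rightarrow> bool" where
  "ring_morphism \<phi> \<longleftrightarrow>
     \<phi> 1 = 1 \<and> (\<forall>x y. \<phi> (x + y) = \<phi> x + \<phi> y) \<and> (\<forall>x y. \<phi> (x * y) = \<phi> x * \<phi> y)"

lemma ring_morphismD:
  assumes "ring_morphism \<phi>"
  shows "\<phi> 0 = 0" "\<phi> 1 = 1" "\<phi> (x + y) = \<phi> x + \<phi> y" "\<phi> (x * y) = \<phi> x * \<phi> y"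
    "\<phi> (- x) = - \<phi> x" "\<phi> (x - y) = \<phi> x - \<phi> y" "\<phi> (x ^ n) = \<phi> x ^ n"
proof -
  have add: "\<phi> (x + y) = \<phi> x + \<phi> y" and mult: "\<phi> (x * y) = \<phi> x * \<phi> y" and one: "\<phi> 1 = 1" for x y
    using assms by (auto simp: ring_morphism_def)
  show zero: "\<phi> 0 = 0" using add[of 0 0] by simp
  show minus: "\<phi> (- x) = - \<phi> x" for x
    using add[of x "- x"] zero by (simp add: eq_neg_iff_add_eq_0 add.commute)
  show "\<phi> (x - y) = \<phi> x - \<phi> y" using add[of x "- y"] minus by simp
  show "\<phi> (x ^ n) = \<phi> x ^ n" by (induction n) (simp_all add: one mult)
qed (use assms in \<open>auto simp: ring_morphism_def\<close>)

lemma ring_morphism_sum: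
  assumes "ring_morphism \<phi>"
  shows "\<phi> (\<Sum>i\<in>I. f i) = (\<Sum>i\<in>I. \<phi> (f i))"
  by (induction I rule: infinite_finite_induct) (simp_all add: ring_morphismD[OF assms])

lemma poly_map_poly_pCons:
  assumes "ring_morphism \<phi>"
  shows "poly (map_poly \<phi> (pCons a f)) Q = \<phi> a + Q * poly (map_poly \<phi> f) Q"
  by (simp add: map_poly_pCons ring_morphismD[OF assms])

lemma ring_morphism_poly_map_poly:
  assumes \<phi>: "ring_morphism \<phi>"
  shows "ring_morphism (\<lambda>f. poly (map_poly \<phi> f) Q)"
proof -
  let ?F = "\<lambda>f. poly (map_poly \<phi> f) Q"
  note pC = poly_map_poly_pCons[OF \<phi>, where Q=Q]
  have add: "?F (f + g) = ?F f + ?F g" for f g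
  proof (induction f arbitrary: g)
    case (pCons a f)
    then show ?case by (cases g) (simp add: pC ring_morphismD[OF \<phi>] algebra_simps)
  qed (simp add: ring_morphismD[OF \<phi>])
  have smult: "?F (smult c f) = \<phi> c * ?F f" for c f
    by (induction f) (simp_all add: pC ring_morphismD[OF \<phi>] algebra_simps)
  have "?F (f * g) = ?F f * ?F g" for f g
    by (induction f) (simp_all add: add smult pC ring_morphismD[OF \<phi>] algebra_simps)
  then show ?thesis
    using add by (simp add: ring_morphism_def one_pCons pC ring_morphismD[OF \<phi>] map_poly_pCons)
qed

lemma ring_morphism_const2: "ring_morphism const2"
  by (simp add: ring_morphism_def const2_def one_pCons)

lemma ring_morphism_subst2: "ring_morphism (subst2 P Q)"
proof -
  have "subst2 P Q = (\<lambda>f. poly (map_poly (\<lambda>g. poly (map_poly const2 g) P) f) Q)"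
    by (rule ext) (simp add: subst2_def)
  then show ?thesis
    using ring_morphism_poly_map_poly[OF ring_morphism_poly_map_poly[OF ring_morphism_const2]] by metis
qed

lemmas const2_simps = ring_morphismD[OF ring_morphism_const2]
lemmas subst2_simps = ring_morphismD[OF ring_morphism_subst2]

lemma subst2_generators [simp]:
  "subst2 P Q (const2 a) = const2 a" "subst2 P Q var_p = P" "subst2 P Q var_pbar = Q"
proof -
  note h = ring_morphism_poly_map_poly[OF ring_morphism_const2]
  note s = poly_map_poly_pCons[OF h] poly_map_poly_pCons[OF ring_morphism_const2]
  show "subst2 P Q (const2 a) = const2 a" "subst2 P Q var_p = P"
    unfolding subst2_def const2_def[of a] var_p_def s by (simp_all add: const2_def one_pCons[symmetric])
  have "map_poly (\<lambda>g. poly (map_poly const2 g) P) 1 = 1"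
    by (rule map_poly_1') (simp add: ring_morphismD(2)[OF h])
  then show "subst2 P Q var_pbar = Q"
    unfolding subst2_def var_pbar_def s
    by (simp add: ring_morphismD(1)[OF h] one_pCons[symmetric] ring_morphismD(2)[OF h])
qed

lemma pCons_eq_const2: "[:pCons a g:] = const2 a + var_p * [:g:]"
  by (simp add: const2_def var_p_def)

lemma pCons_eq_var_pbar: "pCons g f = [:g:] + var_pbar * (f :: poly2)"
  by (simp add: var_pbar_def)

text \<open>Compositions of substitutions are computed on generators, without sums over coefficients.\<close>

lemma ring_morphism_poly2_eqI:
  assumes "ring_morphism \<phi>" "ring_morphism \<psi>"
    and "\<And>a. \<phi> (const2 a) = \<psi> (const2 a)" "\<phi> var_p = \<psi> var_p" "\<phi> var_pbar = \<psi> var_pbar"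
  shows "\<phi> f = \<psi> f"
proof -
  have inner: "\<phi> [:g:] = \<psi> [:g:]" for g
  proof (induction g)
    case 0
    then show ?case using assms(1,2) by (simp add: ring_morphismD)
  next
    case (pCons a g)
    then show ?case
      using assms by (simp add: pCons_eq_const2 ring_morphismD del: mult_pCons_left mult_pCons_right)
  qed
  show ?thesis
  proof (induction f)
    case 0
    then show ?case using assms(1,2) by (simp add: ring_morphismD)
  next
    case (pCons g f)
    then show ?case using assms inner by (simp add: pCons_eq_var_pbar[of g f] ring_morphismD)
  qed
qed

lemma ring_morphism_comp: "ring_morphism \<phi> \<Longrightarrow> ring_morphism \<psi> \<Longrightarrow> ring_morphism (\<lambda>x. \<psi> (\<phi> x))"
  by (simp add: ring_morphism_def)

lemma subst2_subst2:
  "subst2 P Q (subst2 P' Q' f) = subst2 (subst2 P Q P') (subst2 P Q Q') f"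
  by (rule ring_morphism_poly2_eqI[OF ring_morphism_comp[OF ring_morphism_subst2 ring_morphism_subst2]
        ring_morphism_subst2]) auto

lemma subst2_vars: "subst2 var_p var_pbar f = f"
  by (rule ring_morphism_poly2_eqI[OF ring_morphism_subst2]) (auto simp: ring_morphism_def)

lemma coeff2_simps [simp]:
  "coeff2 0 i j = 0"
  "coeff2 (f + g) i j = coeff2 f i j + coeff2 g i j"
  "coeff2 (f - g) i j = coeff2 f i j - coeff2 g i j"
  by (simp_all add: coeff2_def)

lemma coeff2_sum: "coeff2 (\<Sum>k\<in>K. f k) i j = (\<Sum>k\<in>K. coeff2 (f k) i j)"
  by (simp add: coeff2_def coeff_sum)

lemma coeff2_mult:
  "coeff2 (f * g) i j = (\<Sum>l\<le>j. \<Sum>k\<le>i. coeff2 f k l * coeff2 g (i - k) (j - l))"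
  by (simp add: coeff2_def coeff_mult coeff_sum)

lemma coeff2_const2: "coeff2 (const2 a) i j = (if i = 0 \<and> j = 0 then a else 0)"
  by (cases i; cases j) (auto simp: coeff2_def const2_def)

lemma coeff2_var_p: "coeff2 var_p i j = (if i = 1 \<and> j = 0 then 1 else 0)"
  by (cases i; cases j) (auto simp: coeff2_def var_p_def coeff_pCons split: nat.splits)

lemma coeff2_var_pbar: "coeff2 var_pbar i j = (if i = 0 \<and> j = 1 then 1 else 0)"
  by (cases i; cases j) (auto simp: coeff2_def var_pbar_def coeff_pCons split: nat.splits)

lemma eval2_0_0: "eval2 f 0 0 = coeff2 f 0 0"
  by (simp add: eval2_def coeff2_def poly_0_coeff_0)

text \<open>
  The linear parts of conjugates, needed for comparing \<open>I\<close> with \<open>conj I\<close>. They are extracted from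
  the recursive description \<open>f = a + p g + pbar f'\<close>.
\<close>

lemma coeff2_conj2:
  shows "coeff2 (conj2 f) 1 0 = cnj (coeff2 f 0 1)" and "coeff2 (conj2 f) 0 1 = cnj (coeff2 f 1 0)"
proof -
  have conj_pCons: "conj2 (pCons g f) = conj2 [:g:] + var_p * conj2 f" for g f
  proof -
    have "map_poly (map_poly cnj) (pCons g f)
        = map_poly (map_poly cnj) [:g:] + var_pbar * map_poly (map_poly cnj) f"
      using pCons_eq_var_pbar[of "map_poly cnj g" "map_poly (map_poly cnj) f"] by (simp add: map_poly_pCons)
    then show ?thesis by (simp add: conj2_def subst2_simps)
  qed
  have conj_const: "conj2 [:pCons a g:] = const2 (cnj a) + var_pbar * conj2 [:g:]" for a g
  proof -
    have "map_poly (map_poly cnj) [:pCons a g:] = const2 (cnj a) + var_p * map_poly (map_poly cnj) [:g:]"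
      using pCons_eq_const2[of "cnj a" "map_poly cnj g"]
      by (simp add: map_poly_pCons del: mult_pCons_left mult_pCons_right)
    then show ?thesis
      by (simp add: conj2_def subst2_simps del: mult_pCons_left mult_pCons_right)
  qed
  have c00': "coeff2 (conj2 [:g:]) 0 0 = cnj (coeff g 0)" for g
  proof -
    obtain a g' where g: "g = pCons a g'" by (cases g)
    show ?thesis unfolding g conj_const by (simp add: coeff2_mult coeff2_const2 coeff2_var_pbar)
  qed
  have c00: "coeff2 (conj2 f) 0 0 = cnj (coeff2 f 0 0)" for f
  proof -
    obtain g f' where f: "f = pCons g f'" by (cases f)
    show ?thesis
      unfolding f conj_pCons[of g f'] by (simp add: c00' coeff2_mult coeff2_var_p) (simp add: coeff2_def)
  qed
  obtain g f' where f: "f = pCons g f'" by (cases f)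
  obtain a g' where g: "g = pCons a g'" by (cases g)
  have f_conj: "conj2 f = const2 (cnj a) + var_pbar * conj2 [:g':] + var_p * conj2 f'"
  proof -
    have "conj2 f = conj2 [:g:] + var_p * conj2 f'" unfolding f by (rule conj_pCons)
    also have "conj2 [:g:] = const2 (cnj a) + var_pbar * conj2 [:g':]" unfolding g by (rule conj_const)
    finally show ?thesis .
  qed
  show "coeff2 (conj2 f) 1 0 = cnj (coeff2 f 0 1)" "coeff2 (conj2 f) 0 1 = cnj (coeff2 f 1 0)"
    unfolding f_conj
    by (simp_all add: coeff2_mult coeff2_const2 coeff2_var_p coeff2_var_pbar c00 c00')
      (simp_all add: f g coeff2_def)
qed


section \<open>Ideals of finite codimension supported at the origin\<close>

lemma is_ideal_iff:
  "is_ideal J \<longleftrightarrow> 0 \<in> J \<and> (\<forall>f\<in>J. \<forall>g\<in>J. f + g \<in> J) \<and> (\<forall>c. \<forall>f\<in>J. c * f \<in> J)"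
proof -
  have "module ((*) :: poly2 \<Rightarrow> poly2 \<Rightarrow> poly2)"
    by unfold_locales (simp_all add: algebra_simps)
  then show ?thesis by (simp add: is_ideal_def module.subspace_def)
qed

lemma in_ideal_gen: "f \<in> B \<Longrightarrow> f \<in> ideal_gen B"
proof -
  have "module ((*) :: poly2 \<Rightarrow> poly2 \<Rightarrow> poly2)"
    by unfold_locales (simp_all add: algebra_simps)
  then show "f \<in> B \<Longrightarrow> f \<in> ideal_gen B" by (simp add: ideal_gen_def module.span_base)
qed

lemma ideal_simps:
  assumes "is_ideal J"
  shows "0 \<in> J" "f \<in> J \<Longrightarrow> g \<in> J \<Longrightarrow> f + g \<in> J" "f \<in> J \<Longrightarrow> c * f \<in> J" "f \<in> J \<Longrightarrow> f * c \<in> J"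
    "f \<in> J \<Longrightarrow> - f \<in> J" "f \<in> J \<Longrightarrow> g \<in> J \<Longrightarrow> f - g \<in> J"
proof -
  have *: "0 \<in> J" "\<And>f g. f \<in> J \<Longrightarrow> g \<in> J \<Longrightarrow> f + g \<in> J" "\<And>c f. f \<in> J \<Longrightarrow> c * f \<in> J"
    using assms by (auto simp: is_ideal_iff)
  then show "0 \<in> J" "f \<in> J \<Longrightarrow> g \<in> J \<Longrightarrow> f + g \<in> J" "f \<in> J \<Longrightarrow> c * f \<in> J"
    by blast+
  show "f \<in> J \<Longrightarrow> f * c \<in> J" using *(3)[of f c] by (simp add: mult.commute)
  show neg: "f \<in> J \<Longrightarrow> - f \<in> J" for f using *(3)[of f "-1"] by simp
  show "f \<in> J \<Longrightarrow> g \<in> J \<Longrightarrow> f - g \<in> J" using *(2)[of f "- g"] neg by simp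
qed

lemma ideal_sum:
  assumes "is_ideal J" "\<And>k. k \<in> K \<Longrightarrow> f k \<in> J"
  shows "(\<Sum>k\<in>K. f k) \<in> J"
  using assms(2) by (induction K rule: infinite_finite_induct) (auto intro: ideal_simps[OF assms(1)])

text \<open>
  An element of least degree divides all the others, so each of its zeros would be a common zero;
  hence it is constant.
\<close>

lemma one_in_poly_ideal:
  fixes K :: "complex poly set"
  assumes "0 \<in> K" "\<And>f g. f \<in> K \<Longrightarrow> g \<in> K \<Longrightarrow> f + g \<in> K" "\<And>c f. f \<in> K \<Longrightarrow> c * f \<in> K"
    and no_zero: "\<And>b. \<exists>f\<in>K. poly f b \<noteq> 0"
  shows "1 \<in> K"
proof -
  define d where "d = (ARG_MIN degree d. d \<in> K \<and> d \<noteq> 0)"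
  have "\<exists>d. d \<in> K \<and> d \<noteq> 0" using no_zero[of 0] by auto
  then have d: "d \<in> K" "d \<noteq> 0" and least: "\<And>f. f \<in> K \<Longrightarrow> f \<noteq> 0 \<Longrightarrow> degree d \<le> degree f"
    using arg_min_nat_lemma[of "\<lambda>d. d \<in> K \<and> d \<noteq> 0" _ degree] unfolding d_def by blast+
  have dvd: "d dvd f" if "f \<in> K" for f
  proof (rule ccontr)
    assume "\<not> d dvd f"
    then have "f mod d \<noteq> 0" by (simp add: dvd_eq_mod_eq_0)
    moreover have "f mod d = f + (- (f div d)) * d" by (simp add: minus_div_mult_eq_mod[symmetric])
    ultimately show False
      using least[of "f mod d"] degree_mod_less'[OF d(2)] assms(2,3) that d(1) by (metis leD)
  qed
  have "degree d = 0"
  proof (rule ccontr)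
    assume "degree d \<noteq> 0"
    then obtain b where "poly d b = 0"
      using fundamental_theorem_of_algebra[of d] by (auto simp: constant_degree)
    then show False using no_zero[of b] dvd by (metis dvdE mult_zero_left poly_mult)
  qed
  then obtain a where "d = [:a:]" by (rule degree_eq_zeroE)
  then have "[:inverse a:] * d = 1" using d(2) by (simp add: one_pCons)
  then show ?thesis using assms(3)[OF d(1)] by metis
qed

text \<open>
  By the previous lemma some element of the ideal is mapped to \<open>1\<close>, so it differs from \<open>1\<close> by a
  multiple of \<open>t\<close>. The surjections to be considered are the restrictions to the lines \<open>p = a\<close> and
  \<open>pbar = a\<close> with \<open>a \<noteq> 0\<close>, which avoid the only zero of the ideal.
\<close>

lemma invertible_mod_ideal:
  fixes \<epsilon> :: "poly2 \<Rightarrow> complex poly"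
  assumes J: "is_ideal J" and \<epsilon>: "ring_morphism \<epsilon>" and surj: "surj \<epsilon>"
    and ker: "\<And>f. \<epsilon> f = 0 \<Longrightarrow> t dvd f"
    and no_zero: "\<And>b. \<exists>f\<in>J. poly (\<epsilon> f) b \<noteq> 0"
  shows "\<exists>h. 1 - t * h \<in> J"
proof -
  have "1 \<in> \<epsilon> ` J"
  proof (rule one_in_poly_ideal)
    show "0 \<in> \<epsilon> ` J" using ideal_simps(1)[OF J] ring_morphismD(1)[OF \<epsilon>] by force
    show "f + g \<in> \<epsilon> ` J" if fg: "f \<in> \<epsilon> ` J" "g \<in> \<epsilon> ` J" for f g
    proof -
      obtain f' g' where "f = \<epsilon> f'" "g = \<epsilon> g'" "f' \<in> J" "g' \<in> J"
        using fg by blast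
      then show ?thesis using ideal_simps(2)[OF J, of f' g'] ring_morphismD(3)[OF \<epsilon>, of f' g'] by force
    qed
    show "c * f \<in> \<epsilon> ` J" if f: "f \<in> \<epsilon> ` J" for c f
    proof -
      obtain f' c' where "f = \<epsilon> f'" "c = \<epsilon> c'" "f' \<in> J" using f surjD[OF surj, of c] by blast
      then show ?thesis using ideal_simps(3)[OF J, of f' c'] ring_morphismD(4)[OF \<epsilon>, of c' f'] by force
    qed
  qed (use no_zero in auto)
  then obtain f where f: "f \<in> J" "\<epsilon> f = 1" by auto
  then have "\<epsilon> (1 - f) = 0" by (simp add: ring_morphismD[OF \<epsilon>])
  then obtain h where "1 - f = t * h" using ker by blast
  then have "1 - t * h = f" by (simp add: algebra_simps)
  then show ?thesis using f by metis
qed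

lemma invertible_var_p:
  assumes J: "is_ideal J" and zero: "\<And>u v. (\<forall>f\<in>J. eval2 f u v = 0) \<Longrightarrow> (u, v) = (0, 0)" and a: "a \<noteq> 0"
  shows "\<exists>h. 1 - (var_p - const2 a) * h \<in> J"
proof (rule invertible_mod_ideal[OF J])
  let ?e = "\<lambda>f :: poly2. map_poly (\<lambda>g. poly g a) f"
  show mor: "ring_morphism ?e"
    unfolding ring_morphism_def
    by (auto simp: poly_eq_iff coeff_map_poly coeff_mult poly_sum)
  have "?e (map_poly (\<lambda>c. [:c:]) k) = k" for k
    by (simp add: poly_eq_iff coeff_map_poly)
  then show "surj ?e" by (metis surjI)
  show "var_p - const2 a dvd f" if "?e f = 0" for f
  proof -
    have "[:-a, 1:] dvd coeff f i" for i
      using that by (simp add: poly_eq_iff coeff_map_poly poly_eq_0_iff_dvd)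
    moreover have "var_p - const2 a = [:[:-a, 1:]:]" by (simp add: var_p_def const2_def)
    ultimately show ?thesis by (simp add: const_poly_dvd_iff)
  qed
  have ev: "poly (?e f) b = eval2 f a b" for f b
    by (induction f) (simp_all add: eval2_def map_poly_pCons)
  show "\<exists>f\<in>J. poly (?e f) b \<noteq> 0" for b
    unfolding ev using zero[of a b] a by auto
qed

lemma invertible_var_pbar:
  assumes J: "is_ideal J" and zero: "\<And>u v. (\<forall>f\<in>J. eval2 f u v = 0) \<Longrightarrow> (u, v) = (0, 0)" and a: "a \<noteq> 0"
  shows "\<exists>h. 1 - (var_pbar - const2 a) * h \<in> J"
proof (rule invertible_mod_ideal[OF J])
  let ?e = "\<lambda>f :: poly2. poly f [:a:]"
  show "ring_morphism ?e" by (simp add: ring_morphism_def)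
  have "?e [:k:] = k" for k by simp
  then show "surj ?e" by (metis surjI)
  show "var_pbar - const2 a dvd f" if "?e f = 0" for f
  proof -
    have "[:- [:a:], 1:] dvd f" using that by (simp add: poly_eq_0_iff_dvd)
    moreover have "var_pbar - const2 a = [:- [:a:], 1:]" by (simp add: var_pbar_def const2_def)
    ultimately show ?thesis by simp
  qed
  show "\<exists>f\<in>J. poly (?e f) b \<noteq> 0" for b
    using zero[of b a] a by (auto simp: eval2_def)
qed

text \<open>
  A polynomial in \<open>t\<close> that lies in the ideal can be stripped of its nonzero roots, since these
  contribute factors that are invertible modulo the ideal.
\<close>

lemma power_degree_in_ideal:
  assumes J: "is_ideal J" and inv: "\<And>a. a \<noteq> 0 \<Longrightarrow> \<exists>h. 1 - (t - const2 a) * h \<in> J"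
    and "g \<noteq> 0" "poly (map_poly const2 g) t * f \<in> J"
  shows "t ^ degree g * f \<in> J"
  using assms(3,4)
proof (induction "degree g" arbitrary: g f)
  case 0
  then obtain c where c: "g = [:c:]" by (metis degree_eq_zeroE)
  then have "const2 c * f \<in> J" using 0 by (simp add: map_poly_pCons const2_simps)
  then have "const2 (inverse c) * (const2 c * f) \<in> J" by (rule ideal_simps[OF J])
  moreover have "const2 (inverse c) * const2 c = 1"
    using c 0 by (simp add: const2_def one_pCons)
  ultimately show ?case using 0 by (simp add: mult.assoc[symmetric])
next
  case (Suc k)
  then obtain a where "poly g a = 0"
    using fundamental_theorem_of_algebra[of g] by (auto simp: constant_degree)
  then obtain h where h: "g = [:-a, 1:] * h" by (auto simp: poly_eq_0_iff_dvd)
  with Suc.prems have h0: "h \<noteq> 0" by auto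
  have deg: "degree g = Suc (degree h)"
    using h h0 by (simp add: degree_mult_eq del: mult_pCons_left)
  have "poly (map_poly const2 g) t = poly (map_poly const2 [:-a, 1:]) t * poly (map_poly const2 h) t"
    unfolding h by (rule ring_morphismD(4)[OF ring_morphism_poly_map_poly[OF ring_morphism_const2]])
  also have "poly (map_poly const2 [:-a, 1:]) t = t - const2 a"
    by (simp add: map_poly_pCons const2_simps one_pCons[symmetric])
  finally have g: "poly (map_poly const2 g) t * f = (t - const2 a) * (poly (map_poly const2 h) t * f)"
    by (simp add: mult.assoc)
  show ?case
  proof (cases "a = 0")
    case True
    then have "poly (map_poly const2 h) t * (t * f) \<in> J"
      using Suc.prems g by (simp add: const2_simps mult.left_commute)
    then have "t ^ degree h * (t * f) \<in> J"
      using Suc.hyps deg h0 by (metis nat.inject)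
    then show ?thesis by (simp add: deg mult.assoc mult.left_commute)
  next
    case False
    then obtain q where q: "1 - (t - const2 a) * q \<in> J" using inv by blast
    let ?x = "poly (map_poly const2 h) t * f"
    have "(1 - (t - const2 a) * q) * ?x + q * ((t - const2 a) * ?x) \<in> J"
      by (rule ideal_simps(2)[OF J ideal_simps(4)[OF J q] ideal_simps(3)[OF J Suc.prems(2)[unfolded g]]])
    then have "?x \<in> J" by (simp add: algebra_simps)
    then have "t ^ degree h * f \<in> J" using Suc.hyps deg h0 by (metis nat.inject)
    then have "t * (t ^ degree h * f) \<in> J" by (rule ideal_simps[OF J])
    then show ?thesis by (simp add: deg mult.assoc)
  qed
qed

lemma coords_is_coords: "basis_mod J K b \<Longrightarrow> is_coords J K b f (coords J K b f)"
  unfolding coords_def basis_mod_def by (metis theI')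

lemma coords_eqI: "basis_mod J K b \<Longrightarrow> is_coords J K b f a \<Longrightarrow> coords J K b f = a"
  using coords_is_coords unfolding basis_mod_def by metis

lemma coords_cong:
  assumes J: "is_ideal J" and b: "basis_mod J K b" and fg: "f - g \<in> J"
  shows "coords J K b f = coords J K b g"
proof (rule coords_eqI[OF b])
  have "(f - g) + (g - (\<Sum>k\<in>K. const2 (coords J K b g k) * b k)) \<in> J"
    using coords_is_coords[OF b, of g] by (intro ideal_simps(2)[OF J fg]) (simp add: is_coords_def)
  then show "is_coords J K b f (coords J K b g)"
    using coords_is_coords[OF b, of g] by (simp add: is_coords_def)
qed

lemma coords_add:
  assumes J: "is_ideal J" and b: "basis_mod J K b"
  shows "coords J K b (f + g) = (\<lambda>k. coords J K b f k + coords J K b g k)"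
proof (rule coords_eqI[OF b])
  have eq: "f + g - (\<Sum>k\<in>K. const2 (coords J K b f k + coords J K b g k) * b k)
      = (f - (\<Sum>k\<in>K. const2 (coords J K b f k) * b k)) + (g - (\<Sum>k\<in>K. const2 (coords J K b g k) * b k))"
    by (simp add: const2_simps sum.distrib algebra_simps)
  then show "is_coords J K b (f + g) (\<lambda>k. coords J K b f k + coords J K b g k)"
    using coords_is_coords[OF b, of g] coords_is_coords[OF b, of f] ideal_simps(2)[OF J]
    unfolding is_coords_def eq by auto
qed

lemma coords_scale:
  assumes J: "is_ideal J" and b: "basis_mod J K b"
  shows "coords J K b (const2 c * f) = (\<lambda>k. c * coords J K b f k)"
proof (rule coords_eqI[OF b])
  have eq: "const2 c * f - (\<Sum>k\<in>K. const2 (c * coords J K b f k) * b k)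
      = const2 c * (f - (\<Sum>k\<in>K. const2 (coords J K b f k) * b k))"
    by (simp add: const2_simps sum_distrib_left algebra_simps)
  then show "is_coords J K b (const2 c * f) (\<lambda>k. c * coords J K b f k)"
    using coords_is_coords[OF b, of f] ideal_simps(3)[OF J]
    unfolding is_coords_def eq by auto
qed

lemma coords_0:
  assumes J: "is_ideal J" and b: "basis_mod J K b"
  shows "coords J K b 0 = (\<lambda>k. 0)"
  using coords_scale[OF J b, of 0 0] by (simp add: const2_simps)

lemma coords_sum:
  assumes J: "is_ideal J" and b: "basis_mod J K b"
  shows "coords J K b (\<Sum>i\<in>I. f i) k = (\<Sum>i\<in>I. coords J K b (f i) k)"
  by (induction I rule: infinite_finite_induct) (simp_all add: coords_0[OF J b] coords_add[OF J b])

lemma coords_eq_0_iff: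
  assumes J: "is_ideal J" and b: "basis_mod J K b"
  shows "coords J K b f = (\<lambda>k. 0) \<longleftrightarrow> f \<in> J"
proof
  assume "coords J K b f = (\<lambda>k. 0)"
  then show "f \<in> J" using coords_is_coords[OF b, of f] by (simp add: is_coords_def const2_simps)
next
  assume "f \<in> J"
  then show "coords J K b f = (\<lambda>k. 0)" using coords_cong[OF J b, of f 0] coords_0[OF J b] by simp
qed

lemma linear_dependence_mod_ideal:
  fixes b :: "'n::finite \<Rightarrow> poly2" and f :: "nat \<Rightarrow> poly2"
  assumes J: "is_ideal J" and b: "basis_mod J UNIV b"
  shows "\<exists>c. (\<exists>k\<le>CARD('n). c k \<noteq> 0) \<and> (\<Sum>k\<le>CARD('n). const2 (c k) * f k) \<in> J"
proof -
  let ?N = "CARD('n)"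
  define v :: "nat \<Rightarrow> complex^'n" where "v k = (\<chi> i. coords J UNIV b (f k) i)" for k
  have "\<exists>c. (\<exists>k\<le>?N. c k \<noteq> 0) \<and> (\<Sum>k\<le>?N. c k *s v k) = 0"
  \<comment> \<open>Linear dependence is a property of sets of vectors; repetitions are treated separately.\<close>
  proof (cases "inj_on v {..?N}")
    case False
    then obtain i j where ij: "i \<le> ?N" "j \<le> ?N" "i \<noteq> j" "v i = v j" by (auto simp: inj_on_def)
    let ?c = "\<lambda>k. if k = i then 1 else if k = j then -1 else (0::complex)"
    have "(\<Sum>k\<le>?N. ?c k *s v k) = (\<Sum>k\<in>{i, j}. ?c k *s v k)"
      using ij by (intro sum.mono_neutral_right) auto
    also have "\<dots> = 0" using ij by (simp add: vec_eq_iff)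
    finally show ?thesis using ij by (intro exI[of _ ?c]) auto
  next
    case True
    have "vec.dependent (v ` {..?N})"
    proof (rule vec.dependent_biggerset_general)
      have "vec.dim (v ` {..?N}) \<le> ?N"
        using vec.dim_subset[OF subset_UNIV, of "v ` {..?N}"] by (simp only: vec_dim_card)
      then show "vec.dim (v ` {..?N}) < card (v ` {..?N})" using True by (simp add: card_image)
    qed
    then obtain u where u: "\<exists>x\<in>v ` {..?N}. u x \<noteq> 0" "(\<Sum>x\<in>v ` {..?N}. u x *s x) = 0"
      by (auto simp: vec.dependent_finite)
    then show ?thesis
      using True by (intro exI[of _ "\<lambda>k. u (v k)"]) (auto simp: sum.reindex)
  qed
  then obtain c where c: "\<exists>k\<le>?N. c k \<noteq> 0" "(\<Sum>k\<le>?N. c k *s v k) = 0" by blast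
  have "coords J UNIV b (\<Sum>k\<le>?N. const2 (c k) * f k) i = 0" for i
    using c(2) by (simp add: coords_sum[OF J b] coords_scale[OF J b] vec_eq_iff v_def)
  then have "(\<Sum>k\<le>?N. const2 (c k) * f k) \<in> J"
    using coords_eq_0_iff[OF J b] by blast
  then show ?thesis using c(1) by blast
qed

text \<open>
  The powers \<open>1, t, ..., t^n\<close> are dependent modulo the ideal, so some nonzero polynomial in \<open>t\<close> of
  degree at most \<open>n\<close> lies in it.
\<close>

lemma power_in_ideal:
  fixes b :: "'n::finite \<Rightarrow> poly2"
  assumes J: "is_ideal J" and b: "basis_mod J UNIV b"
    and inv: "\<And>a. a \<noteq> 0 \<Longrightarrow> \<exists>h. 1 - (t - const2 a) * h \<in> J"
  shows "t ^ CARD('n) \<in> J"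
proof -
  let ?N = "CARD('n)"
  obtain c where c: "\<exists>k\<le>?N. c k \<noteq> 0" "(\<Sum>k\<le>?N. const2 (c k) * t ^ k) \<in> J"
    using linear_dependence_mod_ideal[OF J b, of "\<lambda>k. t ^ k"] by blast
  define g where "g = (\<Sum>k\<le>?N. monom (c k) k)"
  note mor = ring_morphism_poly_map_poly[OF ring_morphism_const2, of t]
  have "poly (map_poly const2 (monom a k)) t = const2 a * t ^ k" for a k
    by (simp add: map_poly_monom const2_simps poly_monom)
  then have "poly (map_poly const2 g) t = (\<Sum>k\<le>?N. const2 (c k) * t ^ k)"
    unfolding g_def by (simp add: ring_morphism_sum[OF mor])
  moreover have "coeff g k = c k" if "k \<le> ?N" for k
    using that by (simp add: g_def coeff_sum)
  then have "g \<noteq> 0" using c(1) by auto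
  moreover have "degree g \<le> ?N"
    unfolding g_def by (intro degree_sum_le) (auto intro: order_trans[OF degree_monom_le])
  ultimately have "t ^ degree g \<in> J" and "degree g \<le> ?N"
    using power_degree_in_ideal[OF J inv, of g 1] c(2) by auto
  then have "t ^ (?N - degree g) * t ^ degree g \<in> J" by (intro ideal_simps[OF J])
  then show ?thesis using \<open>degree g \<le> ?N\<close> by (simp add: power_add[symmetric])
qed

definition truncate2 :: "nat \<Rightarrow> poly2 \<Rightarrow> poly2" where
  "truncate2 n f = (\<Sum>j<n. \<Sum>i<n. const2 (coeff2 f i j) * var_p ^ i * var_pbar ^ j)"

lemma var_p_power: "var_p ^ i = [:monom 1 i:]"
  by (induction i) (simp_all add: var_p_def monom_Suc one_pCons)

lemma var_pbar_power: "var_pbar ^ j = monom 1 j"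
  by (simp add: var_pbar_def monom_altdef[of 1 j])

text \<open>
  This reduces arbitrary representatives to polynomials of uniformly bounded degree, so that
  only finitely many of their coefficients matter.
\<close>

lemma truncate2_mod_ideal:
  assumes J: "is_ideal J" and p: "var_p ^ n \<in> J" and q: "var_pbar ^ n \<in> J"
  shows "f - truncate2 n f \<in> J"
proof -
  have inner: "[:g:] - (\<Sum>i<n. const2 (coeff g i) * var_p ^ i) \<in> J" for g
  proof -
    let ?r = "g - (\<Sum>i<n. monom (coeff g i) i)"
    have "coeff ?r k = 0" if "k < n" for k
      using that by (simp add: coeff_sum)
    then have "monom 1 n dvd ?r" by (simp add: monom_1_dvd_iff')
    then obtain h where "?r = monom 1 n * h" by blast
    then have "[:?r:] = var_p ^ n * [:h:]" by (simp add: var_p_power)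
    then have "[:?r:] \<in> J" using ideal_simps(4)[OF J p] by metis
    moreover have "(\<Sum>i<m. const2 (coeff g i) * var_p ^ i) = [:\<Sum>i<m. monom (coeff g i) i:]" for m
      by (induction m) (simp_all add: const2_def var_p_power smult_monom)
    ultimately show ?thesis by simp
  qed
  have outer: "f - (\<Sum>j<n. [:coeff f j:] * var_pbar ^ j) \<in> J"
  proof -
    let ?r = "f - (\<Sum>j<n. monom (coeff f j) j)"
    have "coeff ?r k = 0" if "k < n" for k
      using that by (simp add: coeff_sum)
    then have "monom 1 n dvd ?r" by (simp add: monom_1_dvd_iff')
    then obtain h where "?r = var_pbar ^ n * h" by (auto simp: var_pbar_power)
    moreover have "[:coeff f j:] * var_pbar ^ j = monom (coeff f j) j" for j
      by (simp add: var_pbar_power smult_monom one_pCons[symmetric])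
    ultimately show ?thesis using ideal_simps(4)[OF J q] by simp
  qed
  have "(\<Sum>j<n. ([:coeff f j:] - (\<Sum>i<n. const2 (coeff2 f i j) * var_p ^ i)) * var_pbar ^ j) \<in> J"
    unfolding coeff2_def by (intro ideal_sum[OF J] ideal_simps(4)[OF J] inner)
  then have "(\<Sum>j<n. [:coeff f j:] * var_pbar ^ j) - truncate2 n f \<in> J"
    by (simp add: truncate2_def left_diff_distrib sum_subtractf sum_distrib_right)
  with outer show ?thesis using ideal_simps(2)[OF J] by fastforce
qed

lemma hilb0D:
  assumes "J \<in> hilb0 n"
  shows "is_ideal J" and "\<And>u v. (\<forall>f\<in>J. eval2 f u v = 0) \<Longrightarrow> (u, v) = (0, 0)"
    and "\<And>f. f \<in> J \<Longrightarrow> coeff2 f 0 0 = 0"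
proof -
  show "is_ideal J" using assms by (simp add: hilb0_def)
  have Z: "{(u, v). \<forall>f\<in>J. eval2 f u v = 0} = {(0, 0)}" using assms by (simp add: hilb0_def)
  have Z': "(\<forall>f\<in>J. eval2 f u v = 0) \<longleftrightarrow> (u, v) = (0, 0)" for u v
    using set_eq_iff[THEN iffD1, OF Z, rule_format, of "(u, v)"] by simp
  show "(u, v) = (0, 0)" if "\<forall>f\<in>J. eval2 f u v = 0" for u v
    using Z' that by blast
  show "coeff2 f 0 0 = 0" if "f \<in> J" for f
    using Z'[of 0 0] that by (simp add: eval2_0_0)
qed

lemma truncate2_mod_hilb0:
  fixes b :: "'n::finite \<Rightarrow> poly2"
  assumes J: "J \<in> hilb0 CARD('n)" and b: "basis_mod J UNIV b"
  shows "f - truncate2 CARD('n) f \<in> J"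
proof -
  note I = hilb0D(1)[OF J]
  have "var_p ^ CARD('n) \<in> J"
    by (rule power_in_ideal[OF I b invertible_var_p[OF I hilb0D(2)[OF J]]])
  moreover have "var_pbar ^ CARD('n) \<in> J"
    by (rule power_in_ideal[OF I b invertible_var_pbar[OF I hilb0D(2)[OF J]]])
  ultimately show ?thesis by (rule truncate2_mod_ideal[OF I])
qed


section \<open>Smooth functions on a closed surface\<close>

locale surface =
  fixes \<A> :: "'a::t2_space chart set"
  assumes surface: "closed_surface \<A>"
begin

abbreviation smooth :: "'a set \<Rightarrow> ('a \<Rightarrow> 'b::real_normed_vector) \<Rightarrow> bool" where
  "smooth \<equiv> smooth_fn \<A>"

lemma compact_surface: "compact (UNIV :: 'a set)"
  using surface by (simp add: closed_surface_def)

lemma chart_exists: "\<exists>c\<in>\<A>. x \<in> fst c"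
  using surface unfolding closed_surface_def by blast

lemma chart_facts:
  assumes "c \<in> \<A>"
  shows "open (fst c)" "open (chart_image c UNIV)"
    "homeomorphism (fst c) (chart_image c UNIV) (snd c) (chart_inv c)"
  using surface assms unfolding closed_surface_def by auto

lemma chart_inv_snd: "c \<in> \<A> \<Longrightarrow> x \<in> fst c \<Longrightarrow> chart_inv c (snd c x) = x"
  using chart_facts(3) by (auto simp: homeomorphism_def)

lemma snd_in_chart_image: "x \<in> fst c \<Longrightarrow> x \<in> W \<Longrightarrow> snd c x \<in> chart_image c W"
  by (simp add: chart_image_def)

lemma chart_imageD:
  assumes "c \<in> \<A>" "z \<in> chart_image c W"
  shows "chart_inv c z \<in> fst c" "chart_inv c z \<in> W" "snd c (chart_inv c z) = z"
  using assms(2) chart_inv_snd[OF assms(1)] by (auto simp: chart_image_def)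

lemma chart_image_mono: "W \<subseteq> W' \<Longrightarrow> chart_image c W \<subseteq> chart_image c W'"
  by (auto simp: chart_image_def)

lemma open_chart_image:
  assumes c: "c \<in> \<A>" and W: "open W"
  shows "open (chart_image c W)"
proof -
  have "chart_image c W = chart_image c UNIV \<inter> chart_inv c -` W"
    using chart_inv_snd[OF c] by (auto simp: chart_image_def)
  then show ?thesis
    using chart_facts[OF c] W by (metis continuous_open_preimage homeomorphism_def)
qed

lemma smooth_fn_subset: "smooth W f \<Longrightarrow> W' \<subseteq> W \<Longrightarrow> smooth W' f"
  unfolding smooth_fn_def using smooth_on_subset chart_image_mono by metis

lemma smooth_fn_cong:
  assumes "smooth W f" "open W" "\<And>x. x \<in> W \<Longrightarrow> f x = g x"
  shows "smooth W g"
  unfolding smooth_fn_def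
proof
  fix c assume c: "c \<in> \<A>"
  show "smooth_on (chart_image c W) (g \<circ> chart_inv c)"
    by (rule smooth_on_cong[OF _ open_chart_image[OF c assms(2)], where f="f \<circ> chart_inv c"])
      (use assms c chart_imageD(2)[OF c] in \<open>auto simp: smooth_fn_def\<close>)
qed

text \<open>
  Smoothness only has to be checked near each point, for instance separately inside the domain of a
  chart and outside of the support of a function.
\<close>

lemma smooth_fn_local:
  assumes "\<And>x. x \<in> W \<Longrightarrow> \<exists>W'. open W' \<and> x \<in> W' \<and> smooth W' f"
  shows "smooth W f"
  unfolding smooth_fn_def
proof
  fix c assume c: "c \<in> \<A>"
  show "smooth_on (chart_image c W) (f \<circ> chart_inv c)"
  proof (rule smooth_on_local)
    fix z assume z: "z \<in> chart_image c W"
    obtain W' where W': "open W'" "chart_inv c z \<in> W'" "smooth W' f"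
      using assms[OF chart_imageD(2)[OF c z]] by blast
    have "z \<in> chart_image c W'"
      using snd_in_chart_image[OF chart_imageD(1)[OF c z] W'(2)] chart_imageD(3)[OF c z] by simp
    then show "\<exists>V. open V \<and> z \<in> V \<and> smooth_on V (f \<circ> chart_inv c)"
      using W' c open_chart_image[OF c W'(1)] by (auto simp: smooth_fn_def)
  qed
qed

lemma smooth_fn_const: "smooth W (\<lambda>x. k)"
  by (simp add: smooth_fn_def o_def smooth_on_const)

lemma smooth_fn_add:
  assumes "open W" "smooth W f" "smooth W g"
  shows "smooth W (\<lambda>x. f x + g x)"
  using assms unfolding smooth_fn_def o_def by (simp add: smooth_on_add open_chart_image)

lemma smooth_fn_bilinear:
  assumes "bounded_bilinear mul" "open W" "smooth W f" "smooth W g"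
  shows "smooth W (\<lambda>x. mul (f x) (g x))"
  using assms(2-) unfolding smooth_fn_def o_def by (simp add: smooth_on_bilinear[OF assms(1)] open_chart_image)

lemmas smooth_fn_mult = smooth_fn_bilinear[OF bounded_bilinear_mult]
lemmas smooth_fn_matrix_mult = smooth_fn_bilinear[OF bounded_bilinear_matrix_mult]

lemma smooth_fn_bounded_linear:
  assumes "bounded_linear L" "open W" "smooth W f"
  shows "smooth W (\<lambda>x. L (f x))"
  using assms(2-) unfolding smooth_fn_def o_def by (simp add: smooth_on_bounded_linear[OF assms(1)] open_chart_image)

lemma smooth_fn_sum:
  assumes "open W" "\<And>i. i \<in> I \<Longrightarrow> smooth W (f i)"
  shows "smooth W (\<lambda>x. \<Sum>i\<in>I. f i x)"
  using assms(2)
  by (induction I rule: infinite_finite_induct) (auto intro: smooth_fn_const smooth_fn_add[OF assms(1)])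

lemma smooth_fn_prod:
  fixes f :: "'i \<Rightarrow> 'a \<Rightarrow> 'b::{real_normed_algebra, comm_ring_1}"
  assumes "open W" "\<And>i. i \<in> I \<Longrightarrow> smooth W (f i)"
  shows "smooth W (\<lambda>x. \<Prod>i\<in>I. f i x)"
  using assms(2)
  by (induction I rule: infinite_finite_induct) (auto intro: smooth_fn_const smooth_fn_mult[OF assms(1)])

lemma smooth_fn_power:
  fixes f :: "'a \<Rightarrow> complex"
  assumes "open W" "smooth W f"
  shows "smooth W (\<lambda>x. f x ^ k)"
  by (induction k) (auto intro: smooth_fn_const smooth_fn_mult[OF assms(1)] assms(2))

lemma smooth_fn_inverse:
  fixes f :: "'a \<Rightarrow> 'b::real_normed_field"
  assumes "open W" "smooth W f" "\<And>x. x \<in> W \<Longrightarrow> f x \<noteq> 0"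
  shows "smooth W (\<lambda>x. inverse (f x))"
  unfolding smooth_fn_def o_def
proof
  fix c assume c: "c \<in> \<A>"
  show "smooth_on (chart_image c W) (\<lambda>z. inverse (f (chart_inv c z)))"
    using assms c chart_imageD(2)[OF c]
    by (intro smooth_on_inverse open_chart_image) (auto simp: smooth_fn_def o_def)
qed

lemma smooth_fn_compose:
  fixes f :: "'a \<Rightarrow> 'b::euclidean_space"
  assumes "open W" "open V" "smooth W f" "smooth_on V g" "f ` W \<subseteq> V"
  shows "smooth W (\<lambda>x. g (f x))"
  unfolding smooth_fn_def o_def
proof
  fix c assume c: "c \<in> \<A>"
  show "smooth_on (chart_image c W) (\<lambda>z. g (f (chart_inv c z)))"
  proof (rule smooth_on_compose[OF open_chart_image[OF c assms(1)] assms(2) _ assms(4)])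
    show "smooth_on (chart_image c W) (\<lambda>z. f (chart_inv c z))"
      using assms(3) c by (simp add: smooth_fn_def o_def)
    show "(\<lambda>z. f (chart_inv c z)) ` chart_image c W \<subseteq> V"
      using chart_imageD(2)[OF c] assms(5) by auto
  qed
qed

lemma smooth_fn_chart:
  assumes "c \<in> \<A>" "W \<subseteq> fst c"
  shows "smooth W (snd c)"
proof -
  have "smooth (fst c) (snd c)"
    using surface assms(1) unfolding closed_surface_def smooth_fn_def by blast
  then show ?thesis using assms(2) smooth_fn_subset by blast
qed

lemma smooth_fn_imp_smooth_on: "smooth W f \<Longrightarrow> c \<in> \<A> \<Longrightarrow> smooth_on (chart_image c W) (f \<circ> chart_inv c)"
  by (simp add: smooth_fn_def)

lemma smooth_fn_cderiv:
  assumes f: "smooth W f" and W: "open W" and c: "c \<in> \<A>" "W \<subseteq> fst c"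
  shows "smooth W (\<lambda>x. cderiv c f x v)"
  unfolding cderiv_def
  by (rule smooth_fn_compose[OF W open_chart_image[OF c(1) W] smooth_fn_chart[OF c]
        smooth_on_frechet_derivative[OF smooth_fn_imp_smooth_on[OF f c(1)]]])
    (use c in \<open>auto simp: chart_image_def\<close>)

lemma smooth_fn_continuous_on:
  assumes "smooth W f" "open W"
  shows "continuous_on W f"
proof -
  have "isCont f x" if x: "x \<in> W" for x
  proof -
    obtain c where c: "c \<in> \<A>" "x \<in> fst c" using chart_exists by blast
    let ?U = "chart_image c W"
    have "continuous_on ?U (f \<circ> chart_inv c)"
      using smooth_on_continuous_on smooth_fn_imp_smooth_on[OF assms(1) c(1)] by blast
    moreover have "continuous_on (fst c \<inter> W) (snd c)"
      using chart_facts(3)[OF c(1)] by (auto simp: homeomorphism_def intro: continuous_on_subset)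
    ultimately have "continuous_on (fst c \<inter> W) ((f \<circ> chart_inv c) \<circ> snd c)"
      unfolding chart_image_def by (rule continuous_on_compose[rotated])
    then have "continuous_on (fst c \<inter> W) f"
      by (rule continuous_on_eq) (simp add: chart_inv_snd[OF c(1)])
    then show ?thesis
      using x c assms(2) chart_facts(1)[OF c(1)] continuous_on_eq_continuous_at[OF open_Int]
      by (metis IntI)
  qed
  then show ?thesis by (simp add: continuous_at_imp_continuous_on)
qed

subsection \<open>Coordinate changes\<close>

lemma has_cderiv:
  assumes "smooth W f" "open W" "x \<in> W" "c \<in> \<A>" "x \<in> fst c"
  shows "((f \<circ> chart_inv c) has_derivative cderiv c f x) (at (snd c x))"
  using smooth_on_has_derivative[OF smooth_fn_imp_smooth_on[OF assms(1,4)] open_chart_image[OF assms(4,2)],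
      of "snd c x"] assms
  by (simp add: cderiv_def[abs_def] chart_image_def)

lemma cderiv_chain:
  assumes f: "smooth W f" "open W" "x \<in> W"
    and c: "c \<in> \<A>" "x \<in> fst c" and d: "d \<in> \<A>" "x \<in> fst d"
  shows "cderiv c f x v = cderiv d f x (transD c d x v)"
proof -
  have "((snd d \<circ> chart_inv c) has_derivative transD c d x) (at (snd c x))"
    unfolding transD_def[abs_def]
    by (rule has_cderiv[OF smooth_fn_chart[OF d(1) order_refl] chart_facts(1)[OF d(1)] d(2) c])
  moreover have "((f \<circ> chart_inv d) has_derivative cderiv d f x) (at ((snd d \<circ> chart_inv c) (snd c x)))"
    using has_cderiv[OF f d] by (simp add: chart_inv_snd[OF c])
  ultimately have "((f \<circ> chart_inv d) \<circ> (snd d \<circ> chart_inv c) has_derivative cderiv d f x \<circ> transD c d x) (at (snd c x))"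
    by (rule diff_chain_at)
  then have "((f \<circ> chart_inv c) has_derivative cderiv d f x \<circ> transD c d x) (at (snd c x))"
    by (rule has_derivative_transform_within_open[OF _ open_chart_image[OF c(1) chart_facts(1)[OF d(1)]]
          snd_in_chart_image[OF c(2) d(2)]])
      (simp add: chart_inv_snd[OF d(1)] chart_imageD[OF c(1)])
  then show ?thesis
    using frechet_derivative_at by (metis cderiv_def comp_apply)
qed

lemma transD_chain:
  assumes "c \<in> \<A>" "x \<in> fst c" "d \<in> \<A>" "x \<in> fst d" "e \<in> \<A>" "x \<in> fst e"
  shows "transD c e x v = transD d e x (transD c d x v)"
  using cderiv_chain[OF smooth_fn_chart[OF assms(5) order_refl] chart_facts(1)[OF assms(5)] assms(6,1,2,3,4)]
  by (simp add: transD_def)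

lemma linear_transD:
  assumes "c \<in> \<A>" "x \<in> fst c" "d \<in> \<A>" "x \<in> fst d"
  shows "linear (transD c d x)"
  using has_cderiv[OF smooth_fn_chart[OF assms(3) order_refl] chart_facts(1)[OF assms(3)] assms(4,1,2)]
  unfolding transD_def[abs_def] by (rule has_derivative_linear)

lemma transD_refl:
  assumes c: "c \<in> \<A>" "x \<in> fst c"
  shows "transD c c x v = v"
proof -
  have "((snd c \<circ> chart_inv c) has_derivative (\<lambda>v. v)) (at (snd c x))"
    by (rule has_derivative_transform_within_open[OF has_derivative_ident chart_facts(2)[OF c(1)]])
      (use c chart_inv_snd[OF c(1)] in \<open>auto simp: chart_image_def\<close>)
  then show ?thesis
    unfolding transD_def cderiv_def using frechet_derivative_at by metis
qed

lemma transD_wirtinger: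
  assumes "c \<in> \<A>" "x \<in> fst c" "d \<in> \<A>" "x \<in> fst d"
  shows "transD c d x v = trans_z c d x * v + trans_zbar c d x * cnj v"
  using linear_complex_expansion[OF linear_transD[OF assms], of v]
  by (simp add: trans_z_def trans_zbar_def complex_eq_iff algebra_simps add_divide_distrib diff_divide_distrib)

lemma trans_chain:
  assumes "c \<in> \<A>" "x \<in> fst c" "d \<in> \<A>" "x \<in> fst d" "e \<in> \<A>" "x \<in> fst e"
  shows "trans_z c e x = trans_z d e x * trans_z c d x + trans_zbar d e x * cnj (trans_zbar c d x)"
    and "trans_zbar c e x = trans_z d e x * trans_zbar c d x + trans_zbar d e x * cnj (trans_z c d x)"
proof -
  note ch = transD_chain[OF assms] transD_wirtinger[OF assms(3-6)] transD_wirtinger[OF assms(1-4)]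
  show "trans_z c e x = trans_z d e x * trans_z c d x + trans_zbar d e x * cnj (trans_zbar c d x)"
    unfolding trans_z_def[of c e] ch by (simp add: algebra_simps)
  show "trans_zbar c e x = trans_z d e x * trans_zbar c d x + trans_zbar d e x * cnj (trans_z c d x)"
    unfolding trans_zbar_def[of c e] ch by (simp add: algebra_simps)
qed

lemma trans_refl:
  assumes "c \<in> \<A>" "x \<in> fst c"
  shows "trans_z c c x = 1" "trans_zbar c c x = 0"
  by (simp_all add: trans_z_def trans_zbar_def transD_refl[OF assms])

lemma smooth_fn_trans:
  assumes "c \<in> \<A>" "d \<in> \<A>"
  shows "smooth (fst c \<inter> fst d) (trans_z c d)" "smooth (fst c \<inter> fst d) (trans_zbar c d)"
proof -
  let ?W = "fst c \<inter> fst d"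
  have W: "open ?W" using assms chart_facts(1) by blast
  have D: "smooth ?W (\<lambda>x. transD c d x v)" for v
    unfolding transD_def using assms W by (intro smooth_fn_cderiv smooth_fn_chart) auto
  have "smooth ?W (\<lambda>x. (transD c d x 1 + (- \<i>) * transD c d x \<i>) * (1/2))"
    and "smooth ?W (\<lambda>x. (transD c d x 1 + \<i> * transD c d x \<i>) * (1/2))"
    by (intro smooth_fn_mult smooth_fn_add smooth_fn_const D W)+
  then show "smooth ?W (trans_z c d)" "smooth ?W (trans_zbar c d)"
    by (auto simp: trans_z_def[abs_def] trans_zbar_def[abs_def])
qed

text \<open>The determinant of \<open>v \<mapsto> a v + b conj v\<close> is \<open>|a|^2 - |b|^2\<close>.\<close>

definition jac :: "'a chart \<Rightarrow> 'a chart \<Rightarrow> 'a \<Rightarrow> real" where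
  "jac c d x = (cmod (trans_z c d x))\<^sup>2 - (cmod (trans_zbar c d x))\<^sup>2"

lemma jac_eq_det:
  assumes "c \<in> \<A>" "x \<in> fst c" "d \<in> \<A>" "x \<in> fst d"
  shows "jac c d x = Re (transD c d x 1) * Im (transD c d x \<i>) - Im (transD c d x 1) * Re (transD c d x \<i>)"
  unfolding transD_wirtinger[OF assms] jac_def cmod_power2
  by (simp add: algebra_simps power2_eq_square)

text \<open>
  The Wirtinger components \<open>(a, b)\<close> of a coordinate change and those of its inverse satisfy the two
  linear relations below; with \<open>|a| = |b|\<close> these contradict each other.
\<close>

lemma jac_nonzero:
  assumes "c \<in> \<A>" "x \<in> fst c" "d \<in> \<A>" "x \<in> fst d"
  shows "jac c d x \<noteq> 0"
proof
  assume J: "jac c d x = 0"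
  let ?a = "trans_z c d x" and ?b = "trans_zbar c d x"
  have 1: "trans_z d c x * ?a + trans_zbar d c x * cnj ?b = 1"
    using trans_chain(1)[OF assms assms(1,2)] trans_refl[OF assms(1,2)] by simp
  have 2: "trans_z d c x * ?b + trans_zbar d c x * cnj ?a = 0"
    using trans_chain(2)[OF assms assms(1,2)] trans_refl[OF assms(1,2)] by simp
  have "?a * cnj ?a = ?b * cnj ?b"
    using J by (simp add: jac_def complex_norm_square[symmetric] flip: of_real_power)
  then have "cnj ?a * (trans_z d c x * ?a + trans_zbar d c x * cnj ?b)
      = cnj ?b * (trans_z d c x * ?b + trans_zbar d c x * cnj ?a)"
    by (simp add: algebra_simps)
  then have "?a = 0" using 1 2 by simp
  then have "?b = 0" using J by (simp add: jac_def)
  then show False using 1 \<open>?a = 0\<close> by simp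
qed


subsection \<open>Bump functions\<close>

text \<open>
  The bump function of a disc in a chart, extended by zero. The closed disc is compact, hence closed in
  the surface because this is Hausdorff, and so the extension is smooth.
\<close>

lemma bump_function_exists:
  assumes W: "open W" and x: "x \<in> W"
  shows "\<exists>\<beta> :: 'a \<Rightarrow> real. smooth UNIV \<beta> \<and> (\<forall>y. 0 \<le> \<beta> y) \<and> 0 < \<beta> x \<and> closure {y. \<beta> y \<noteq> 0} \<subseteq> W"
proof -
  obtain c where c: "c \<in> \<A>" "x \<in> fst c" using chart_exists by blast
  define a where "a = snd c x"
  have "a \<in> chart_image c W" using c x by (simp add: a_def chart_image_def)
  then obtain e where e: "e > 0" "cball a e \<subseteq> chart_image c W"
    using open_chart_image[OF c(1) W] open_contains_cball by blast
  define \<beta> where "\<beta> y = (if y \<in> fst c then bump a e (snd c y) else 0)" for y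
  define K where "K = chart_inv c ` cball a e"
  have "continuous_on (cball a e) (chart_inv c)"
    using chart_facts(3)[OF c(1)] e(2) chart_image_mono[of W UNIV c]
    by (auto simp: homeomorphism_def intro: continuous_on_subset)
  then have "compact K" unfolding K_def by (intro compact_continuous_image) auto
  then have K: "closed K" by (rule compact_imp_closed)
  have "K \<subseteq> W" unfolding K_def using chart_imageD(2)[OF c(1)] e(2) by blast
  have supp: "y \<in> K" if "\<beta> y \<noteq> 0" for y
  proof -
    have y: "y \<in> fst c" "bump a e (snd c y) \<noteq> 0" using that by (auto simp: \<beta>_def split: if_splits)
    then have "snd c y \<in> ball a e"
      using bump_pos_iff[OF e(1)] bump_nonneg[of a e "snd c y"] by fastforce
    then show ?thesis
      unfolding K_def using chart_inv_snd[OF c(1) y(1)] by (metis ball_subset_cball image_eqI subsetD)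
  qed
  have "closure {y. \<beta> y \<noteq> 0} \<subseteq> K" using K supp by (intro closure_minimal) auto
  then have "closure {y. \<beta> y \<noteq> 0} \<subseteq> W" using \<open>K \<subseteq> W\<close> by blast
  moreover have "smooth UNIV \<beta>"
  proof (rule smooth_fn_local)
    fix y
    show "\<exists>W'. open W' \<and> y \<in> W' \<and> smooth W' \<beta>"
    proof (cases "y \<in> K")
      case True
      then have "y \<in> fst c" unfolding K_def using chart_imageD(1)[OF c(1)] e(2) by blast
      moreover have "smooth (fst c) (\<lambda>y. bump a e (snd c y))"
        by (rule smooth_fn_compose[OF chart_facts(1)[OF c(1)] open_UNIV smooth_fn_chart[OF c(1) order_refl] smooth_on_bump])
          simp
      then have "smooth (fst c) \<beta>"
        by (rule smooth_fn_cong[OF _ chart_facts(1)[OF c(1)]]) (simp add: \<beta>_def)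
      ultimately show ?thesis using chart_facts(1)[OF c(1)] by blast
    next
      case False
      have "open (- K)" using K by auto
      moreover have "smooth (- K) \<beta>"
        by (rule smooth_fn_cong[OF smooth_fn_const[of _ 0] \<open>open (- K)\<close>]) (use supp in force)
      ultimately show ?thesis using False by blast
    qed
  qed
  moreover have "\<beta> x > 0" using c e by (simp add: \<beta>_def a_def bump_pos_iff)
  moreover have "0 \<le> \<beta> y" for y by (simp add: \<beta>_def bump_nonneg)
  ultimately show ?thesis by blast
qed

end


section \<open>The bundle \<open>V\<close> and its transition matrices\<close>

text \<open>The rank of \<open>V\<close> is the size of the type \<open>'n\<close> that indexes its frames, given by \<open>rank_type\<close>.\<close>

locale higher_surface =
  fixes X :: "('a::t2_space, 'j) hcs" and rank_type :: "'n::finite itself"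
  assumes closed: "closed_surface (atlas X)"
    and hcs: "higher_complex_structure CARD('n) X"
    and half: "half_canonical X"
begin

sublocale surface "atlas X"
  by unfold_locales (rule closed)

lemma hideal_hilb0: "c \<in> atlas X \<Longrightarrow> x \<in> fst c \<Longrightarrow> hideal X c x \<in> hilb0 CARD('n)"
  using hcs unfolding higher_complex_structure_def hilb0_section_def by blast

lemma chg_hideal_iff:
  "c \<in> atlas X \<Longrightarrow> d \<in> atlas X \<Longrightarrow> x \<in> fst c \<Longrightarrow> x \<in> fst d \<Longrightarrow>
    chg c d x f \<in> hideal X d x \<longleftrightarrow> f \<in> hideal X c x"
  using hcs unfolding higher_complex_structure_def hilb0_section_def by blast

lemma local_basis:
  assumes "c \<in> atlas X" "x \<in> fst c"
  obtains W b where "open W" "x \<in> W" "W \<subseteq> fst c"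
    "\<And>y. y \<in> W \<Longrightarrow> basis_mod (hideal X c y) {..<CARD('n)} b"
    "\<And>f i. i < CARD('n) \<Longrightarrow> smooth W (\<lambda>y. coords (hideal X c y) {..<CARD('n)} b f i)"
  using hcs assms unfolding higher_complex_structure_def hilb0_section_def by meson

abbreviation vtrivs :: "('a, 'j, 'n) triv set" where
  "vtrivs \<equiv> trivs X"

lemma trivD:
  assumes "s \<in> vtrivs"
  shows "open (tdom s)" "tchart s \<in> atlas X" "tindex s \<in> hc_index X"
    "tdom s \<subseteq> fst (tchart s)" "tdom s \<subseteq> hc_dom X (tindex s)"
    "smooth (tdom s) (\<lambda>x. coeff2 (tframe s k x) i j)"
    "x \<in> tdom s \<Longrightarrow> x \<in> fst (tchart s)"
    "x \<in> tdom s \<Longrightarrow> basis_mod (hideal X (tchart s) x) UNIV (\<lambda>k. tframe s k x)"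
    "x \<in> tdom s \<Longrightarrow> hideal X (tchart s) x \<in> hilb0 CARD('n)"
    "x \<in> tdom s \<Longrightarrow> is_ideal (hideal X (tchart s) x)"
proof -
  show "open (tdom s)" "tchart s \<in> atlas X" "tindex s \<in> hc_index X"
    "tdom s \<subseteq> fst (tchart s)" "tdom s \<subseteq> hc_dom X (tindex s)"
    "smooth (tdom s) (\<lambda>x. coeff2 (tframe s k x) i j)"
    "x \<in> tdom s \<Longrightarrow> basis_mod (hideal X (tchart s) x) UNIV (\<lambda>k. tframe s k x)"
    using assms unfolding trivs_def by blast+
  then show "x \<in> tdom s \<Longrightarrow> x \<in> fst (tchart s)"
    and "x \<in> tdom s \<Longrightarrow> hideal X (tchart s) x \<in> hilb0 CARD('n)"
    and "x \<in> tdom s \<Longrightarrow> is_ideal (hideal X (tchart s) x)"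
    using hideal_hilb0 hilb0D(1) by blast+
qed

lemma chg_simps:
  "chg c d x (f + g) = chg c d x f + chg c d x g" "chg c d x (f - g) = chg c d x f - chg c d x g"
  "chg c d x (f * g) = chg c d x f * chg c d x g" "chg c d x (const2 a) = const2 a" "chg c d x 1 = 1"
  by (simp_all add: chg_def subst2_simps)

lemma chg_chg:
  assumes "c \<in> atlas X" "x \<in> fst c" "d \<in> atlas X" "x \<in> fst d" "e \<in> atlas X" "x \<in> fst e"
  shows "chg d e x (chg c d x f) = chg c e x f"
  unfolding chg_def subst2_subst2
  by (simp add: subst2_simps trans_chain[OF assms] const2_simps algebra_simps)

lemma chg_refl:
  assumes "c \<in> atlas X" "x \<in> fst c"
  shows "chg c c x f = f"
  by (simp add: chg_def trans_refl[OF assms] const2_simps subst2_vars)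


subsection \<open>Coordinate vectors\<close>

definition rep :: "('a, 'j, 'n) triv \<Rightarrow> 'a \<Rightarrow> complex^'n \<Rightarrow> poly2" where
  "rep s x v = (\<Sum>k\<in>UNIV. const2 (v $ k) * tframe s k x)"

definition cvec :: "('a, 'j, 'n) triv \<Rightarrow> 'a \<Rightarrow> poly2 \<Rightarrow> complex^'n" where
  "cvec s x f = (\<chi> i. coords (hideal X (tchart s) x) UNIV (\<lambda>k. tframe s k x) f i)"

lemma cvec_eqI:
  assumes s: "s \<in> vtrivs" "x \<in> tdom s" and f: "f - rep s x v \<in> hideal X (tchart s) x"
  shows "cvec s x f = v"
proof -
  have "coords (hideal X (tchart s) x) UNIV (\<lambda>k. tframe s k x) f = ($) v"
    by (rule coords_eqI[OF trivD(8)[OF s]]) (use f in \<open>simp add: is_coords_def rep_def\<close>)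
  then show ?thesis by (simp add: cvec_def vec_eq_iff)
qed

lemma rep_cvec:
  assumes s: "s \<in> vtrivs" "x \<in> tdom s"
  shows "f - rep s x (cvec s x f) \<in> hideal X (tchart s) x"
  using coords_is_coords[OF trivD(8)[OF s], of f] by (simp add: is_coords_def rep_def cvec_def)

lemma cvec_rep:
  assumes s: "s \<in> vtrivs" "x \<in> tdom s"
  shows "cvec s x (rep s x v) = v"
  by (rule cvec_eqI[OF s]) (simp add: ideal_simps[OF trivD(10)[OF s]])

lemma cvec_cong:
  assumes s: "s \<in> vtrivs" "x \<in> tdom s" and "f - g \<in> hideal X (tchart s) x"
  shows "cvec s x f = cvec s x g"
  using coords_cong[OF trivD(10)[OF s] trivD(8)[OF s] assms(3)] by (simp add: cvec_def)

lemma cvec_simps: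
  assumes s: "s \<in> vtrivs" "x \<in> tdom s"
  shows "cvec s x (f + g) = cvec s x f + cvec s x g" "cvec s x (const2 a * f) = a *s cvec s x f"
    "cvec s x (\<Sum>i\<in>I. h i) = (\<Sum>i\<in>I. cvec s x (h i))"
  by (simp_all add: cvec_def vec_eq_iff coords_add[OF trivD(10)[OF s] trivD(8)[OF s]]
      coords_scale[OF trivD(10)[OF s] trivD(8)[OF s]] coords_sum[OF trivD(10)[OF s] trivD(8)[OF s]])

lemma cvec_eq_0_iff:
  assumes s: "s \<in> vtrivs" "x \<in> tdom s"
  shows "cvec s x f = 0 \<longleftrightarrow> f \<in> hideal X (tchart s) x"
  using coords_eq_0_iff[OF trivD(10)[OF s] trivD(8)[OF s], of f] by (auto simp: cvec_def vec_eq_iff)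

text \<open>The transition function of \<open>K^((n-1)/2)\<close>.\<close>

definition hctr :: "('a, 'j, 'n) triv \<Rightarrow> ('a, 'j, 'n) triv \<Rightarrow> 'a \<Rightarrow> complex" where
  "hctr s s' x = hc_trans X (tindex s) (tindex s') x ^ (CARD('n) - 1)"

lemma transT_vector:
  assumes s: "s \<in> vtrivs" "x \<in> tdom s" and s': "s' \<in> vtrivs" "x \<in> tdom s'"
  shows "transT X s s' x *v v = cvec s' x (const2 (hctr s s' x) * chg (tchart s) (tchart s') x (rep s x v))"
proof -
  have mor: "ring_morphism (chg (tchart s) (tchart s') x)"
    using ring_morphism_subst2 unfolding chg_def[abs_def] by simp
  have "const2 (hctr s s' x) * chg (tchart s) (tchart s') x (rep s x v)
     = (\<Sum>k\<in>UNIV. const2 (v $ k) * (const2 (hctr s s' x) * chg (tchart s) (tchart s') x (tframe s k x)))"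
    unfolding rep_def ring_morphism_sum[OF mor]
    by (simp add: chg_simps sum_distrib_left mult.left_commute)
  then have "cvec s' x (const2 (hctr s s' x) * chg (tchart s) (tchart s') x (rep s x v))
     = (\<Sum>k\<in>UNIV. v $ k *s cvec s' x (const2 (hctr s s' x) * chg (tchart s) (tchart s') x (tframe s k x)))"
    by (simp only: cvec_simps[OF s'])
  then show ?thesis
    by (simp add: vec_eq_iff matrix_vector_mult_def transT_def cvec_def hctr_def mult.commute)
qed

lemma half_canonicalD:
  assumes j: "j \<in> hc_index X" and k: "k \<in> hc_index X"
  shows "x \<in> hc_dom X j \<Longrightarrow> x \<in> hc_dom X k \<Longrightarrow> hc_trans X j k x \<noteq> 0"
    and "smooth (hc_dom X j \<inter> hc_dom X k) (hc_trans X j k)"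
    and "l \<in> hc_index X \<Longrightarrow> x \<in> hc_dom X j \<Longrightarrow> x \<in> hc_dom X k \<Longrightarrow> x \<in> hc_dom X l \<Longrightarrow>
      hc_trans X j k x * hc_trans X k l x = hc_trans X j l x"
proof -
  have "\<forall>j\<in>hc_index X. \<forall>k\<in>hc_index X. \<forall>l\<in>hc_index X.
        \<forall>x\<in>hc_dom X j \<inter> hc_dom X k \<inter> hc_dom X l. hc_trans X j k x * hc_trans X k l x = hc_trans X j l x"
    and 1: "\<forall>j\<in>hc_index X. \<forall>k\<in>hc_index X. smooth (hc_dom X j \<inter> hc_dom X k) (hc_trans X j k) \<and>
        (\<forall>x\<in>hc_dom X j \<inter> hc_dom X k. hc_trans X j k x \<noteq> 0)"
    using half unfolding half_canonical_def by auto
  then show "l \<in> hc_index X \<Longrightarrow> x \<in> hc_dom X j \<Longrightarrow> x \<in> hc_dom X k \<Longrightarrow> x \<in> hc_dom X l \<Longrightarrow>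
      hc_trans X j k x * hc_trans X k l x = hc_trans X j l x"
    using j k by blast
  show "x \<in> hc_dom X j \<Longrightarrow> x \<in> hc_dom X k \<Longrightarrow> hc_trans X j k x \<noteq> 0"
    and "smooth (hc_dom X j \<inter> hc_dom X k) (hc_trans X j k)"
    using 1 j k by blast+
qed

lemma hctr_chain:
  assumes "s \<in> vtrivs" "x \<in> tdom s" "s' \<in> vtrivs" "x \<in> tdom s'" "s'' \<in> vtrivs" "x \<in> tdom s''"
  shows "hctr s s' x * hctr s' s'' x = hctr s s'' x"
proof -
  have "hc_trans X (tindex s) (tindex s') x * hc_trans X (tindex s') (tindex s'') x
      = hc_trans X (tindex s) (tindex s'') x"
    using assms(2,4,6) trivD(5)[OF assms(1)] trivD(5)[OF assms(3)] trivD(5)[OF assms(5)]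
    by (intro half_canonicalD(3) trivD(3) assms) auto
  then show ?thesis by (simp add: hctr_def power_mult_distrib[symmetric])
qed

lemma hctr_refl:
  assumes "s \<in> vtrivs" "x \<in> tdom s"
  shows "hctr s s x = 1"
proof -
  have "hc_trans X (tindex s) (tindex s) x \<noteq> 0"
    using assms(2) trivD(5)[OF assms(1)] by (intro half_canonicalD(1) trivD(3) assms) auto
  then have "hctr s s x \<noteq> 0" by (simp add: hctr_def)
  then show ?thesis using hctr_chain[OF assms assms assms] by simp
qed

text \<open>
  A coordinate change maps the ideal of one chart to that of the other, so passing through an
  intermediate trivialisation may be computed with any representative of a class.
\<close>

lemma transT_chain:
  assumes s: "s \<in> vtrivs" "x \<in> tdom s" and s': "s' \<in> vtrivs" "x \<in> tdom s'"
    and s'': "s'' \<in> vtrivs" "x \<in> tdom s''"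
  shows "transT X s' s'' x ** transT X s s' x = transT X s s'' x"
proof -
  note c = trivD(2)[OF s(1)] trivD(7)[OF s] note c' = trivD(2)[OF s'(1)] trivD(7)[OF s']
  note c'' = trivD(2)[OF s''(1)] trivD(7)[OF s'']
  have "transT X s' s'' x *v (transT X s s' x *v v) = transT X s s'' x *v v" for v
  proof -
    let ?f = "const2 (hctr s s' x) * chg (tchart s) (tchart s') x (rep s x v)"
    have "?f - rep s' x (cvec s' x ?f) \<in> hideal X (tchart s') x" by (rule rep_cvec[OF s'])
    then have "chg (tchart s') (tchart s'') x (?f - rep s' x (cvec s' x ?f)) \<in> hideal X (tchart s'') x"
      using chg_hideal_iff[OF c'(1) c''(1) c'(2) c''(2)] by blast
    then have "const2 (hctr s' s'' x) * chg (tchart s') (tchart s'') x (?f - rep s' x (cvec s' x ?f))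
        \<in> hideal X (tchart s'') x"
      by (rule ideal_simps[OF trivD(10)[OF s'']])
    then have "cvec s'' x (const2 (hctr s' s'' x) * chg (tchart s') (tchart s'') x ?f)
        = cvec s'' x (const2 (hctr s' s'' x) * chg (tchart s') (tchart s'') x (rep s' x (cvec s' x ?f)))"
      by (intro cvec_cong[OF s'']) (simp add: chg_simps right_diff_distrib)
    moreover have "const2 (hctr s' s'' x) * chg (tchart s') (tchart s'') x ?f
        = const2 (hctr s s'' x) * chg (tchart s) (tchart s'') x (rep s x v)"
      unfolding hctr_chain[OF s s' s'', symmetric]
      by (simp add: chg_simps chg_chg[OF c c' c''] const2_simps mult_ac)
    ultimately show ?thesis
      by (simp add: transT_vector[OF s s'] transT_vector[OF s' s''] transT_vector[OF s s''])
  qed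
  then show ?thesis by (simp add: matrix_eq matrix_vector_mul_assoc)
qed

lemma transT_refl:
  assumes s: "s \<in> vtrivs" "x \<in> tdom s"
  shows "transT X s s x = mat 1"
proof -
  have "transT X s s x *v v = v" for v
    by (simp add: transT_vector[OF s s] hctr_refl[OF s] chg_refl[OF trivD(2)[OF s(1)] trivD(7)[OF s]]
        const2_simps cvec_rep[OF s])
  then show ?thesis by (simp add: matrix_eq)
qed

lemma transT_inverse:
  assumes "s \<in> vtrivs" "x \<in> tdom s" "s' \<in> vtrivs" "x \<in> tdom s'"
  shows "transT X s' s x ** transT X s s' x = mat 1"
  using transT_chain[OF assms assms(1,2)] transT_refl[OF assms(1,2)] by simp


subsection \<open>The line \<open>L\<close>\<close>

text \<open>The coordinates of the class of the constant \<open>1\<close>, which spans \<open>L\<close>.\<close>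

definition unit_vec :: "('a, 'j, 'n) triv \<Rightarrow> 'a \<Rightarrow> complex^'n" where
  "unit_vec s x = cvec s x 1"

lemma line_L_eq:
  assumes s: "s \<in> vtrivs" "x \<in> tdom s"
  shows "line_L X s x = {a *s unit_vec s x | a. True}"
proof -
  have "rep s x v - const2 a \<in> hideal X (tchart s) x \<longleftrightarrow> v = a *s unit_vec s x" for v a
  proof
    assume "rep s x v - const2 a \<in> hideal X (tchart s) x"
    then have "cvec s x (rep s x v) = cvec s x (const2 a * 1)"
      by (intro cvec_cong[OF s]) simp
    then show "v = a *s unit_vec s x"
      by (simp only: cvec_rep[OF s] cvec_simps[OF s] unit_vec_def)
  next
    assume "v = a *s unit_vec s x"
    then have "v = cvec s x (const2 a)"
      using cvec_simps(2)[OF s, of a 1] by (simp add: unit_vec_def)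
    then show "rep s x v - const2 a \<in> hideal X (tchart s) x"
      using ideal_simps(5)[OF trivD(10)[OF s] rep_cvec[OF s, of "const2 a"]] by simp
  qed
  then show ?thesis by (auto simp: line_L_def rep_def)
qed

text \<open>
  The ideal has a zero, so it does not contain \<open>1\<close>.
\<close>

lemma unit_vec_nonzero:
  assumes s: "s \<in> vtrivs" "x \<in> tdom s"
  shows "unit_vec s x \<noteq> 0"
proof
  assume "unit_vec s x = 0"
  then have "1 \<in> hideal X (tchart s) x" by (simp add: unit_vec_def cvec_eq_0_iff[OF s])
  then show False
    using hilb0D(3)[OF trivD(9)[OF s], of 1] coeff2_const2[of 1 0 0] by (simp add: const2_simps)
qed

text \<open>
  Coordinate changes fix constants, so the line \<open>L\<close> does not depend on the trivialisation.
\<close>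

lemma transT_unit_vec:
  assumes s: "s \<in> vtrivs" "x \<in> tdom s" and s': "s' \<in> vtrivs" "x \<in> tdom s'"
  shows "transT X s s' x *v unit_vec s x = hctr s s' x *s unit_vec s' x"
proof -
  note c = trivD(2)[OF s(1)] trivD(7)[OF s] note c' = trivD(2)[OF s'(1)] trivD(7)[OF s']
  have "chg (tchart s) (tchart s') x (1 - rep s x (cvec s x 1)) \<in> hideal X (tchart s') x"
    using chg_hideal_iff[OF c(1) c'(1) c(2) c'(2)] rep_cvec[OF s] by blast
  then have "const2 (hctr s s' x) * chg (tchart s) (tchart s') x (1 - rep s x (cvec s x 1)) \<in> hideal X (tchart s') x"
    by (rule ideal_simps[OF trivD(10)[OF s']])
  then have "cvec s' x (const2 (hctr s s' x) * 1)
      = cvec s' x (const2 (hctr s s' x) * chg (tchart s) (tchart s') x (rep s x (cvec s x 1)))"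
    by (intro cvec_cong[OF s']) (simp add: chg_simps right_diff_distrib)
  then show ?thesis
    by (simp only: transT_vector[OF s s'] unit_vec_def cvec_simps[OF s'])
qed


subsection \<open>Smoothness of coordinates\<close>

definition smooth_poly :: "'a set \<Rightarrow> ('a \<Rightarrow> poly2) \<Rightarrow> bool" where
  "smooth_poly W f \<longleftrightarrow> (\<forall>i j. smooth W (\<lambda>x. coeff2 (f x) i j))"

lemma smooth_poly_const: "smooth_poly W (\<lambda>x. f)"
  by (simp add: smooth_poly_def smooth_fn_const)

lemma smooth_poly_const2:
  assumes "smooth W f"
  shows "smooth_poly W (\<lambda>x. const2 (f x))"
  unfolding smooth_poly_def
proof (intro allI)
  show "smooth W (\<lambda>x. coeff2 (const2 (f x)) i j)" for i j
    using assms by (cases "i = 0 \<and> j = 0") (auto simp: coeff2_const2 smooth_fn_const)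
qed

lemma smooth_poly_add:
  "open W \<Longrightarrow> smooth_poly W f \<Longrightarrow> smooth_poly W g \<Longrightarrow> smooth_poly W (\<lambda>x. f x + g x)"
  by (simp add: smooth_poly_def smooth_fn_add)

lemma smooth_poly_mult:
  "open W \<Longrightarrow> smooth_poly W f \<Longrightarrow> smooth_poly W g \<Longrightarrow> smooth_poly W (\<lambda>x. f x * g x)"
  by (simp add: smooth_poly_def coeff2_mult smooth_fn_sum smooth_fn_mult)

lemma smooth_poly_power: "open W \<Longrightarrow> smooth_poly W f \<Longrightarrow> smooth_poly W (\<lambda>x. f x ^ k)"
  by (induction k) (simp_all add: smooth_poly_const smooth_poly_mult)

lemma smooth_poly_sum:
  "open W \<Longrightarrow> (\<And>i. i \<in> I \<Longrightarrow> smooth_poly W (f i)) \<Longrightarrow> smooth_poly W (\<lambda>x. \<Sum>i\<in>I. f i x)"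
  by (simp add: smooth_poly_def coeff2_sum smooth_fn_sum)

lemma smooth_poly_subset: "smooth_poly W f \<Longrightarrow> W' \<subseteq> W \<Longrightarrow> smooth_poly W' f"
  unfolding smooth_poly_def using smooth_fn_subset by blast

text \<open>
  In a constant local basis the coordinates of fixed polynomials are smooth. A varying polynomial
  may be truncated, which makes its class a finite combination of classes of monomials with smooth
  coefficients.
\<close>

lemma smooth_local_coords:
  assumes s: "s \<in> vtrivs" and W: "open W" "W \<subseteq> tdom s"
    and b: "\<And>y. y \<in> W \<Longrightarrow> basis_mod (hideal X (tchart s) y) {..<CARD('n)} b"
    and smooth_b: "\<And>f i. i < CARD('n) \<Longrightarrow>
      smooth W (\<lambda>y. coords (hideal X (tchart s) y) {..<CARD('n)} b f i)"
    and f: "smooth_poly W f" and i: "i < CARD('n)"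
  shows "smooth W (\<lambda>y. coords (hideal X (tchart s) y) {..<CARD('n)} b (f y) i)"
proof (rule smooth_fn_cong)
  let ?g = "\<lambda>y. \<Sum>l<CARD('n). \<Sum>k<CARD('n). coeff2 (f y) k l *
      coords (hideal X (tchart s) y) {..<CARD('n)} b (var_p ^ k * var_pbar ^ l) i"
  show "smooth W ?g"
    using f by (intro smooth_fn_sum smooth_fn_mult smooth_b W i) (simp add: smooth_poly_def)
  show "?g y = coords (hideal X (tchart s) y) {..<CARD('n)} b (f y) i" if y: "y \<in> W" for y
  proof -
    have ys: "y \<in> tdom s" using W(2) y by blast
    note J = trivD(10)[OF s ys]
    have "coords (hideal X (tchart s) y) {..<CARD('n)} b (f y)
        = coords (hideal X (tchart s) y) {..<CARD('n)} b (truncate2 CARD('n) (f y))"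
      by (rule coords_cong[OF J b[OF y] truncate2_mod_hilb0[OF trivD(9)[OF s ys] trivD(8)[OF s ys]]])
    then show ?thesis
      by (simp add: truncate2_def coords_sum[OF J b[OF y]] coords_scale[OF J b[OF y]] mult.assoc)
  qed
qed (rule W(1))

lemma smooth_fn_det:
  fixes P :: "'a \<Rightarrow> complex^'n^'n"
  assumes "open W" "\<And>i j. smooth W (\<lambda>x. P x $ i $ j)"
  shows "smooth W (\<lambda>x. det (P x))"
  unfolding det_def
  by (intro smooth_fn_sum smooth_fn_mult smooth_fn_prod smooth_fn_const assms)

text \<open>
  The coordinates in the frame of a trivialisation solve a linear system whose matrix is the frame
  expressed in the local basis; Cramer's rule shows that they are smooth.
\<close>

lemma smooth_cvec:
  assumes s: "s \<in> vtrivs" and W: "open W" "W \<subseteq> tdom s" and f: "smooth_poly W f"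
  shows "smooth W (\<lambda>x. cvec s x (f x) $ k)"
proof (rule smooth_fn_local)
  fix x assume x: "x \<in> W"
  obtain W0 b where W0: "open W0" "x \<in> W0"
    "\<And>y. y \<in> W0 \<Longrightarrow> basis_mod (hideal X (tchart s) y) {..<CARD('n)} b"
    "\<And>f i. i < CARD('n) \<Longrightarrow> smooth W0 (\<lambda>y. coords (hideal X (tchart s) y) {..<CARD('n)} b f i)"
    using local_basis[OF trivD(2)[OF s], of x] trivD(7)[OF s] W(2) x by (metis subsetD)
  define U where "U = W \<inter> W0"
  have U: "open U" "U \<subseteq> tdom s" "U \<subseteq> W0" "U \<subseteq> W" "x \<in> U" using W W0 x by (auto simp: U_def)
  \<comment> \<open>Local bases are indexed by numbers, frames by the type \<open>'n\<close>.\<close>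
  obtain idx :: "'n \<Rightarrow> nat" where idx: "bij_betw idx UNIV {..<CARD('n)}"
    using ex_bij_betw_finite_nat[of "UNIV :: 'n set"] by (auto simp: atLeast0LessThan)
  have idx_less: "idx i < CARD('n)" for i using idx by (auto simp: bij_betw_def)
  define co where "co f y i = coords (hideal X (tchart s) y) {..<CARD('n)} b f (idx i)" for f y i
  have smooth_co: "smooth U (\<lambda>y. co (g y) y i)" if "smooth_poly U g" for g i
    unfolding co_def
    by (rule smooth_local_coords[OF s U(1,2) _ _ that idx_less])
      (use W0 U smooth_fn_subset in \<open>blast+\<close>)
  define P where "P y = (\<chi> i k. co (tframe s k y) y i)" for y
  define R where "R y = (\<chi> i. co (f y) y i)" for y
  have P_mult: "P y *v v = (\<chi> i. co (rep s y v) y i)" if y: "y \<in> U" for y v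
  proof -
    have "y \<in> W0" "y \<in> tdom s" using U y by auto
    note J = trivD(10)[OF s \<open>y \<in> tdom s\<close>] note B = W0(3)[OF \<open>y \<in> W0\<close>]
    show ?thesis
      by (simp add: P_def co_def rep_def matrix_vector_mult_def coords_sum[OF J B] coords_scale[OF J B]
          mult.commute)
  qed
  have detP: "det (P y) \<noteq> 0" if y: "y \<in> U" for y
  proof -
    have yy: "y \<in> W0" "y \<in> tdom s" using U y by auto
    note J = trivD(10)[OF s yy(2)] note B = W0(3)[OF yy(1)]
    have "v = 0" if "P y *v v = 0" for v
    proof -
      have z: "co (rep s y v) y i = 0" for i
        using that unfolding P_mult[OF y] by (simp add: vec_eq_iff)
      have "coords (hideal X (tchart s) y) {..<CARD('n)} b (rep s y v) m = 0" for m
      proof (cases "m < CARD('n)")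
        case True
        then obtain i where "m = idx i" using idx by (metis bij_betw_def imageE lessThan_iff)
        then show ?thesis using z by (simp add: co_def)
      next
        case False
        then show ?thesis using coords_is_coords[OF B, of "rep s y v"] by (simp add: is_coords_def)
      qed
      then have "rep s y v \<in> hideal X (tchart s) y"
        using coords_eq_0_iff[OF J B, of "rep s y v"] by blast
      then show "v = 0" using cvec_eq_0_iff[OF s yy(2)] cvec_rep[OF s yy(2)] by metis
    qed
    then show ?thesis
      using matrix_left_invertible_ker invertible_left_inverse invertible_det_nz by metis
  qed
  have solve: "cvec s y (f y) $ k = det (\<chi> i j. if j = k then R y $ i else P y $ i $ j) * inverse (det (P y))"
    if y: "y \<in> U" for y
  proof -
    have yy: "y \<in> W0" "y \<in> tdom s" using U y by auto
    note J = trivD(10)[OF s yy(2)] note B = W0(3)[OF yy(1)]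
    have "co (rep s y (cvec s y (f y))) y i = co (f y) y i" for i
      using coords_cong[OF J B rep_cvec[OF s yy(2)]] by (simp add: co_def)
    then have "P y *v cvec s y (f y) = R y" by (simp add: P_mult[OF y] R_def)
    then show ?thesis
      using cramer[OF detP[OF y]] by (simp add: vec_eq_iff divide_inverse)
  qed
  have "smooth U (\<lambda>y. det (\<chi> i j. if j = k then R y $ i else P y $ i $ j) * inverse (det (P y)))"
  proof (intro smooth_fn_mult smooth_fn_det smooth_fn_inverse U(1))
    have sP: "smooth U (\<lambda>y. P y $ i $ j)" for i j
    proof -
      have "smooth_poly U (\<lambda>y. tframe s j y)"
        unfolding smooth_poly_def by (intro allI smooth_fn_subset[OF trivD(6)[OF s] U(2)])
      then show ?thesis by (simp add: P_def smooth_co)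
    qed
    moreover have sR: "smooth U (\<lambda>y. R y $ i)" for i
      using smooth_co[OF smooth_poly_subset[OF f U(4)]] by (simp add: R_def)
    ultimately show "smooth U (\<lambda>y. (\<chi> i j. if j = k then R y $ i else P y $ i $ j) $ i $ j)" for i j
      by (cases "j = k") simp_all
    show "smooth U (\<lambda>y. P y $ i $ j)" for i j by (rule sP)
  qed (rule detP)
  then have "smooth U (\<lambda>y. cvec s y (f y) $ k)"
    by (rule smooth_fn_cong[OF _ U(1)]) (simp add: solve)
  then show "\<exists>W'. open W' \<and> x \<in> W' \<and> smooth W' (\<lambda>x. cvec s x (f x) $ k)"
    using U by blast
qed

lemma smooth_fn_matrixI:
  fixes M :: "'a \<Rightarrow> complex^'n^'n"
  assumes W: "open W" and M: "\<And>i j. smooth W (\<lambda>x. M x $ i $ j)"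
  shows "smooth W M"
proof -
  have E: "bounded_linear (\<lambda>a::complex. (\<chi> i' j'. if i' = i \<and> j' = j then a else 0) :: complex^'n^'n)" for i j
    unfolding linear_conv_bounded_linear[symmetric] by (rule linearI) (auto simp: vec_eq_iff)
  have "smooth W (\<lambda>x. \<Sum>i\<in>UNIV. \<Sum>j\<in>UNIV. (\<chi> i' j'. if i' = i \<and> j' = j then M x $ i $ j else 0))"
    by (intro smooth_fn_sum W smooth_fn_bounded_linear[OF E] M)
  moreover have "(\<Sum>i\<in>UNIV. \<Sum>j\<in>UNIV. (\<chi> i' j'. if i' = i \<and> j' = j then A $ i $ j else 0)) = A"
    for A :: "complex^'n^'n"
  proof -
    have "(\<Sum>i\<in>UNIV. \<Sum>j\<in>UNIV. if i' = i \<and> j' = j then A $ i $ j else 0) = A $ i' $ j'" for i' j'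
    proof -
      have "(\<Sum>i\<in>UNIV. \<Sum>j\<in>UNIV. if i' = i \<and> j' = j then A $ i $ j else 0)
          = (\<Sum>i\<in>UNIV. if i' = i then (\<Sum>j\<in>UNIV. if j' = j then A $ i $ j else 0) else 0)"
        by (intro sum.cong) auto
      then show ?thesis by simp
    qed
    then show ?thesis by (simp add: vec_eq_iff)
  qed
  ultimately show ?thesis by simp
qed

text \<open>
  The frame polynomials may have unbounded degree near a point. Truncating them before the coordinate
  change leaves a fixed finite expression in smooth functions.
\<close>

lemma smooth_transT:
  assumes s: "s \<in> vtrivs" and s': "s' \<in> vtrivs"
  shows "smooth (tdom s \<inter> tdom s') (transT X s s')"
proof (rule smooth_fn_matrixI)
  let ?W = "tdom s \<inter> tdom s'" and ?n = "CARD('n)"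
  let ?c = "tchart s" and ?d = "tchart s'"
  show W: "open ?W" using trivD(1) s s' by blast
  fix i j
  let ?P = "\<lambda>x. const2 (trans_z ?c ?d x) * var_p + const2 (cnj (trans_zbar ?c ?d x)) * var_pbar"
  let ?Q = "\<lambda>x. const2 (trans_zbar ?c ?d x) * var_p + const2 (cnj (trans_z ?c ?d x)) * var_pbar"
  define g where "g x = const2 (hctr s s' x) * (\<Sum>l<?n. \<Sum>k<?n. const2 (coeff2 (tframe s j x) k l) * ?P x ^ k * ?Q x ^ l)" for x
  have tr: "smooth ?W (trans_z ?c ?d)" "smooth ?W (trans_zbar ?c ?d)"
    using smooth_fn_trans[OF trivD(2)[OF s] trivD(2)[OF s']] trivD(4)[OF s] trivD(4)[OF s']
    by (meson Int_mono smooth_fn_subset)+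
  have hc: "smooth ?W (hc_trans X (tindex s) (tindex s'))"
  proof -
    have "smooth (hc_dom X (tindex s) \<inter> hc_dom X (tindex s')) (hc_trans X (tindex s) (tindex s'))"
      by (rule half_canonicalD(2)[OF trivD(3)[OF s] trivD(3)[OF s']])
    then show ?thesis
      using trivD(5)[OF s] trivD(5)[OF s'] by (meson Int_mono smooth_fn_subset)
  qed
  have fr: "smooth ?W (\<lambda>x. coeff2 (tframe s j x) k l)" for k l
    using trivD(6)[OF s] smooth_fn_subset by (metis inf_le1)
  have "smooth_poly ?W g"
    unfolding g_def hctr_def
    by (intro smooth_poly_mult smooth_poly_sum smooth_poly_power smooth_poly_add smooth_poly_const2
        smooth_poly_const smooth_fn_power smooth_fn_bounded_linear[OF bounded_linear_cnj] W tr hc fr)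
  then have "smooth ?W (\<lambda>x. cvec s' x (g x) $ i)"
    by (rule smooth_cvec[OF s' W, OF Int_lower2])
  then show "smooth ?W (\<lambda>x. transT X s s' x $ i $ j)"
  proof (rule smooth_fn_cong[OF _ W])
    fix x assume x: "x \<in> ?W"
    then have xs: "x \<in> tdom s" "x \<in> tdom s'" by auto
    note J' = trivD(10)[OF s' xs(2)]
    have "tframe s j x - truncate2 ?n (tframe s j x) \<in> hideal X ?c x"
      by (rule truncate2_mod_hilb0[OF trivD(9)[OF s xs(1)] trivD(8)[OF s xs(1)]])
    then have "chg ?c ?d x (tframe s j x - truncate2 ?n (tframe s j x)) \<in> hideal X ?d x"
      using chg_hideal_iff[OF trivD(2)[OF s] trivD(2)[OF s'] trivD(7)[OF s xs(1)] trivD(7)[OF s' xs(2)]]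
      by blast
    then have "const2 (hctr s s' x) * chg ?c ?d x (tframe s j x - truncate2 ?n (tframe s j x)) \<in> hideal X ?d x"
      by (rule ideal_simps[OF J'])
    moreover have "const2 (hctr s s' x) * chg ?c ?d x (truncate2 ?n (tframe s j x)) = g x"
      by (simp add: g_def truncate2_def chg_def ring_morphism_sum[OF ring_morphism_subst2] subst2_simps)
    ultimately have "cvec s' x (const2 (hctr s s' x) * chg ?c ?d x (tframe s j x)) = cvec s' x (g x)"
      by (intro cvec_cong[OF s' xs(2)]) (simp add: chg_simps right_diff_distrib)
    then show "cvec s' x (g x) $ i = transT X s s' x $ i $ j"
      by (simp add: transT_def cvec_def hctr_def)
  qed
qed

lemma smooth_unit_vec:
  assumes s: "s \<in> vtrivs"
  shows "smooth (tdom s) (\<lambda>x. unit_vec s x $ i)"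
  unfolding unit_vec_def
  by (rule smooth_cvec[OF s trivD(1)[OF s] order_refl smooth_poly_const])


subsection \<open>Trivialisations and partitions of unity\<close>

text \<open>
  A local basis consisting of constant polynomials is a smooth frame.
\<close>

lemma triv_exists: "\<exists>s\<in>vtrivs. x \<in> tdom s"
proof -
  obtain c where c: "c \<in> atlas X" "x \<in> fst c" using chart_exists by blast
  obtain j where j: "j \<in> hc_index X" "x \<in> hc_dom X j" "open (hc_dom X j)"
    using half unfolding half_canonical_def by (metis UNIV_I UN_E)
  obtain W b where W: "open W" "x \<in> W" "W \<subseteq> fst c"
    "\<And>y. y \<in> W \<Longrightarrow> basis_mod (hideal X c y) {..<CARD('n)} b"
    using local_basis[OF c] by metis
  obtain idx :: "'n \<Rightarrow> nat" where idx: "bij_betw idx UNIV {..<CARD('n)}"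
    using ex_bij_betw_finite_nat[of "UNIV :: 'n set"] by (auto simp: atLeast0LessThan)
  have basis: "basis_mod J UNIV (\<lambda>k. b (idx k))" if B: "basis_mod J {..<CARD('n)} b" for J
    unfolding basis_mod_def
  proof (intro conjI allI)
    fix f
    show "\<exists>!a. is_coords J UNIV (\<lambda>k. b (idx k)) f a"
    proof (rule ex1I)
      have re: "(\<Sum>k\<in>UNIV. const2 (a (idx k)) * b (idx k)) = (\<Sum>m<CARD('n). const2 (a m) * b m)" for a
        by (rule sum.reindex_bij_betw[OF idx])
      show "is_coords J UNIV (\<lambda>k. b (idx k)) f (\<lambda>k. coords J {..<CARD('n)} b f (idx k))"
        using coords_is_coords[OF B, of f] by (simp add: is_coords_def re)
      fix a assume a: "is_coords J UNIV (\<lambda>k. b (idx k)) f a"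
      define a' where "a' m = (if m < CARD('n) then a (inv_into UNIV idx m) else 0)" for m
      have a': "a' (idx k) = a k" for k
        using idx by (auto simp: a'_def bij_betw_def)
      have "is_coords J {..<CARD('n)} b f a'"
        using a re[of a'] by (simp add: is_coords_def a') (simp add: a'_def)
      then have "coords J {..<CARD('n)} b f = a'" by (rule coords_eqI[OF B])
      then show "a = (\<lambda>k. coords J {..<CARD('n)} b f (idx k))" by (simp add: a')
    qed
  qed simp
  define s :: "('a, 'j, 'n) triv" where
    "s = \<lparr>tdom = W \<inter> hc_dom X j, tchart = c, tindex = j, tframe = (\<lambda>k x. b (idx k))\<rparr>"
  have "s \<in> vtrivs"
    unfolding trivs_def s_def using W j c basis by (auto simp: smooth_fn_const)
  moreover have "x \<in> tdom s" using W j by (simp add: s_def)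
  ultimately show ?thesis by blast
qed

text \<open>
  The surface integral is computed with a partition of unity selected by a choice operator; existence
  guarantees that the selected object has the required properties.
\<close>

lemma partition_of_unity_exists:
  "\<exists>P :: nat \<times> (nat \<Rightarrow> ('a, 'j, 'n) triv) \<times> (nat \<Rightarrow> 'a \<Rightarrow> real). partition_of_unity X P"
proof -
  have "\<exists>s \<beta>. s \<in> vtrivs \<and> smooth UNIV (\<beta> :: 'a \<Rightarrow> real) \<and> (\<forall>y. 0 \<le> \<beta> y) \<and> 0 < \<beta> x
      \<and> closure {y. \<beta> y \<noteq> 0} \<subseteq> tdom s" for x
    using triv_exists[of x] bump_function_exists trivD(1) by meson
  then obtain s \<beta> where s: "\<And>x. s x \<in> vtrivs"
    and \<beta>: "\<And>x. smooth UNIV (\<beta> x :: 'a \<Rightarrow> real)" "\<And>x y. 0 \<le> \<beta> x y" "\<And>x. 0 < \<beta> x x"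
      "\<And>x. closure {y. \<beta> x y \<noteq> 0} \<subseteq> tdom (s x)"
    by metis
  have "open {y. 0 < \<beta> x y}" for x
    using open_Collect_less[OF continuous_on_const smooth_fn_continuous_on[OF \<beta>(1) open_UNIV]] .
  then obtain F where F: "finite F" "(\<Union>x\<in>F. {y. 0 < \<beta> x y}) = UNIV"
    using compactE_image[OF compact_surface, of UNIV "\<lambda>x. {y. 0 < \<beta> x y}"] \<beta>(3)
    by (metis (no_types, lifting) UNIV_I UN_I mem_Collect_eq subsetI top.extremum_uniqueI)
  obtain g where g: "bij_betw g {..<card F} F"
    using ex_bij_betw_nat_finite[OF F(1)] by (auto simp: atLeast0LessThan)
  define tot where "tot y = (\<Sum>x\<in>F. \<beta> x y)" for y
  have tot: "tot y > 0" for y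
  proof -
    obtain x where "x \<in> F" "0 < \<beta> x y" using F(2) by blast
    then show ?thesis unfolding tot_def using F(1) \<beta>(2) by (meson sum_pos2)
  qed
  have tot0: "tot y \<noteq> 0" for y using tot[of y] by simp
  define r where "r i y = \<beta> (g i) y * inverse (tot y)" for i y
  have "smooth UNIV tot" unfolding tot_def[abs_def] by (intro smooth_fn_sum open_UNIV \<beta>(1))
  then have "smooth UNIV (r i)" for i
    unfolding r_def[abs_def] by (intro smooth_fn_mult smooth_fn_inverse open_UNIV \<beta>(1) tot0)
  moreover have "0 \<le> r i y" for i y using \<beta>(2) tot[of y] by (simp add: r_def)
  moreover have "closure {y. r i y \<noteq> 0} \<subseteq> tdom (s (g i))" for i
  proof -
    have "{y. r i y \<noteq> 0} = {y. \<beta> (g i) y \<noteq> 0}" by (auto simp: r_def tot0)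
    then show ?thesis using \<beta>(4) by simp
  qed
  moreover have "(\<Sum>i<card F. r i y) = 1" for y
  proof -
    have "(\<Sum>i<card F. r i y) = (\<Sum>x\<in>F. \<beta> x y * inverse (tot y))"
      unfolding r_def by (rule sum.reindex_bij_betw[OF g])
    also have "\<dots> = tot y * inverse (tot y)" by (simp add: tot_def sum_distrib_right)
    finally show ?thesis using tot[of y] by simp
  qed
  ultimately have "partition_of_unity X (card F, \<lambda>i. s (g i), r)"
    using s by (simp add: partition_of_unity_def)
  then show ?thesis by blast
qed

end


context higher_surface
begin

section \<open>Orientation\<close>

lemma sum_hideal_conj2:
  assumes "c \<in> atlas X" "x \<in> fst c"
  obtains f g where "f \<in> hideal X c x" "g \<in> hideal X c x" "var_p = f + conj2 g"
proof -
  have "{f + conj2 g | f g. f \<in> hideal X c x \<and> g \<in> hideal X c x} = ideal_gen {var_p, var_pbar}"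
    using hcs assms unfolding higher_complex_structure_def by blast
  moreover have "var_p \<in> ideal_gen {var_p, var_pbar}" by (intro in_ideal_gen) simp
  ultimately show ?thesis using that by blast
qed

text \<open>
  The linear parts of conjugates of elements of \<open>I\<close> are annihilated by \<open>(conj v, conj u)\<close>. If
  \<open>|u| = |v|\<close>, this is proportional to \<open>(u, v)\<close>, so that \<open>(u, v)\<close> annihilates the linear part of every element of
  \<open>I + conj I\<close>, in particular that of \<open>p\<close>; then \<open>u = 0\<close>.
\<close>

lemma canonical_line_cmod_neq:
  assumes c: "c \<in> atlas X" "x \<in> fst c" and uv: "(u, v) \<in> canonical_line X c x" "(u, v) \<noteq> (0, 0)"
  shows "cmod u \<noteq> cmod v"
proof
  assume eq: "cmod u = cmod v"
  obtain f g where fg: "f \<in> hideal X c x" "g \<in> hideal X c x" "var_p = f + conj2 g"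
    using sum_hideal_conj2[OF c] .
  have "coeff2 var_p 1 0 = coeff2 (f + conj2 g) 1 0" "coeff2 var_p 0 1 = coeff2 (f + conj2 g) 0 1"
    using fg(3) by simp_all
  then have p: "1 = coeff2 f 1 0 + cnj (coeff2 g 0 1)" "0 = coeff2 f 0 1 + cnj (coeff2 g 1 0)"
    by (simp_all only: coeff2_simps coeff2_conj2 coeff2_var_p) simp_all
  have ann: "u * coeff2 f 1 0 + v * coeff2 f 0 1 = 0" "u * coeff2 g 1 0 + v * coeff2 g 0 1 = 0"
    using uv(1) fg by (auto simp: canonical_line_def)
  have uu: "u * cnj u = v * cnj v" using eq by (simp add: complex_norm_square[symmetric])
  have "u = u * (coeff2 f 1 0 + cnj (coeff2 g 0 1)) + v * (coeff2 f 0 1 + cnj (coeff2 g 1 0))"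
    using p by simp
  also have "\<dots> = u * cnj (coeff2 g 0 1) + v * cnj (coeff2 g 1 0)"
    using ann(1) by (simp add: algebra_simps)
  finally have "cnj u * u = cnj u * (u * cnj (coeff2 g 0 1) + v * cnj (coeff2 g 1 0))" by simp
  also have "\<dots> = v * cnj (u * coeff2 g 1 0 + v * coeff2 g 0 1)"
    using uu by (simp add: algebra_simps)
  finally have "cnj u * u = 0" by (simp only: ann(2) complex_cnj_zero mult_zero_right)
  then have "u = 0" by simp
  then show False using eq uv(2) by simp
qed

text \<open>
  Two independent annihilating covectors would force all elements of \<open>I\<close>, and then those of
  \<open>I + conj I\<close>, to have zero linear part.
\<close>

lemma canonical_line_proportional:
  assumes c: "c \<in> atlas X" "x \<in> fst c" and uv: "(u, v) \<in> canonical_line X c x"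
    and uv': "(u', v') \<in> canonical_line X c x"
  shows "u * v' = u' * v"
proof (rule ccontr)
  assume D: "u * v' \<noteq> u' * v"
  have lin: "coeff2 f 1 0 = 0 \<and> coeff2 f 0 1 = 0" if "f \<in> hideal X c x" for f
  proof -
    have e: "u * coeff2 f 1 0 + v * coeff2 f 0 1 = 0" "u' * coeff2 f 1 0 + v' * coeff2 f 0 1 = 0"
      using uv uv' that by (auto simp: canonical_line_def)
    have "(u * v' - u' * v) * coeff2 f 1 0 = v' * (u * coeff2 f 1 0 + v * coeff2 f 0 1)
        - v * (u' * coeff2 f 1 0 + v' * coeff2 f 0 1)"
      and "(u * v' - u' * v) * coeff2 f 0 1 = u * (u' * coeff2 f 1 0 + v' * coeff2 f 0 1)
        - u' * (u * coeff2 f 1 0 + v * coeff2 f 0 1)"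
      by (simp_all add: algebra_simps)
    then have "(u * v' - u' * v) * coeff2 f 1 0 = 0" "(u * v' - u' * v) * coeff2 f 0 1 = 0"
      by (simp_all only: e mult_zero_right diff_zero)
    then show ?thesis using D by simp
  qed
  obtain f g where fg: "f \<in> hideal X c x" "g \<in> hideal X c x" "var_p = f + conj2 g"
    using sum_hideal_conj2[OF c] .
  have "coeff2 var_p 1 0 = coeff2 (f + conj2 g) 1 0" using fg(3) by simp
  then have "1 = coeff2 f 1 0 + cnj (coeff2 g 0 1)"
    by (simp only: coeff2_simps coeff2_conj2 coeff2_var_p) simp
  then show False using lin[OF fg(1)] lin[OF fg(2)] by simp
qed

text \<open>
  The coefficient of \<open>dz \<and> dzbar\<close> in \<open>\<theta> \<and> conj \<theta>\<close> for the given generator \<open>\<theta> = u dz + v dzbar\<close> of the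
  canonical line.
\<close>

definition orient :: "'j \<Rightarrow> 'a chart \<Rightarrow> 'a \<Rightarrow> real" where
  "orient j c x = (cmod (fst (hc_form X j c x)))\<^sup>2 - (cmod (snd (hc_form X j c x)))\<^sup>2"

lemma hc_formD:
  assumes j: "j \<in> hc_index X" and c: "c \<in> atlas X"
  shows "smooth (fst c \<inter> hc_dom X j) (hc_form X j c)"
    and "x \<in> fst c \<Longrightarrow> x \<in> hc_dom X j \<Longrightarrow> hc_form X j c x \<in> canonical_line X c x - {(0, 0)}"
    and "open (hc_dom X j)"
    and "d \<in> atlas X \<Longrightarrow> x \<in> fst c \<Longrightarrow> x \<in> fst d \<Longrightarrow> x \<in> hc_dom X j \<Longrightarrow>
      hc_form X j c x = (fst (hc_form X j d x) * trans_z c d x + snd (hc_form X j d x) * cnj (trans_zbar c d x),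
                         fst (hc_form X j d x) * trans_zbar c d x + snd (hc_form X j d x) * cnj (trans_z c d x))"
proof -
  have 1: "\<forall>j\<in>hc_index X. \<forall>c\<in>atlas X.
        smooth (fst c \<inter> hc_dom X j) (hc_form X j c) \<and>
        (\<forall>x\<in>fst c \<inter> hc_dom X j. hc_form X j c x \<in> canonical_line X c x - {(0, 0)})"
    and 2: "\<forall>j\<in>hc_index X. \<forall>c\<in>atlas X. \<forall>d\<in>atlas X. \<forall>x\<in>fst c \<inter> fst d \<inter> hc_dom X j.
        let (u, v) = hc_form X j d x in
        hc_form X j c x = (u * trans_z c d x + v * cnj (trans_zbar c d x),
                           u * trans_zbar c d x + v * cnj (trans_z c d x))"
    and 3: "\<forall>j\<in>hc_index X. open (hc_dom X j)"
    using half unfolding half_canonical_def by blast+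
  show "smooth (fst c \<inter> hc_dom X j) (hc_form X j c)"
    and "x \<in> fst c \<Longrightarrow> x \<in> hc_dom X j \<Longrightarrow> hc_form X j c x \<in> canonical_line X c x - {(0, 0)}"
    and "open (hc_dom X j)"
    using 1 3 j c by blast+
  assume "d \<in> atlas X" "x \<in> fst c" "x \<in> fst d" "x \<in> hc_dom X j"
  then have "let (u, v) = hc_form X j d x in
        hc_form X j c x = (u * trans_z c d x + v * cnj (trans_zbar c d x),
                           u * trans_zbar c d x + v * cnj (trans_z c d x))"
    using 2 j c by blast
  then show "hc_form X j c x = (fst (hc_form X j d x) * trans_z c d x + snd (hc_form X j d x) * cnj (trans_zbar c d x),
                         fst (hc_form X j d x) * trans_zbar c d x + snd (hc_form X j d x) * cnj (trans_z c d x))"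
    by (simp add: Let_def case_prod_unfold)
qed

lemma orient_nonzero:
  assumes "j \<in> hc_index X" "c \<in> atlas X" "x \<in> fst c" "x \<in> hc_dom X j"
  shows "orient j c x \<noteq> 0"
proof -
  obtain u v where uv: "hc_form X j c x = (u, v)" by fastforce
  then have "(u, v) \<in> canonical_line X c x" "(u, v) \<noteq> (0, 0)"
    using hc_formD(2)[OF assms] by auto
  then show ?thesis
    using canonical_line_cmod_neq[OF assms(2,3)] uv by (simp add: orient_def)
qed

lemma chart_sign_eq_sgn:
  assumes "j \<in> hc_index X" "c \<in> atlas X" "x \<in> fst c" "x \<in> hc_dom X j"
  shows "chart_sign X c x = sgn (orient j c x)"
proof -
  obtain u v where uv: "hc_form X j c x = (u, v)" by fastforce
  then have can: "(u, v) \<in> canonical_line X c x" "(u, v) \<noteq> (0, 0)"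
    using hc_formD(2)[OF assms] by auto
  note neq = canonical_line_cmod_neq[OF assms(2,3) can]
  have "(\<exists>(u', v')\<in>canonical_line X c x. cmod v' < cmod u') \<longleftrightarrow> cmod v < cmod u"
  proof
    assume "\<exists>(u', v')\<in>canonical_line X c x. cmod v' < cmod u'"
    then obtain u' v' where 1: "(u', v') \<in> canonical_line X c x" "cmod v' < cmod u'" by auto
    have "cmod u * cmod v' = cmod u' * cmod v"
      using canonical_line_proportional[OF assms(2,3) can(1) 1(1)] by (metis norm_mult)
    moreover have "cmod u * cmod v' < cmod u' * cmod v" if "cmod u < cmod v"
    proof -
      have "cmod u * cmod v' \<le> cmod u * cmod u'" using 1(2) by (intro mult_left_mono) auto
      also have "\<dots> < cmod v * cmod u'"
        using that 1(2) norm_ge_zero[of v'] by (intro mult_strict_right_mono) linarith+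
      finally show ?thesis by (simp add: mult.commute)
    qed
    ultimately show "cmod v < cmod u" using neq by fastforce
  qed (use can in auto)
  moreover have "cmod v < cmod u \<longleftrightarrow> 0 < orient j c x"
    by (simp add: orient_def uv) (metis abs_le_square_iff abs_norm_cancel not_le)
  ultimately show ?thesis
    using orient_nonzero[OF assms] by (simp add: chart_sign_def sgn_if)
qed

text \<open>
  The signs of two charts differ by the sign of the Jacobian, because \<open>\<theta> \<and> conj \<theta>\<close> is a two-form.
\<close>

lemma chart_sign_change:
  assumes c: "c \<in> atlas X" "x \<in> fst c" and d: "d \<in> atlas X" "x \<in> fst d"
  shows "chart_sign X c x * jac c d x = chart_sign X d x * \<bar>jac c d x\<bar>"
proof -
  obtain j where j: "j \<in> hc_index X" "x \<in> hc_dom X j"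
    using half unfolding half_canonical_def by (metis UNIV_I UN_E)
  have "orient j c x = orient j d x * jac c d x"
    unfolding orient_def jac_def hc_formD(4)[OF j(1) c(1) d(1) c(2) d(2) j(2)] fst_conv snd_conv cmod_power2
    by (simp add: algebra_simps power2_eq_square)
  then have "chart_sign X c x = chart_sign X d x * sgn (jac c d x)"
    using chart_sign_eq_sgn[OF j(1) c j(2)] chart_sign_eq_sgn[OF j(1) d j(2)] by (simp add: sgn_mult)
  then show ?thesis by (simp add: abs_sgn mult.commute mult.left_commute)
qed

lemma chart_sign_square: "chart_sign X c x * chart_sign X c x = 1"
  by (simp add: chart_sign_def)

lemma chart_sign_locally_constant:
  assumes c: "c \<in> atlas X" "x \<in> fst c"
  obtains W where "open W" "x \<in> W" "W \<subseteq> fst c" "\<And>y. y \<in> W \<Longrightarrow> chart_sign X c y = chart_sign X c x"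
proof -
  obtain j where j: "j \<in> hc_index X" "x \<in> hc_dom X j"
    using half unfolding half_canonical_def by (metis UNIV_I UN_E)
  let ?U = "fst c \<inter> hc_dom X j"
  have U: "open ?U" using chart_facts(1)[OF c(1)] hc_formD(3)[OF j(1) c(1)] by blast
  have "continuous_on ?U (hc_form X j c)"
    by (rule smooth_fn_continuous_on[OF hc_formD(1)[OF j(1) c(1)] U])
  then have cont: "continuous_on ?U (\<lambda>y. orient j c x * orient j c y)"
    unfolding orient_def by (intro continuous_intros)
  let ?W = "?U \<inter> (\<lambda>y. orient j c x * orient j c y) -` {0<..}"
  show ?thesis
  proof
    show "open ?W" by (rule continuous_open_preimage[OF cont U]) simp
    show "x \<in> ?W" using c j orient_nonzero[OF j(1) c j(2)] by (simp add: zero_less_mult_iff) linarith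
    show "chart_sign X c y = chart_sign X c x" if "y \<in> ?W" for y
      using that chart_sign_eq_sgn[OF j(1) c j(2)] chart_sign_eq_sgn[OF j(1) c(1), of y]
      by (auto simp: zero_less_mult_iff)
  qed auto
qed


section \<open>Curvature on the surface\<close>

text \<open>The connection form in the coordinates of the trivialisation.\<close>

definition local_rep :: "('a, 'j, 'n) matrix_form \<Rightarrow> ('a, 'j, 'n) triv \<Rightarrow> 'n local_form" where
  "local_rep A s z v = A s (chart_inv (tchart s) z) v"

lemma smooth_local_rep:
  assumes A: "smooth_form X A" and s: "s \<in> vtrivs"
  shows "smooth_local_form (chart_image (tchart s) (tdom s)) (local_rep A s)"
proof -
  have 1: "smooth (tdom s) (\<lambda>x. A s x v)" for v
    using A s unfolding smooth_form_def by blast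
  have 2: "linear (A s x)" if "x \<in> tdom s" for x
    using A s that unfolding smooth_form_def by blast
  show ?thesis
    unfolding smooth_local_form_def local_rep_def[abs_def]
    using smooth_fn_imp_smooth_on[OF 1 trivD(2)[OF s]] 2 chart_imageD(2)[OF trivD(2)[OF s]]
    by (auto simp: o_def)
qed

lemma curvature_eq_local:
  assumes s: "s \<in> vtrivs" "x \<in> tdom s"
  shows "curvature A s x v w = local_curvature (local_rep A s) (snd (tchart s) x) v w"
  using chart_inv_snd[OF trivD(2)[OF s(1)] trivD(7)[OF s]]
  by (simp add: curvature_def local_curvature_def local_rep_def cderiv_def o_def)

lemma open_triv_image: "s \<in> vtrivs \<Longrightarrow> open (chart_image (tchart s) (tdom s))"
  by (intro open_chart_image trivD(1,2))

lemma triv_image: "s \<in> vtrivs \<Longrightarrow> x \<in> tdom s \<Longrightarrow> snd (tchart s) x \<in> chart_image (tchart s) (tdom s)"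
  by (intro snd_in_chart_image trivD(7))

lemma curvature_alternating:
  assumes A: "smooth_form X A" and s: "s \<in> vtrivs" "x \<in> tdom s"
  shows "curvature A s x v w = (Re v * Im w - Im v * Re w) *\<^sub>R curvature A s x 1 \<i>"
  unfolding curvature_eq_local[OF s]
  by (rule local_curvature_alternating[OF smooth_local_rep[OF A s(1)] open_triv_image[OF s(1)] triv_image[OF s]])

lemma smooth_curvature:
  assumes A: "smooth_form X A" and s: "s \<in> vtrivs"
  shows "smooth (tdom s) (\<lambda>x. curvature A s x v w)"
proof -
  have A': "smooth (tdom s) (\<lambda>x. A s x v)" for v
    using A s unfolding smooth_form_def by blast
  note W = trivD(1)[OF s]
  have m: "bounded_linear (\<lambda>M :: complex^'n^'n. - M)" by (rule bounded_linear_minus[OF bounded_linear_ident])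
  have "smooth (tdom s) (\<lambda>x. (cderiv (tchart s) (\<lambda>y. A s y w) x v + - cderiv (tchart s) (\<lambda>y. A s y v) x w)
     + (A s x v ** A s x w + - (A s x w ** A s x v)))"
    by (intro smooth_fn_add smooth_fn_matrix_mult smooth_fn_bounded_linear[OF m]
        smooth_fn_cderiv[OF A' W trivD(2)[OF s] trivD(4)[OF s]] A' W)
  then show ?thesis by (simp add: curvature_def)
qed

definition gauge_compatible :: "('a, 'j, 'n) matrix_form \<Rightarrow> bool" where
  "gauge_compatible A \<longleftrightarrow> (\<forall>s\<in>vtrivs. \<forall>s'\<in>vtrivs. \<forall>x\<in>tdom s \<inter> tdom s'. \<forall>v.
     A s' x (transD (tchart s) (tchart s') x v) ** transT X s s' x
       + cderiv (tchart s) (transT X s s') x v = transT X s s' x ** A s x v)"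

text \<open>
  Pull back the connection form along the coordinate change; the transition matrix then intertwines two
  connections in the same coordinates.
\<close>

lemma curvature_transform:
  assumes A: "smooth_form X A" "gauge_compatible A"
    and s: "s \<in> vtrivs" "x \<in> tdom s" and s': "s' \<in> vtrivs" "x \<in> tdom s'"
  shows "curvature A s' x (transD (tchart s) (tchart s') x v) (transD (tchart s) (tchart s') x w) ** transT X s s' x
    = transT X s s' x ** curvature A s x v w"
proof -
  let ?c = "tchart s" and ?c' = "tchart s'"
  note c = trivD(2)[OF s(1)] and c' = trivD(2)[OF s'(1)]
  define U where "U = chart_image ?c (tdom s \<inter> tdom s')"
  define \<phi> where "\<phi> = snd ?c' \<circ> chart_inv ?c"
  let ?D = "\<lambda>z. Der \<phi> z"
  let ?z = "snd ?c x"
  have dom: "open (tdom s \<inter> tdom s')" using trivD(1) s s' by blast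
  have U: "open U" unfolding U_def by (rule open_chart_image[OF c dom])
  have U_sub: "U \<subseteq> chart_image ?c (tdom s)" unfolding U_def by (rule chart_image_mono) simp
  have z: "?z \<in> U" unfolding U_def using s s' trivD(7) by (intro snd_in_chart_image) auto
  have Uy: "chart_inv ?c z \<in> tdom s \<inter> tdom s'" "snd ?c (chart_inv ?c z) = z" if "z \<in> U" for z
    using chart_imageD[OF c that[unfolded U_def]] by auto
  have \<phi>: "smooth_on U \<phi>"
    unfolding U_def \<phi>_def
    by (rule smooth_fn_imp_smooth_on[OF smooth_fn_chart[OF c'] c]) (use trivD(4)[OF s'(1)] in auto)
  have img: "\<phi> ` U \<subseteq> chart_image ?c' (tdom s')"
    using Uy triv_image[OF s'(1)] by (auto simp: \<phi>_def)
  have T: "smooth_on U (transT X s s' \<circ> chart_inv ?c)"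
    unfolding U_def by (rule smooth_fn_imp_smooth_on[OF smooth_transT[OF s(1) s'(1)] c])
  let ?B = "\<lambda>z v. local_rep A s' (\<phi> z) (?D z v)"
  have inv: "chart_inv ?c' (\<phi> z) = chart_inv ?c z" if "z \<in> U" for z
    using chart_inv_snd[OF c'] trivD(7)[OF s'(1)] Uy(1)[OF that] by (auto simp: \<phi>_def)
  have D: "?D z v = transD ?c ?c' (chart_inv ?c z) v" if "z \<in> U" for z v
    using Uy(2)[OF that] by (simp add: transD_def cderiv_def \<phi>_def)
  have gauge: "?B z v ** (transT X s s' \<circ> chart_inv ?c) z + Der (transT X s s' \<circ> chart_inv ?c) z v
      = (transT X s s' \<circ> chart_inv ?c) z ** local_rep A s z v" if z: "z \<in> U" for z v
  proof -
    let ?y = "chart_inv ?c z"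
    have "A s' ?y (transD ?c ?c' ?y v) ** transT X s s' ?y + cderiv ?c (transT X s s') ?y v
        = transT X s s' ?y ** A s ?y v"
      using A(2) s(1) s'(1) Uy(1)[OF z] unfolding gauge_compatible_def by blast
    then show ?thesis
      using Uy(2)[OF z] by (simp add: local_rep_def inv[OF z] D[OF z] cderiv_def)
  qed
  have sA: "smooth_local_form U (local_rep A s)"
    using smooth_local_rep[OF A(1) s(1)] U_sub smooth_on_subset
    unfolding smooth_local_form_def by blast
  have "local_curvature ?B ?z v w ** (transT X s s' \<circ> chart_inv ?c) ?z
      = (transT X s s' \<circ> chart_inv ?c) ?z ** local_curvature (local_rep A s) ?z v w"
    by (rule local_curvature_gauge[OF sA smooth_local_form_pullback[OF smooth_local_rep[OF A(1) s'(1)]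
          open_triv_image[OF s'(1)] \<phi> U img] T U z gauge])
  moreover have "local_curvature ?B ?z v w = local_curvature (local_rep A s') (\<phi> ?z) (?D ?z v) (?D ?z w)"
    by (rule local_curvature_pullback[OF smooth_local_rep[OF A(1) s'(1)]
          open_triv_image[OF s'(1)] \<phi> U z img])
  ultimately show ?thesis
    using chart_inv_snd[OF c trivD(7)[OF s]]
    by (simp add: curvature_eq_local[OF s] curvature_eq_local[OF s'] D[OF z]) (simp add: \<phi>_def)
qed

lemma curvature_transform_jac:
  assumes A: "smooth_form X A" "gauge_compatible A"
    and s: "s \<in> vtrivs" "x \<in> tdom s" and s': "s' \<in> vtrivs" "x \<in> tdom s'"
  shows "jac (tchart s) (tchart s') x *\<^sub>R (curvature A s' x 1 \<i> ** transT X s s' x)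
    = transT X s s' x ** curvature A s x 1 \<i>"
  using curvature_transform[OF A s s', of 1 \<i>]
    jac_eq_det[OF trivD(2)[OF s(1)] trivD(7)[OF s] trivD(2)[OF s'(1)] trivD(7)[OF s']]
  unfolding curvature_alternating[OF A(1) s', of "transD (tchart s) (tchart s') x 1"]
  by (simp add: matrix_scaleR_left)

text \<open>
  The volume form is parallel, so its logarithmic derivative is the trace of the connection form.
\<close>

lemma trace_curvature:
  assumes vol: "volume_form X vol" and A: "sl_connection X vol A"
    and s: "s \<in> vtrivs" "x \<in> tdom s"
  shows "trace (curvature A s x v w) = 0"
proof -
  let ?c = "tchart s"
  note c = trivD(2)[OF s(1)]
  have smooth: "smooth_form X A"
    and tr: "\<And>x v. x \<in> tdom s \<Longrightarrow> cderiv ?c (vol s) x v = trace (A s x v) * vol s x"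
    using A s(1) unfolding sl_connection_def by blast+
  have vs: "smooth (tdom s) (vol s)" "vol s x \<noteq> 0"
    using vol s unfolding volume_form_def by blast+
  show ?thesis
    unfolding curvature_eq_local[OF s]
  proof (rule trace_local_curvature_eq_0[OF smooth_local_rep[OF smooth s(1)] open_triv_image[OF s(1)] triv_image[OF s]
        smooth_fn_imp_smooth_on[OF vs(1) c]])
    show "(vol s \<circ> chart_inv ?c) (snd ?c x) \<noteq> 0"
      using vs(2) chart_inv_snd[OF c trivD(7)[OF s]] by simp
    show "Der (vol s \<circ> chart_inv ?c) z v = trace (local_rep A s z v) * (vol s \<circ> chart_inv ?c) z"
      if "z \<in> chart_image ?c (tdom s)" for z v
      using tr[OF chart_imageD(2)[OF c that], of v] chart_imageD(3)[OF c that]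
      by (simp add: cderiv_def local_rep_def)
  qed
qed

lemma matrix_inv_left_right:
  fixes H :: "complex^'n^'n"
  assumes "invertible H"
  shows "H ** matrix_inv H = mat 1" "matrix_inv H ** H = mat 1"
  using someI_ex[OF assms[unfolded invertible_def]] unfolding matrix_inv_def by auto

text \<open>
  By definition of \<open>neg_adjoint\<close>, the Gram matrix intertwines \<open>d + A\<close> with \<open>d - B^\<dagger>\<close>.
\<close>

lemma curvature_neg_adjoint:
  assumes h: "hermitian_structure X h" and A: "smooth_form X A" and B: "smooth_form X B"
    and s: "s \<in> vtrivs" "x \<in> tdom s"
    and eq: "\<And>x v. x \<in> tdom s \<Longrightarrow> A s x v = neg_adjoint h B s x v"
  shows "curvature A s x v w = - hadjoint (h s x) (curvature B s x v w)"
proof -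
  let ?c = "tchart s" and ?U = "chart_image (tchart s) (tdom s)"
  note c = trivD(2)[OF s(1)]
  have hs: "smooth (tdom s) (h s)" and inv: "\<And>x. x \<in> tdom s \<Longrightarrow> invertible (h s x)"
    using h s(1) unfolding hermitian_structure_def by blast+
  let ?C = "\<lambda>z v. - ctranspose (local_rep B s z v)"
  note SB = smooth_local_rep[OF B s(1)] and U = open_triv_image[OF s(1)] and z = triv_image[OF s]
  have "local_curvature ?C (snd ?c x) v w ** (h s \<circ> chart_inv ?c) (snd ?c x)
      = (h s \<circ> chart_inv ?c) (snd ?c x) ** local_curvature (local_rep A s) (snd ?c x) v w"
  proof (rule local_curvature_gauge[OF smooth_local_rep[OF A s(1)] smooth_local_form_neg_ctranspose[OF SB U]
        smooth_fn_imp_smooth_on[OF hs c] U z])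
    fix z v assume z: "z \<in> ?U"
    let ?y = "chart_inv ?c z"
    note y = chart_imageD[OF c z]
    have "h s ?y ** A s ?y v = cderiv ?c (h s) ?y v - ctranspose (B s ?y v) ** h s ?y"
      unfolding eq[OF y(2)] neg_adjoint_def hadjoint_def
      by (simp add: matrix_algebra_simps(4-6) matrix_mul_assoc matrix_inv_left_right[OF inv[OF y(2)]])
    then show "?C z v ** (h s \<circ> chart_inv ?c) z + Der (h s \<circ> chart_inv ?c) z v
        = (h s \<circ> chart_inv ?c) z ** local_rep A s z v"
      using y(3) by (simp add: local_rep_def cderiv_def matrix_algebra_simps(3))
  qed
  then have "- ctranspose (curvature B s x v w) ** h s x = h s x ** curvature A s x v w"
    unfolding local_curvature_neg_ctranspose[OF SB U z]
    by (simp add: curvature_eq_local[OF s] chart_inv_snd[OF c trivD(7)[OF s]])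
  then have "matrix_inv (h s x) ** (h s x ** curvature A s x v w)
      = matrix_inv (h s x) ** (- ctranspose (curvature B s x v w) ** h s x)" by simp
  then show ?thesis
    by (simp add: matrix_mul_assoc matrix_inv_left_right[OF inv[OF s(2)]] hadjoint_def matrix_algebra_simps(3,6))
qed

end


section \<open>Test sections\<close>

text \<open>
  Continuity and the compact support make the integrand integrable, so that the integral is not zero by
  default. For the strict inequality, the real part is bounded below on a small disc.
\<close>

lemma Re_set_integral_nonneg:
  fixes f :: "complex \<Rightarrow> complex"
  assumes U: "open U" and f: "continuous_on U f" and K: "compact K" "K \<subseteq> U"
    and supp: "\<And>z. z \<in> U \<Longrightarrow> z \<notin> K \<Longrightarrow> f z = 0"
    and nonneg: "\<And>z. z \<in> U \<Longrightarrow> 0 \<le> Re (f z)"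
  shows "0 \<le> Re (set_lebesgue_integral lborel U f)"
    and "z0 \<in> U \<Longrightarrow> 0 < Re (f z0) \<Longrightarrow> 0 < Re (set_lebesgue_integral lborel U f)"
proof -
  have eq: "(\<lambda>z. indicator U z *\<^sub>R f z) = (\<lambda>z. indicator K z *\<^sub>R f z)"
    using supp K(2) by (auto simp: indicator_def fun_eq_iff)
  have int: "integrable lborel (\<lambda>z. indicator U z *\<^sub>R f z)"
    unfolding eq using f K by (intro borel_integrable_compact) (auto intro: continuous_on_subset)
  have Re_int: "Re (set_lebesgue_integral lborel U f) = (LINT z|lborel. Re (indicator U z *\<^sub>R f z))"
    unfolding set_lebesgue_integral_def by (rule integral_Re[OF int, symmetric])
  have nn: "0 \<le> Re (indicator U z *\<^sub>R f z)" for z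
    using nonneg by (simp add: indicator_def)
  show "0 \<le> Re (set_lebesgue_integral lborel U f)"
    unfolding Re_int by (rule integral_nonneg_AE) (simp add: nn del: scaleR_complex.simps)
  assume z0: "z0 \<in> U" "0 < Re (f z0)"
  define d where "d = Re (f z0) / 2"
  have d: "d > 0" using z0 by (simp add: d_def)
  have "open (U \<inter> (\<lambda>z. Re (f z)) -` {d<..})"
    by (rule continuous_open_preimage[OF _ U]) (auto intro: continuous_intros f)
  moreover have "z0 \<in> U \<inter> (\<lambda>z. Re (f z)) -` {d<..}" using z0 by (simp add: d_def)
  ultimately obtain e where e: "e > 0" "ball z0 e \<subseteq> U \<inter> (\<lambda>z. Re (f z)) -` {d<..}"
    using openE by blast
  have fin: "emeasure lborel (ball z0 e) < \<infinity>" by (rule emeasure_lborel_ball_finite)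
  have "0 < d * measure lborel (ball z0 e)"
    using d e(1) content_ball_pos[of e z0] by simp
  also have "\<dots> = (LINT z|lborel. d * indicator (ball z0 e) z)"
    using fin by simp
  also have "\<dots> \<le> (LINT z|lborel. Re (indicator U z *\<^sub>R f z))"
  proof (rule Bochner_Integration.integral_mono)
    show "integrable lborel (\<lambda>z. d * indicator (ball z0 e) z)"
      using fin by (intro integrable_mult_right integrable_real_indicator) auto
    show "integrable lborel (\<lambda>z. Re (indicator U z *\<^sub>R f z))" by (rule integrable_Re[OF int])
    show "d * indicator (ball z0 e) z \<le> Re (indicator U z *\<^sub>R f z)" for z
    proof (cases "z \<in> ball z0 e")
      case True
      then have "z \<in> U" "d < Re (f z)" using e(2) by auto
      then show ?thesis using True by simp
    next
      case False
      then show ?thesis using nn[of z] by simp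
    qed
  qed
  finally show "0 < Re (set_lebesgue_integral lborel U f)" unfolding Re_int .
qed

definition cscale :: "complex \<Rightarrow> complex^'n^'m \<Rightarrow> complex^'n^'m" where
  "cscale a M = (\<chi> i j. a * M $ i $ j)"

lemma cscale_mult:
  "cscale a M ** N = cscale a (M ** N)" "M ** cscale a N = cscale a (M ** N)"
  "cscale a M *v v = a *s (M *v v)"
  by (simp_all add: cscale_def matrix_matrix_mult_def matrix_vector_mult_def vec_eq_iff sum_distrib_left mult_ac)

lemma trace_cscale: "trace (cscale a M) = a * trace M"
  by (simp add: trace_def cscale_def sum_distrib_left)

lemma bounded_linear_cscale: "bounded_linear (cscale a :: complex^'n^'n::finite \<Rightarrow> complex^'n^'n)"
  unfolding linear_conv_bounded_linear[symmetric]
  by (rule linearI) (auto simp: cscale_def vec_eq_iff algebra_simps)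

context higher_surface
begin

text \<open>
  Corrects a constant matrix by a rank one matrix so that it preserves the moving line \<open>L\<close>. The
  linear form \<open>v $ k / e $ k\<close> takes the value \<open>1\<close> on the generator \<open>e\<close> of \<open>L\<close>, and the rank one
  matrix has trace zero because its image lies in the kernel of that form.
\<close>

definition stabilise :: "'n \<Rightarrow> complex^'n \<Rightarrow> complex^'n^'n \<Rightarrow> complex^'n^'n" where
  "stabilise k e M = (\<chi> i j. M $ i $ j
     - (if j = k then ((M *v e) $ i - (M *v e) $ k / e $ k * e $ i) / e $ k else 0))"

lemma stabilise_vector:
  assumes "e $ k \<noteq> 0"
  shows "stabilise k e M *v e = ((M *v e) $ k / e $ k) *s e"
proof -
  have "(stabilise k e M *v e) $ i = ((M *v e) $ k / e $ k) * e $ i" for i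
  proof -
    let ?w = "((M *v e) $ i - (M *v e) $ k / e $ k * e $ i) / e $ k"
    have "(stabilise k e M *v e) $ i = (\<Sum>j\<in>UNIV. M $ i $ j * e $ j) - (\<Sum>j\<in>UNIV. (if j = k then ?w else 0) * e $ j)"
      by (simp add: stabilise_def matrix_vector_mult_def left_diff_distrib sum_subtractf)
    also have "(\<Sum>j\<in>UNIV. (if j = k then ?w else 0) * e $ j) = (\<Sum>j\<in>UNIV. if j = k then ?w * e $ j else 0)"
      by (intro sum.cong) auto
    also have "\<dots> = ?w * e $ k" by simp
    finally show ?thesis using assms by (simp add: matrix_vector_mult_def)
  qed
  then show ?thesis by (simp add: vec_eq_iff)
qed

lemma trace_stabilise:
  assumes "e $ k \<noteq> 0"
  shows "trace (stabilise k e M) = trace M"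
  using assms by (simp add: trace_def stabilise_def sum_subtractf)

lemma stabilise_fixed:
  assumes "e $ k \<noteq> 0" "M *v e = a *s e"
  shows "stabilise k e M = M"
  using assms by (simp add: stabilise_def vec_eq_iff)

lemma smooth_stabilise:
  assumes W: "open W" and e: "\<And>i. smooth W (\<lambda>x. e x $ i)" and k: "\<And>x. x \<in> W \<Longrightarrow> e x $ k \<noteq> 0"
  shows "smooth W (\<lambda>x. stabilise k (e x) M)"
proof (rule smooth_fn_matrixI[OF W])
  fix i j
  have Me: "smooth W (\<lambda>x. (M *v e x) $ i)" for i
    unfolding matrix_vector_mult_def vec_lambda_beta by (intro smooth_fn_sum smooth_fn_mult smooth_fn_const W e)
  have "smooth W (\<lambda>x. M $ i $ j + (if j = k then -1 else 0) *
      (((M *v e x) $ i + (-1) * ((M *v e x) $ k * inverse (e x $ k) * e x $ i)) * inverse (e x $ k)))"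
    by (intro smooth_fn_add smooth_fn_mult smooth_fn_const smooth_fn_inverse W e Me k)
  then show "smooth W (\<lambda>x. stabilise k (e x) M $ i $ j)"
    by (rule smooth_fn_cong[OF _ W]) (simp add: stabilise_def divide_inverse)
qed

text \<open>
  The section with matrices \<open>m\<close> in the trivialisation \<open>s0\<close>, extended by zero. The factor on the right
  is the inverse of the one on the left.
\<close>

definition extend_section ::
    "('a, 'j, 'n) triv \<Rightarrow> 'a set \<Rightarrow> ('a \<Rightarrow> complex^'n^'n) \<Rightarrow> ('a, 'j, 'n) triv \<Rightarrow> 'a \<Rightarrow> complex^'n^'n" where
  "extend_section s0 W m s x = (if x \<in> W then transT X s0 s x ** m x ** transT X s s0 x else 0)"

lemma sl_section_extend:
  assumes s0: "s0 \<in> vtrivs" and W: "open W" "W \<subseteq> tdom s0"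
    and m: "smooth W m" "\<And>x. x \<in> W \<Longrightarrow> trace (m x) = 0"
    and K: "closed K" "K \<subseteq> W" "\<And>x. x \<in> W \<Longrightarrow> x \<notin> K \<Longrightarrow> m x = 0"
  shows "sl_section X (extend_section s0 W m)"
  unfolding sl_section_def
proof (intro conjI ballI)
  fix s assume s: "s \<in> vtrivs"
  show "smooth (tdom s) (extend_section s0 W m s)"
  proof (rule smooth_fn_local)
    fix x assume x: "x \<in> tdom s"
    show "\<exists>W'. open W' \<and> x \<in> W' \<and> smooth W' (extend_section s0 W m s)"
    proof (cases "x \<in> W")
      case True
      let ?U = "W \<inter> tdom s"
      have U: "open ?U" using W trivD(1)[OF s] by blast
      have "smooth ?U (\<lambda>x. transT X s0 s x ** m x ** transT X s s0 x)"
      proof (intro smooth_fn_matrix_mult U)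
        show "smooth ?U (transT X s0 s)"
          by (rule smooth_fn_subset[OF smooth_transT[OF s0 s]]) (use W(2) in blast)
        show "smooth ?U (transT X s s0)"
          by (rule smooth_fn_subset[OF smooth_transT[OF s s0]]) (use W(2) in blast)
        show "smooth ?U m" by (rule smooth_fn_subset[OF m(1)]) blast
      qed
      then have "smooth ?U (extend_section s0 W m s)"
        by (rule smooth_fn_cong[OF _ U]) (simp add: extend_section_def)
      then show ?thesis using U True x by blast
    next
      case False
      have "open (- K)" using K by auto
      moreover have "smooth (- K) (extend_section s0 W m s)"
        by (rule smooth_fn_cong[OF smooth_fn_const[of _ 0] \<open>open (- K)\<close>])
          (use K(3) in \<open>simp add: extend_section_def matrix_algebra_simps\<close>)
      ultimately show ?thesis using False K(2) by blast
    qed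
  qed
next
  fix s x assume s: "s \<in> vtrivs" "x \<in> tdom s"
  show "trace (extend_section s0 W m s x) = 0"
  proof (cases "x \<in> W")
    case True
    then have s0x: "x \<in> tdom s0" using W by blast
    have "trace (extend_section s0 W m s x) = trace (transT X s s0 x ** (transT X s0 s x ** m x))"
      using True trace_mul_sym[of "transT X s0 s x ** m x" "transT X s s0 x"]
      by (simp add: extend_section_def)
    then show ?thesis
      using m(2)[OF True] by (simp add: matrix_mul_assoc transT_inverse[OF s0 s0x s])
  qed (simp add: extend_section_def trace_def)
next
  fix s s' x assume s: "s \<in> vtrivs" and s': "s' \<in> vtrivs" and x: "x \<in> tdom s \<inter> tdom s'"
  show "extend_section s0 W m s' x ** transT X s s' x = transT X s s' x ** extend_section s0 W m s x"
  proof (cases "x \<in> W")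
    case True
    then have xs: "x \<in> tdom s0" "x \<in> tdom s" "x \<in> tdom s'" using W x by auto
    have "extend_section s0 W m s' x ** transT X s s' x
        = transT X s0 s' x ** m x ** (transT X s' s0 x ** transT X s s' x)"
      using True by (simp add: extend_section_def matrix_mul_assoc)
    also have "\<dots> = (transT X s s' x ** transT X s0 s x) ** m x ** transT X s s0 x"
      by (simp only: transT_chain[OF s xs(2) s' xs(3) s0 xs(1)] transT_chain[OF s0 xs(1) s xs(2) s' xs(3)])
    finally show ?thesis using True by (simp add: extend_section_def matrix_mul_assoc)
  qed (simp add: extend_section_def matrix_algebra_simps)
qed

lemma preserves_L_iff:
  assumes s: "s \<in> vtrivs" "x \<in> tdom s"
  shows "preserves_L X s x M \<longleftrightarrow> (\<exists>a. M *v unit_vec s x = a *s unit_vec s x)"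
proof
  assume "preserves_L X s x M"
  moreover have "unit_vec s x \<in> line_L X s x"
    unfolding line_L_eq[OF s] by (auto intro: exI[of _ 1])
  ultimately show "\<exists>a. M *v unit_vec s x = a *s unit_vec s x"
    unfolding preserves_L_def line_L_eq[OF s] by blast
next
  assume "\<exists>a. M *v unit_vec s x = a *s unit_vec s x"
  then obtain a where "M *v unit_vec s x = a *s unit_vec s x" by blast
  then have "M *v (b *s unit_vec s x) = (b * a) *s unit_vec s x" for b
    by (simp add: vector_scalar_commute)
  then show "preserves_L X s x M" unfolding preserves_L_def line_L_eq[OF s] by blast
qed

lemma preserves_L_extend:
  assumes s0: "s0 \<in> vtrivs" and W: "W \<subseteq> tdom s0"
    and m: "\<And>x. x \<in> W \<Longrightarrow> preserves_L X s0 x (m x)"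
    and s: "s \<in> vtrivs" "x \<in> tdom s"
  shows "preserves_L X s x (extend_section s0 W m s x)"
proof (cases "x \<in> W")
  case True
  then have x0: "x \<in> tdom s0" using W by blast
  obtain a where a: "m x *v unit_vec s0 x = a *s unit_vec s0 x"
    using m[OF True] preserves_L_iff[OF s0 x0] by blast
  have "extend_section s0 W m s x *v unit_vec s x
      = transT X s0 s x *v (m x *v (transT X s s0 x *v unit_vec s x))"
    using True by (simp add: extend_section_def matrix_vector_mul_assoc matrix_mul_assoc)
  also have "\<dots> = (hctr s s0 x * a * hctr s0 s x) *s unit_vec s x"
    by (simp add: transT_unit_vec[OF s s0 x0] transT_unit_vec[OF s0 x0 s] vector_scalar_commute a mult.assoc)
  finally show ?thesis using preserves_L_iff[OF s] by blast
next
  case False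
  then have "extend_section s0 W m s x *v unit_vec s x = 0 *s unit_vec s x"
    by (simp add: extend_section_def)
  then show ?thesis using preserves_L_iff[OF s] by blast
qed

text \<open>
  The trace does not see the change of frame, and a two-form on the plane is multiplied by the Jacobian.
\<close>

lemma trace_curvature_extend:
  assumes A: "smooth_form X A" "gauge_compatible A"
    and s0: "s0 \<in> vtrivs" "x \<in> tdom s0" and s: "s \<in> vtrivs" "x \<in> tdom s" and x: "x \<in> W"
  shows "trace (curvature A s x 1 \<i> ** extend_section s0 W m s x)
    = of_real (jac (tchart s) (tchart s0) x) * trace (curvature A s0 x 1 \<i> ** m x)"
proof -
  let ?T = "transT X s s0 x" and ?T' = "transT X s0 s x"
  let ?F = "curvature A s x 1 \<i>" and ?G = "curvature A s0 x 1 \<i>"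
  let ?J = "jac (tchart s) (tchart s0) x"
  have "trace (?F ** extend_section s0 W m s x) = trace ((?F ** ?T' ** m x) ** ?T)"
    using x by (simp add: extend_section_def matrix_mul_assoc)
  also have "\<dots> = trace ((?T ** ?F) ** ?T' ** m x)"
    using trace_mul_sym[of "?F ** ?T' ** m x" ?T] by (simp add: matrix_mul_assoc)
  also have "?T ** ?F = ?J *\<^sub>R (?G ** ?T)" by (rule curvature_transform_jac[OF A s s0, symmetric])
  also have "?J *\<^sub>R (?G ** ?T) ** ?T' ** m x = ?J *\<^sub>R (?G ** (?T ** ?T') ** m x)"
    by (simp add: matrix_scaleR_left matrix_mul_assoc)
  also have "?T ** ?T' = mat 1" by (rule transT_inverse[OF s0 s])
  finally show ?thesis
    by (simp add: linear_scale[OF bounded_linear.linear[OF bounded_linear_trace]] scaleR_conv_of_real[where 'a=complex])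
qed

lemma chart_sign_continuous_on:
  assumes "c \<in> atlas X"
  shows "continuous_on (fst c) (chart_sign X c)"
proof -
  have "isCont (chart_sign X c) x" if x: "x \<in> fst c" for x
  proof -
    obtain W where W: "open W" "x \<in> W" "\<And>y. y \<in> W \<Longrightarrow> chart_sign X c y = chart_sign X c x"
      using chart_sign_locally_constant[OF assms x] by metis
    have "continuous_on W (chart_sign X c)"
      using continuous_on_cong[of W W "chart_sign X c" "\<lambda>_. chart_sign X c x"] W(3) by simp
    then show ?thesis using W continuous_on_eq_continuous_at by blast
  qed
  then show ?thesis by (simp add: continuous_at_imp_continuous_on)
qed

definition patch_integral ::
    "('a, 'j, 'n) triv \<Rightarrow> ('a \<Rightarrow> real) \<Rightarrow> (('a, 'j, 'n) triv \<Rightarrow> 'a \<Rightarrow> complex) \<Rightarrow> complex" where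
  "patch_integral s r \<omega> = set_lebesgue_integral lborel (chart_image (tchart s) (tdom s))
     (\<lambda>z. let x = chart_inv (tchart s) z in complex_of_real (r x * chart_sign X (tchart s) x) * \<omega> s x)"

lemma surface_integral_partition:
  obtains m :: nat and s r where
    "\<And>\<omega>. surface_integral X \<omega> = (\<Sum>i<m. patch_integral (s i) (r i) \<omega>)"
    "\<And>i. i < m \<Longrightarrow> s i \<in> vtrivs" "\<And>i. i < m \<Longrightarrow> smooth UNIV (r i)"
    "\<And>i x. i < m \<Longrightarrow> 0 \<le> r i x" "\<And>i. i < m \<Longrightarrow> closure {x. r i x \<noteq> 0} \<subseteq> tdom (s i)"
    "\<And>x. (\<Sum>i<m. r i x) = (1 :: real)"
proof -
  define P where "P = (SOME P :: nat \<times> (nat \<Rightarrow> ('a, 'j, 'n) triv) \<times> (nat \<Rightarrow> 'a \<Rightarrow> real). partition_of_unity X P)"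
  have P: "partition_of_unity X P"
    unfolding P_def using partition_of_unity_exists by (rule someI_ex)
  obtain m s r where msr: "P = (m, s, r)" by (cases P)
  have si: "surface_integral X \<omega> = (\<Sum>i<m. patch_integral (s i) (r i) \<omega>)" for \<omega>
    unfolding surface_integral_def P_def[symmetric] msr by (simp add: patch_integral_def)
  have *: "\<And>i. i < m \<Longrightarrow> s i \<in> vtrivs \<and> smooth UNIV (r i) \<and> (\<forall>x. 0 \<le> r i x) \<and>
      closure {x. r i x \<noteq> 0} \<subseteq> tdom (s i)" and **: "\<And>x. (\<Sum>i<m. r i x) = 1"
    using P unfolding msr partition_of_unity_def by simp_all
  show ?thesis by (rule that[OF si _ _ _ _ **]) (use * in auto)
qed

text \<open>
  Suppose that the trace is nonzero at \<open>x0\<close>. The test section is \<open>M0\<close>, corrected to preserve \<open>L\<close> near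
  \<open>x0\<close>, times a bump function and a constant of suitable phase. All charts contribute to its integral
  with the same sign, because the Jacobians of the coordinate changes and the signs of the charts
  compensate each other.
\<close>

lemma L_parabolic_imp_pointwise:
  assumes A: "smooth_form X A" "gauge_compatible A" and par: "L_parabolic X A"
    and s0: "s0 \<in> vtrivs" "x0 \<in> tdom s0" and M0: "M0 \<in> parabolic_L X s0 x0"
  shows "trace (curvature A s0 x0 1 \<i> ** M0) = 0"
proof (rule ccontr)
  assume nz: "trace (curvature A s0 x0 1 \<i> ** M0) \<noteq> 0"
  let ?o = "tchart s0"
  note c0 = trivD(2)[OF s0(1)] trivD(7)[OF s0]
  define e where "e = unit_vec s0"
  obtain k where k: "e x0 $ k \<noteq> 0"
    using unit_vec_nonzero[OF s0] by (auto simp: e_def vec_eq_iff)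
  have se: "smooth (tdom s0) (\<lambda>x. e x $ i)" for i
    unfolding e_def by (rule smooth_unit_vec[OF s0(1)])
  define W1 where "W1 = tdom s0 \<inter> (\<lambda>x. e x $ k) -` (- {0})"
  have W1: "open W1" "x0 \<in> W1" "W1 \<subseteq> tdom s0" "\<And>x. x \<in> W1 \<Longrightarrow> e x $ k \<noteq> 0"
    unfolding W1_def using k s0
    by (auto intro!: continuous_open_preimage[OF smooth_fn_continuous_on[OF se trivD(1)[OF s0(1)]] trivD(1)[OF s0(1)]])
  define Mt where "Mt x = stabilise k (e x) M0" for x
  have sMt: "smooth W1 Mt"
    unfolding Mt_def[abs_def]
    by (rule smooth_stabilise[OF W1(1) smooth_fn_subset[OF se W1(3)] W1(4)])
  obtain a where "M0 *v e x0 = a *s e x0"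
    using M0 preserves_L_iff[OF s0] by (auto simp: parabolic_L_def e_def)
  then have Mt_x0: "Mt x0 = M0" unfolding Mt_def by (rule stabilise_fixed[OF k])
  have tr_Mt: "trace (Mt x) = 0" if "x \<in> W1" for x
    using trace_stabilise[OF W1(4)[OF that]] M0 by (simp add: Mt_def parabolic_L_def)
  have pres_Mt: "preserves_L X s0 x (Mt x)" if "x \<in> W1" for x
    using stabilise_vector[OF W1(4)[OF that], of M0] that W1(3) preserves_L_iff[OF s0(1), of x]
    by (auto simp: Mt_def e_def)
  define g where "g x = trace (curvature A s0 x 1 \<i> ** Mt x)" for x
  have sg: "smooth W1 g"
    unfolding g_def[abs_def]
    by (intro smooth_fn_bounded_linear[OF bounded_linear_trace W1(1)] smooth_fn_matrix_mult W1(1)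
        smooth_fn_subset[OF smooth_curvature[OF A(1) s0(1)] W1(3)] sMt)
  have g0: "g x0 \<noteq> 0" using nz by (simp add: g_def Mt_x0)
  obtain W3 where W3: "open W3" "x0 \<in> W3" "\<And>y. y \<in> W3 \<Longrightarrow> chart_sign X ?o y = chart_sign X ?o x0"
    using chart_sign_locally_constant[OF c0] by metis
  \<comment> \<open>On \<open>W\<close> the phase of \<open>g\<close> stays within a right angle of its value at \<open>x0\<close>, and the sign of
    the chart is constant.\<close>
  define W where "W = (W1 \<inter> (\<lambda>x. Re (cnj (g x0) * g x)) -` {0<..}) \<inter> W3"
  have "open (W1 \<inter> (\<lambda>x. Re (cnj (g x0) * g x)) -` {0<..})"
    by (rule continuous_open_preimage[OF _ W1(1)])
      (auto intro!: continuous_intros smooth_fn_continuous_on[OF sg W1(1)])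
  then have oW: "open W" unfolding W_def using W3(1) by blast
  have "0 < Re (cnj (g x0) * g x0)"
  proof -
    have "cnj (g x0) * g x0 = of_real ((cmod (g x0))\<^sup>2)"
      using complex_norm_square[of "g x0"] by (simp add: mult.commute)
    then show ?thesis using g0 by simp
  qed
  then have x0W: "x0 \<in> W" unfolding W_def using W1(2) W3(2) by simp
  have WW1: "W \<subseteq> W1" by (auto simp: W_def)
  then have WD: "W \<subseteq> tdom s0" using W1(3) by blast
  have Wpos: "0 < Re (cnj (g x0) * g x)" if "x \<in> W" for x using that by (simp add: W_def)
  obtain \<beta> :: "'a \<Rightarrow> real" where \<beta>: "smooth UNIV \<beta>" "\<And>y. 0 \<le> \<beta> y" "0 < \<beta> x0"
      "closure {y. \<beta> y \<noteq> 0} \<subseteq> W"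
    using bump_function_exists[OF oW x0W] by blast
  define \<sigma> where "\<sigma> = chart_sign X ?o x0"
  \<comment> \<open>This phase makes the integrand a nonnegative multiple of \<open>cnj (g x0) * g x\<close>.\<close>
  define \<kappa> where "\<kappa> = of_real \<sigma> * cnj (g x0)"
  define m where "m x = \<beta> x *\<^sub>R cscale \<kappa> (Mt x)" for x
  have sm: "smooth W m"
    unfolding m_def[abs_def]
    by (intro smooth_fn_bilinear[OF bounded_bilinear_scaleR] smooth_fn_bounded_linear[OF bounded_linear_cscale] oW
        smooth_fn_subset[OF \<beta>(1)] smooth_fn_subset[OF sMt WW1]) auto
  have m_tr: "trace (m x) = 0" if "x \<in> W" for x
    using tr_Mt WW1 that
    by (auto simp: m_def linear_scale[OF bounded_linear.linear[OF bounded_linear_trace]] trace_cscale)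
  have m_eq: "m x = cscale (of_real (\<beta> x) * \<kappa>) (Mt x)" for x
    by (simp add: m_def cscale_def vec_eq_iff scaleR_conv_of_real[where 'a=complex] mult.assoc)
  have m_pres: "preserves_L X s0 x (m x)" if x: "x \<in> W" for x
  proof -
    have xs: "x \<in> tdom s0" using x WD by blast
    obtain a where "Mt x *v unit_vec s0 x = a *s unit_vec s0 x"
      using pres_Mt x WW1 preserves_L_iff[OF s0(1) xs] by blast
    then have "m x *v unit_vec s0 x = (of_real (\<beta> x) * \<kappa> * a) *s unit_vec s0 x"
      by (simp add: m_eq cscale_mult mult.assoc)
    then show ?thesis using preserves_L_iff[OF s0(1) xs] by blast
  qed
  define M where "M = extend_section s0 W m"
  have supp_m: "m x = 0" if "x \<notin> closure {y. \<beta> y \<noteq> 0}" for x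
  proof -
    have "\<beta> x = 0" using that closure_subset[of "{y. \<beta> y \<noteq> 0}"] by blast
    then show ?thesis by (simp add: m_def)
  qed
  have sl: "sl_section X M"
    unfolding M_def by (rule sl_section_extend[OF s0(1) oW WD sm m_tr closed_closure \<beta>(4) supp_m])
  have "\<forall>s\<in>vtrivs. \<forall>x\<in>tdom s. preserves_L X s x (M s x)"
    unfolding M_def using preserves_L_extend[OF s0(1) WD m_pres] by blast
  then have int0: "surface_integral X (\<lambda>s x. trace (curvature A s x 1 \<i> ** M s x)) = 0"
    using par sl unfolding L_parabolic_def by blast

  obtain n :: nat and s r where P:
    "\<And>\<omega>. surface_integral X \<omega> = (\<Sum>i<n. patch_integral (s i) (r i) \<omega>)"
    and si: "\<And>i. i < n \<Longrightarrow> s i \<in> vtrivs" and r: "\<And>i. i < n \<Longrightarrow> smooth UNIV (r i)"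
    "\<And>i x. i < n \<Longrightarrow> 0 \<le> r i x" "\<And>i. i < n \<Longrightarrow> closure {x. r i x \<noteq> 0} \<subseteq> tdom (s i)"
    "\<And>x. (\<Sum>i<n. r i x) = (1 :: real)"
    by (rule surface_integral_partition) blast
  define \<omega> where "\<omega> i x = complex_of_real (r i x * chart_sign X (tchart (s i)) x) * trace (curvature A (s i) x 1 \<i> ** M (s i) x)" for i x
  define U where "U i = chart_image (tchart (s i)) (tdom (s i))" for i
  define f where "f i z = \<omega> i (chart_inv (tchart (s i)) z)" for i z
  have sum0: "(\<Sum>i<n. set_lebesgue_integral lborel (U i) (f i)) = 0"
    using int0 unfolding P U_def f_def \<omega>_def patch_integral_def Let_def .
  have Re_\<omega>: "Re (\<omega> i x) = (if x \<in> W then r i x * \<bar>jac (tchart (s i)) ?o x\<bar> * \<beta> x * Re (cnj (g x0) * g x) else 0)"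
    if i: "i < n" and x: "x \<in> tdom (s i)" for i x
  proof (cases "x \<in> W")
    case True
    then have xs0: "x \<in> tdom s0" using WD by blast
    let ?J = "jac (tchart (s i)) ?o x"
    have "chart_sign X ?o x = \<sigma>" using True W3(3) by (simp add: W_def \<sigma>_def)
    then have sgnJ: "chart_sign X (tchart (s i)) x * ?J = \<sigma> * \<bar>?J\<bar>"
      using chart_sign_change[OF trivD(2)[OF si[OF i]] trivD(7)[OF si[OF i] x] c0(1) trivD(7)[OF s0(1) xs0]] by simp
    have "trace (curvature A (s i) x 1 \<i> ** M (s i) x) = of_real ?J * (of_real (\<beta> x) * \<kappa> * g x)"
      unfolding M_def trace_curvature_extend[OF A s0(1) xs0 si[OF i] x True]
      by (simp add: m_eq cscale_mult trace_cscale g_def)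
    then have "\<omega> i x = of_real (r i x) * of_real (chart_sign X (tchart (s i)) x * ?J) * (of_real (\<beta> x) * \<kappa> * g x)"
      by (simp add: \<omega>_def)
    also have "\<dots> = of_real (r i x * \<bar>?J\<bar> * \<beta> x * (\<sigma> * \<sigma>)) * (cnj (g x0) * g x)"
      unfolding sgnJ \<kappa>_def by (simp add: mult_ac)
    also have "\<sigma> * \<sigma> = 1" unfolding \<sigma>_def by (rule chart_sign_square)
    finally have "\<omega> i x = of_real (r i x * \<bar>?J\<bar> * \<beta> x) * (cnj (g x0) * g x)" by simp
    moreover have "Re (of_real a * z) = a * Re z" for a z by simp
    ultimately show ?thesis using True by (simp only: if_True)
  next
    case False
    then show ?thesis by (simp add: \<omega>_def M_def extend_section_def matrix_algebra_simps trace_def)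
  qed
  have main: "0 \<le> Re (set_lebesgue_integral lborel (U i) (f i))"
    "z0 \<in> U i \<Longrightarrow> 0 < Re (f i z0) \<Longrightarrow> 0 < Re (set_lebesgue_integral lborel (U i) (f i))" if i: "i < n" for i z0
  proof -
    let ?c = "tchart (s i)"
    note s = si[OF i] note c = trivD(2)[OF s]
    let ?S = "closure {x. r i x \<noteq> 0}"
    define K where "K = snd ?c ` ?S"
    have S: "compact ?S" using compact_surface by (metis closed_Int_compact closed_closure inf_top_right)
    have Sdom: "?S \<subseteq> tdom (s i)" by (rule r(3)[OF i])
    have "continuous_on ?S (snd ?c)"
      using chart_facts(3)[OF c] Sdom trivD(4)[OF s] by (auto simp: homeomorphism_def intro: continuous_on_subset)
    then have K: "compact K" unfolding K_def using S by (rule compact_continuous_image)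
    have KU: "K \<subseteq> U i" unfolding K_def U_def using Sdom triv_image[OF s] by blast
    have U: "open (U i)" unfolding U_def by (rule open_triv_image[OF s])
    have ci: "continuous_on (U i) (chart_inv ?c)"
      using chart_facts(3)[OF c] chart_image_mono[of "tdom (s i)" UNIV ?c]
      by (auto simp: homeomorphism_def U_def intro: continuous_on_subset)
    have img: "chart_inv ?c ` U i \<subseteq> tdom (s i)"
      unfolding U_def using chart_imageD(2)[OF c] by blast
    have cont: "continuous_on (tdom (s i)) (\<omega> i)"
    proof -
      have "continuous_on (tdom (s i)) (r i)"
        using smooth_fn_continuous_on[OF r(1)[OF i] open_UNIV] continuous_on_subset by blast
      moreover have "continuous_on (tdom (s i)) (chart_sign X ?c)"
        using chart_sign_continuous_on[OF c] trivD(4)[OF s] continuous_on_subset by blast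
      moreover have "smooth (tdom (s i)) (\<lambda>x. trace (curvature A (s i) x 1 \<i> ** M (s i) x))"
        using sl s unfolding sl_section_def
        by (intro smooth_fn_bounded_linear[OF bounded_linear_trace] smooth_fn_matrix_mult smooth_curvature A(1) trivD(1)) auto
      then have "continuous_on (tdom (s i)) (\<lambda>x. trace (curvature A (s i) x 1 \<i> ** M (s i) x))"
        by (rule smooth_fn_continuous_on[OF _ trivD(1)[OF s]])
      ultimately show ?thesis unfolding \<omega>_def[abs_def] by (intro continuous_intros)
    qed
    have cf: "continuous_on (U i) (f i)"
      unfolding f_def[abs_def] by (rule continuous_on_compose2[OF cont ci img])
    have supp: "f i z = 0" if z: "z \<in> U i" "z \<notin> K" for z
    proof -
      have "chart_inv ?c z \<notin> ?S"
        using z chart_imageD(3)[OF c] unfolding K_def U_def by (metis image_eqI)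
      then have "r i (chart_inv ?c z) = 0" using closure_subset[of "{x. r i x \<noteq> 0}"] by blast
      then show ?thesis by (simp add: f_def \<omega>_def)
    qed
    have nonneg: "0 \<le> Re (f i z)" if z: "z \<in> U i" for z
    proof -
      have "chart_inv ?c z \<in> tdom (s i)" using img z by blast
      then have "Re (f i z) = (if chart_inv ?c z \<in> W then r i (chart_inv ?c z) * \<bar>jac ?c ?o (chart_inv ?c z)\<bar>
          * \<beta> (chart_inv ?c z) * Re (cnj (g x0) * g (chart_inv ?c z)) else 0)"
        unfolding f_def by (rule Re_\<omega>[OF i])
      moreover have "0 \<le> Re (cnj (g x0) * g (chart_inv ?c z))" if "chart_inv ?c z \<in> W"
        using Wpos[OF that] by (rule less_imp_le)
      ultimately show ?thesis
        using r(2)[OF i] \<beta>(2) by (auto simp only: split: if_split intro!: mult_nonneg_nonneg)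
    qed
    show "0 \<le> Re (set_lebesgue_integral lborel (U i) (f i))"
      "z0 \<in> U i \<Longrightarrow> 0 < Re (f i z0) \<Longrightarrow> 0 < Re (set_lebesgue_integral lborel (U i) (f i))"
      by (rule Re_set_integral_nonneg[OF U cf K KU supp nonneg]; assumption)+
  qed
  \<comment> \<open>Some function of the partition is positive at \<open>x0\<close>, and its term is positive.\<close>
  obtain i where i: "i < n" "0 < r i x0"
  proof -
    have "\<exists>i<n. r i x0 \<noteq> 0" using r(4)[of x0] by (metis lessThan_iff sum.neutral zero_neq_one)
    then show ?thesis using r(2) that by (metis less_eq_real_def)
  qed
  have "x0 \<in> {x. r i x \<noteq> 0}" using i(2) by simp
  then have xi: "x0 \<in> tdom (s i)" by (rule subsetD[OF r(3)[OF i(1)] subsetD[OF closure_subset]])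
  have "snd (tchart (s i)) x0 \<in> U i" unfolding U_def by (rule triv_image[OF si[OF i(1)] xi])
  moreover have "0 < Re (f i (snd (tchart (s i)) x0))"
    unfolding f_def chart_inv_snd[OF trivD(2)[OF si[OF i(1)]] trivD(7)[OF si[OF i(1)] xi]] Re_\<omega>[OF i(1) xi]
    using i(2) \<beta>(3) Wpos[OF x0W]
      jac_nonzero[OF trivD(2)[OF si[OF i(1)]] trivD(7)[OF si[OF i(1)] xi] c0]
    unfolding if_P[OF x0W] zero_less_abs_iff[symmetric] by (intro mult_pos_pos)
  ultimately have "0 < Re (set_lebesgue_integral lborel (U i) (f i))" by (rule main(2)[OF i(1)])
  then have "0 < (\<Sum>i<n. Re (set_lebesgue_integral lborel (U i) (f i)))"
    using i(1) main(1) by (intro sum_pos2[of _ i]) auto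
  then show False using sum0 by (simp flip: Re_sum)
qed

end


section \<open>Families of connections\<close>

lemma cscale_1: "cscale 1 M = M"
  by (simp add: cscale_def vec_eq_iff)

lemma matrix_mult_sum:
  fixes M :: "'i \<Rightarrow> complex^'n^'n::finite"
  shows "(\<Sum>i\<in>I. M i) ** T = (\<Sum>i\<in>I. M i ** T)" "T ** (\<Sum>i\<in>I. M i) = (\<Sum>i\<in>I. T ** M i)"
  by (induction I rule: infinite_finite_induct) (simp_all add: matrix_algebra_simps)

lemma laurent_family_eq:
  "laurent_family N A l s x v = A 0 s x v + (\<Sum>i\<in>{- int N..int N} - {0}. cscale (l powi i) (A i s x v))"
proof -
  have "laurent_family N A l s x v = (\<Sum>i\<in>{- int N..int N}. cscale (l powi i) (A i s x v))"
    by (simp add: laurent_family_def cscale_def)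
  also have "\<dots> = cscale (l powi 0) (A 0 s x v) + (\<Sum>i\<in>{- int N..int N} - {0}. cscale (l powi i) (A i s x v))"
    by (rule sum.remove) auto
  finally show ?thesis by (simp add: cscale_1)
qed

context higher_surface
begin

lemma sl_connectionD:
  assumes "sl_connection X vol A"
  shows "smooth_form X A" "gauge_compatible A"
    "s \<in> vtrivs \<Longrightarrow> x \<in> tdom s \<Longrightarrow> cderiv (tchart s) (vol s) x v = trace (A s x v) * vol s x"
  using assms unfolding sl_connection_def gauge_compatible_def by blast+

text \<open>Connections form an affine space over the one-forms with values in \<open>sl(V)\<close>.\<close>

lemma sl_connection_laurent_family:
  assumes A0: "sl_connection X vol (A 0)"
    and A: "\<And>i. i \<in> {- int N..int N} \<Longrightarrow> i \<noteq> 0 \<Longrightarrow> sl_one_form X (A i)"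
  shows "sl_connection X vol (laurent_family N A l :: ('a, 'j, 'n) matrix_form)"
proof -
  let ?I = "{- int N..int N} - {0}"
  have I: "sl_one_form X (A i)" if "i \<in> ?I" for i using A that by blast
  have smooth_Ai: "smooth_form X (A i)" if "i \<in> ?I" for i
    using I[OF that] unfolding sl_one_form_def by blast
  have trace_Ai: "trace (A i s x v) = 0" if "i \<in> ?I" "s \<in> vtrivs" "x \<in> tdom s" for i s x v
    using I[OF that(1)] that(2,3) unfolding sl_one_form_def by blast
  have gauge_Ai: "A i s' x (transD (tchart s) (tchart s') x v) ** transT X s s' x = transT X s s' x ** A i s x v"
    if "i \<in> ?I" "s \<in> vtrivs" "s' \<in> vtrivs" "x \<in> tdom s \<inter> tdom s'" for i s s' x v
    using I[OF that(1)] that(2-) unfolding sl_one_form_def by blast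
  note A0D = sl_connectionD[OF A0]
  show ?thesis
    unfolding sl_connection_def
  proof (intro conjI ballI allI)
    show "smooth_form X (laurent_family N A l)"
      unfolding smooth_form_def
    proof (intro ballI conjI allI)
      fix s v assume s: "s \<in> vtrivs"
      have "smooth (tdom s) (\<lambda>x. A i s x v)" if "i = 0 \<or> i \<in> ?I" for i
        using that A0D(1) smooth_Ai s unfolding smooth_form_def by blast
      then show "smooth (tdom s) (\<lambda>x. laurent_family N A l s x v)"
        unfolding laurent_family_eq
        by (intro smooth_fn_add smooth_fn_sum smooth_fn_bounded_linear[OF bounded_linear_cscale] trivD(1)[OF s]) auto
    next
      fix s x assume s: "s \<in> vtrivs" "x \<in> tdom s"
      have "linear (A i s x)" if "i = 0 \<or> i \<in> ?I" for i
        using that A0D(1) smooth_Ai s unfolding smooth_form_def by blast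
      then have "linear (\<lambda>v. A 0 s x v + (\<Sum>i\<in>?I. cscale (l powi i) (A i s x v)))"
        using linear_compose[OF _ bounded_linear.linear[OF bounded_linear_cscale], unfolded o_def]
        by (intro linear_compose_add linear_compose_sum ballI) auto
      then show "linear (laurent_family N A l s x)"
        by (simp only: laurent_family_eq[symmetric])
    qed
  next
    fix s x v assume s: "s \<in> vtrivs" "x \<in> tdom s"
    have "trace (laurent_family N A l s x v) = trace (A 0 s x v) + (\<Sum>i\<in>?I. l powi i * trace (A i s x v))"
      unfolding laurent_family_eq
      by (simp add: trace_add linear_sum[OF bounded_linear.linear[OF bounded_linear_trace]] trace_cscale)
    then show "cderiv (tchart s) (vol s) x v = trace (laurent_family N A l s x v) * vol s x"
      using A0D(3)[OF s] trace_Ai s by simp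
  next
    fix s s' x v assume s: "s \<in> vtrivs" "s' \<in> vtrivs" "x \<in> tdom s \<inter> tdom s'"
    let ?D = "transD (tchart s) (tchart s') x v" and ?T = "transT X s s' x"
    have "A 0 s' x ?D ** ?T + cderiv (tchart s) (transT X s s') x v = ?T ** A 0 s x v"
      using A0D(2) s unfolding gauge_compatible_def by blast
    then show "laurent_family N A l s' x ?D ** ?T + cderiv (tchart s) (transT X s s') x v
        = ?T ** laurent_family N A l s x v"
      unfolding laurent_family_eq
      by (simp add: matrix_algebra_simps(1,4) matrix_mult_sum cscale_mult gauge_Ai[OF _ s] add.commute add.left_commute)
  qed
qed

text \<open>
  The integrand vanishes at the points of \<open>tdom (s i)\<close>, and these are the points where it is evaluated.
\<close>

lemma flat_imp_L_parabolic:
  assumes "flat X (A :: ('a, 'j, 'n) matrix_form)"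
  shows "L_parabolic X A"
  unfolding L_parabolic_def
proof (intro allI impI)
  fix M :: "('a, 'j, 'n) triv \<Rightarrow> 'a \<Rightarrow> complex^'n^'n"
  obtain n :: nat and s r where P:
    "\<And>\<omega>. surface_integral X \<omega> = (\<Sum>i<n. patch_integral (s i) (r i) \<omega>)"
    and s: "\<And>i. i < n \<Longrightarrow> s i \<in> vtrivs"
    by (rule surface_integral_partition) blast
  have zero: "indicator (chart_image (tchart (s i)) (tdom (s i))) z *\<^sub>R
      (a * trace (curvature A (s i) (chart_inv (tchart (s i)) z) 1 \<i> ** M (s i) (chart_inv (tchart (s i)) z))) = 0"
    if i: "i < n" for i z and a :: complex
  proof (cases "z \<in> chart_image (tchart (s i)) (tdom (s i))")
    case True
    then have "curvature A (s i) (chart_inv (tchart (s i)) z) 1 \<i> = 0"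
      using assms s[OF i] chart_imageD(2)[OF trivD(2)[OF s[OF i]] True] unfolding flat_def by blast
    then show ?thesis by (simp add: matrix_algebra_simps trace_def)
  qed simp
  show "surface_integral X (\<lambda>s x. trace (curvature A s x 1 \<i> ** M s x)) = 0"
    unfolding P patch_integral_def set_lebesgue_integral_def Let_def by (intro sum.neutral ballI) (simp add: zero)
qed

lemma L_parabolic_imp_curvature_in_dual:
  assumes vol: "volume_form X vol" and A: "sl_connection X vol A" and par: "L_parabolic X A"
    and s: "s \<in> vtrivs" "x \<in> tdom s"
  shows "curvature A s x 1 \<i> \<in> parabolic_L_dual X s x"
  unfolding parabolic_L_dual_def
  using trace_curvature[OF vol A s] L_parabolic_imp_pointwise[OF sl_connectionD(1,2)[OF A] par s]
  by blast

end

lemma parabolic_L_dual_subspace: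
  assumes "F \<in> parabolic_L_dual X s x" "G \<in> parabolic_L_dual X s x"
  shows "F + G \<in> parabolic_L_dual X s x" "cscale a F \<in> parabolic_L_dual X s x"
  using assms by (auto simp: parabolic_L_dual_def matrix_algebra_simps trace_add cscale_mult trace_cscale)

lemma hadjoint_add: "hadjoint H (M + N) = hadjoint H M + hadjoint H N"
  by (simp add: hadjoint_def ctranspose_add matrix_algebra_simps)

lemma hadjoint_cscale: "hadjoint H (cscale a M) = cscale (cnj a) (hadjoint H M)"
proof -
  have "ctranspose (cscale a M) = cscale (cnj a) (ctranspose M)"
    by (simp add: ctranspose_def cscale_def vec_eq_iff)
  then show ?thesis by (simp add: hadjoint_def cscale_mult)
qed

text \<open>
  The dual parabolic is a complex subspace. If it contains both \<open>F\<close> and its adjoint \<open>G\<close>, it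
  contains the self-adjoint matrices \<open>F + G\<close> and \<open>i (F - G)\<close>, both of which must vanish.
\<close>

lemma eq_0_if_adjoint_in_parabolic_L_dual:
  fixes F G :: "complex^'n^'n::finite"
  assumes comp: "parabolic_L_dual X s x \<inter> {M. trace M = 0 \<and> hadjoint H M = M} = {0}"
    and FG: "F \<in> parabolic_L_dual X s x" "G \<in> parabolic_L_dual X s x"
    and adj: "hadjoint H F = G" "hadjoint H G = F"
  shows "F = 0"
proof -
  have zero: "M = 0" if "M \<in> parabolic_L_dual X s x" "hadjoint H M = M" for M
  proof -
    have "trace M = 0" using that(1) by (simp add: parabolic_L_dual_def)
    then have "M \<in> parabolic_L_dual X s x \<inter> {M. trace M = 0 \<and> hadjoint H M = M}"
      using that by simp
    then show ?thesis unfolding comp by simp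
  qed
  have "F + G = 0"
    by (rule zero[OF parabolic_L_dual_subspace(1)[OF FG]]) (simp add: hadjoint_add adj add.commute)
  moreover have "cscale \<i> F + cscale (- \<i>) G = 0"
    by (rule zero[OF parabolic_L_dual_subspace(1)[OF parabolic_L_dual_subspace(2)[OF FG(1,1)]
            parabolic_L_dual_subspace(2)[OF FG(2,2)]]])
      (simp add: hadjoint_add hadjoint_cscale adj add.commute)
  then have "F = G" by (simp add: cscale_def vec_eq_iff)
  ultimately show "F = 0" by (simp add: vec_eq_iff)
qed


theorem proposition5p3:
  fixes X :: "('a::t2_space, 'j) hcs"
    and vol :: "('a, 'j, 'n::finite) triv \<Rightarrow> 'a \<Rightarrow> complex"
    and h :: "('a, 'j, 'n) triv \<Rightarrow> 'a \<Rightarrow> complex^'n^'n"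
    and N :: nat
    and A :: "int \<Rightarrow> ('a, 'j, 'n) matrix_form"
    and M :: "complex \<Rightarrow> ('a, 'j, 'n) matrix_form"
  defines "M \<equiv> laurent_family N A"
  assumes "closed_surface (atlas X)"
    and "higher_complex_structure CARD('n) X"
    and "half_canonical X"
    and "volume_form X vol"
    and "hermitian_structure X h"
    and "L_compatible X h"
    and "sl_connection X vol (A 0)"
    and "\<And>i. i \<in> {- int N..int N} \<Longrightarrow> i \<noteq> 0 \<Longrightarrow> sl_one_form X (A i)"
    and "\<And>l s x v. l \<noteq> 0 \<Longrightarrow> s \<in> trivs X \<Longrightarrow> x \<in> tdom s \<Longrightarrow>
           M l s x v = neg_adjoint h (M (- 1 / cnj l)) s x v"
  shows "(\<forall>l. l \<noteq> 0 \<longrightarrow> flat X (M l)) \<longleftrightarrow> (\<forall>l. l \<noteq> 0 \<longrightarrow> L_parabolic X (M l))"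
proof -
  interpret higher_surface X "TYPE('n)"
    using assms(2-4) by unfold_locales
  have conn: "sl_connection X vol (M l)" for l
    unfolding M_def by (rule sl_connection_laurent_family[of vol A N l, OF assms(8,9)])
  note smooth = sl_connectionD(1)[OF conn]
  have "flat X (M l)" if par: "\<forall>l. l \<noteq> 0 \<longrightarrow> L_parabolic X (M l)" and l: "l \<noteq> 0" for l
    unfolding flat_def
  proof (intro ballI allI)
    fix s x v w assume s: "s \<in> vtrivs" "x \<in> tdom s"
    let ?F = "\<lambda>l. curvature (M l) s x 1 \<i>"
    let ?l' = "- 1 / cnj l"
    have l': "?l' \<noteq> 0" "- 1 / cnj ?l' = l" using l by simp_all
    have dual: "?F l \<in> parabolic_L_dual X s x" if "l \<noteq> 0" for l
      using L_parabolic_imp_curvature_in_dual[OF assms(5) conn _ s] par that by blast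
    \<comment> \<open>The hypothesis on the family equates two connection forms, hence their curvatures.\<close>
    have sym: "?F l = - hadjoint (h s x) (?F (- 1 / cnj l))" if "l \<noteq> 0" for l
      by (rule curvature_neg_adjoint[OF assms(6) smooth smooth s]) (rule assms(10)[OF that s(1)])
    have neg: "- N = cscale (- 1) N" for N :: "complex^'n^'n"
      by (simp add: cscale_def vec_eq_iff)
    have "?F l = 0"
    proof (rule eq_0_if_adjoint_in_parabolic_L_dual)
      show "parabolic_L_dual X s x \<inter> {M. trace M = 0 \<and> hadjoint (h s x) M = M} = {0}"
        using assms(7) s unfolding L_compatible_def by blast
      show "?F l \<in> parabolic_L_dual X s x" by (rule dual[OF l])
      show "- ?F ?l' \<in> parabolic_L_dual X s x"
        unfolding neg by (rule parabolic_L_dual_subspace(2)[OF dual[OF l'(1)] dual[OF l'(1)]])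
      show "hadjoint (h s x) (?F l) = - ?F ?l'"
        using sym[OF l'(1)] unfolding l'(2) by simp
      show "hadjoint (h s x) (- ?F ?l') = ?F l"
        using sym[OF l] by (simp add: neg hadjoint_cscale)
    qed
    then show "curvature (M l) s x v w = 0"
      unfolding curvature_alternating[OF smooth s, of l v w] by simp
  qed
  then show ?thesis using flat_imp_L_parabolic by blast
qed

end
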